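(* Let $N\ge1$, $1\le p,q\le\infty$, $\alpha>0$. A function $f\in H^p(\mathbb B_N)$ is in $\Lambda^{p,q}_\alpha(\mathbb B_N)$ if and only if the sequence $\{2^{\nu\alpha}E_{2^\nu}(f)_p\}_{\nu=0}^\infty$ is in $\ell^q$.
   Context: $\mathbb B_N$ is the unit ball of $\mathbb C^N$, $\mathbb S_N=\partial\mathbb B_N$, $\sigma$ is the normalized Lebesgue measure on $\mathbb S_N$, and $H(\mathbb B_N)$ is the space of holomorphic functions on $\mathbb B_N$. For $0<r<1$, $M_p(r,g)=\left(\int_{\mathbb S_N}|g(r\zeta)|^p\,d\sigma(\zeta)\right)^{1/p}$ for $p<\infty$ and $M_\infty(r,g)=\operatorname{ess\,sup}_{\zeta\in\mathbb S_N}|g(r\zeta)|$. $H^p(\mathbb B_N)$ is the space of $f\in H(\mathbb B_N)$ with $\|f\|_p:=\sup_{0<r<1}M_p(r,f)<\infty$. For $\beta\in\mathbb R$, $\|g\|_{p,q,\beta}=\left(2N\int_0^1M_p^q(r,g)(1-r^2)^{q\beta-1}r^{2N-1}\,dr\right)^{1/q}$ for $q<\infty$ and $\|g\|_{p,\infty,\beta}=\operatorname{ess\,sup}_{0\le r<1}(1-r^2)^\beta M_p(r,g)$. If $f=\sum_{k\ge0}f_k$ is the homogeneous expansion, then $\mathcal R^sf=\sum_{k\ge1}k^sf_k$. $\Lambda^{p,q}_\alpha(\mathbb B_N)$ is the set of $f\in H(\mathbb B_N)$ with $\|\mathcal R^sf\|_{p,q,s-\alpha}<\infty$, where $s$ is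 the smallest integer greater than $\alpha$. For $f\in H^p(\mathbb B_N)$, $E_m(f)_p=\inf\{\|f-P\|_p:P\in\mathscr P_m(\mathbb B_N)\}$, where $\mathscr P_m(\mathbb B_N)$ is the set of all (holomorphic) polynomials in $z\in\mathbb C^N$ of degree $\le m$. *)

theory Defs
  imports "HOL-Probability.Probability" "HOL-Complex_Analysis.Complex_Analysis"
begin

text \<open>
  \<open>\<complex>\<^sup>N\<close> is the type \<open>complex ^ 'n\<close> with \<open>N = CARD('n)\<close>; its norm is the Euclidean one.  The exponents
  \<open>p, q \<in> [1, \<infinity>]\<close> have type \<open>ennreal\<close>, and all norms take values in \<open>ennreal\<close>, so that they are
  defined for every function and their finiteness is a genuine condition.
\<close>

section \<open>Holomorphic functions and polynomials on \<open>\<complex>\<^sup>N\<close>\<close>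

abbreviation unit_ball :: "(complex ^ 'n) set" where
  "unit_ball \<equiv> ball 0 1"

text \<open>Fr\'echet differentiability with a complex linear derivative (additivity of \<open>D\<close> is part of
  \<open>has_derivative\<close>).\<close>

definition holomorphic_cvec_on :: "(complex ^ 'n \<Rightarrow> complex) \<Rightarrow> (complex ^ 'n) set \<Rightarrow> bool" where
  "holomorphic_cvec_on f S \<longleftrightarrow>
     (\<forall>z\<in>S. \<exists>D. (f has_derivative D) (at z) \<and> (\<forall>c v. D (c *s v) = c * D v))"

definition monomial_cvec :: "('n::finite \<Rightarrow> nat) \<Rightarrow> complex ^ 'n \<Rightarrow> complex" where
  "monomial_cvec a z = (\<Prod>i\<in>UNIV. (z $ i) ^ a i)"

definition polynomials_le :: "nat \<Rightarrow> (complex ^ 'n \<Rightarrow> complex) set" where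
  "polynomials_le m =
     {P. \<exists>c. P = (\<lambda>z. \<Sum>a | (\<Sum>i\<in>UNIV. a i) \<le> m. c a * monomial_cvec a z)}"

definition homogeneous_polynomials :: "nat \<Rightarrow> (complex ^ 'n \<Rightarrow> complex) set" where
  "homogeneous_polynomials k =
     {P. \<exists>c. P = (\<lambda>z. \<Sum>a | (\<Sum>i\<in>UNIV. a i) = k. c a * monomial_cvec a z)}"

text \<open>The index sets of these sums are finite, so the sums are not junk values.\<close>

lemma finite_multi_indices_le: "finite {a :: 'n::finite \<Rightarrow> nat. (\<Sum>i\<in>UNIV. a i) \<le> m}"
proof (rule finite_subset)
  show "{a :: 'n \<Rightarrow> nat. (\<Sum>i\<in>UNIV. a i) \<le> m} \<subseteq> (\<Pi>\<^sub>E i\<in>UNIV. {..m})"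
  proof
    fix a :: "'n \<Rightarrow> nat"
    assume "a \<in> {a. (\<Sum>i\<in>UNIV. a i) \<le> m}"
    then have "(\<Sum>i\<in>UNIV. a i) \<le> m" by simp
    moreover have "a i \<le> (\<Sum>i\<in>UNIV. a i)" for i
      by (rule member_le_sum) auto
    ultimately show "a \<in> (\<Pi>\<^sub>E i\<in>UNIV. {..m})"
      by (auto intro: order_trans)
  qed
qed (auto intro!: finite_PiE)

lemma finite_multi_indices_eq: "finite {a :: 'n::finite \<Rightarrow> nat. (\<Sum>i\<in>UNIV. a i) = k}"
  by (rule finite_subset[OF _ finite_multi_indices_le[of k]]) auto

definition homogeneous_expansion ::
    "(complex ^ 'n \<Rightarrow> complex) \<Rightarrow> (nat \<Rightarrow> complex ^ 'n \<Rightarrow> complex) \<Rightarrow> bool" where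
  "homogeneous_expansion f F \<longleftrightarrow>
     (\<forall>k. F k \<in> homogeneous_polynomials k) \<and> (\<forall>z\<in>unit_ball. (\<lambda>k. F k z) sums f z)"

definition homogeneous_part :: "(complex ^ 'n \<Rightarrow> complex) \<Rightarrow> nat \<Rightarrow> complex ^ 'n \<Rightarrow> complex" where
  "homogeneous_part f = (THE F. homogeneous_expansion f F)"

lemma homogeneous_polynomials_scale:
  assumes "P \<in> homogeneous_polynomials k"
  shows "P (w *s z) = w ^ k * P z"
proof -
  obtain c where c: "P = (\<lambda>z. \<Sum>a | (\<Sum>i\<in>UNIV. a i) = k. c a * monomial_cvec a z)"
    using assms by (auto simp: homogeneous_polynomials_def)
  have "monomial_cvec a (w *s z) = w ^ (\<Sum>i\<in>UNIV. a i) * monomial_cvec a z" for a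
    by (simp add: monomial_cvec_def power_mult_distrib prod.distrib power_sum)
  then show ?thesis
    by (simp add: c sum_distrib_left mult_ac)
qed

text \<open>The homogeneous expansion is unique, so \<open>homogeneous_part\<close> picks the intended one.\<close>

lemma homogeneous_expansion_unique:
  assumes F: "homogeneous_expansion f F" and G: "homogeneous_expansion f G"
  shows "F = G"
proof (rule ext, rule ext)
  fix k and z :: "complex ^ 'a"
  define r where "r = 1 / (1 + norm z)"
  have r: "r > 0" "r * norm z < 1"
    by (auto simp: r_def field_simps add_pos_nonneg)
  define H where "H = (\<lambda>k. F k z - G k z)"
  have "(\<lambda>k. H k * w ^ k) sums 0" if w: "norm w < r" for w
  proof -
    have "w *s z \<in> unit_ball"
    proof -
      have "norm (w *s z) = norm w * norm z"
        by (simp add: norm_vec_def norm_mult L2_set_right_distrib)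
      also have "\<dots> \<le> r * norm z"
        using w by (intro mult_right_mono) auto
      finally show ?thesis using r by simp
    qed
    then have "(\<lambda>k. F k (w *s z) - G k (w *s z)) sums (f (w *s z) - f (w *s z))"
      using F G unfolding homogeneous_expansion_def by (intro sums_diff) auto
    moreover have "F k (w *s z) - G k (w *s z) = H k * w ^ k" for k
    proof -
      have "F k \<in> homogeneous_polynomials k" "G k \<in> homogeneous_polynomials k"
        using F G by (auto simp: homogeneous_expansion_def)
      then show ?thesis
        by (simp add: homogeneous_polynomials_scale H_def algebra_simps)
    qed
    ultimately show ?thesis by simp
  qed
  note sums = this
  have H0: "H 0 = 0"
    using sums[of 0] r(1) by simp
  have "H k = 0"
  proof (rule ccontr)
    assume "H k \<noteq> 0"
    moreover from this H0 have "k > 0" by (cases k) auto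
    ultimately obtain e where e: "e > 0" "\<And>w. w \<in> cball (0::complex) e - {0} \<Longrightarrow> (0::complex) \<noteq> 0"
      using powser_0_nonzero[of r 0 H "\<lambda>_. 0" k] sums r(1) by auto
    then show False using e(2)[of "of_real e"] by simp
  qed
  then show "F k z = G k z" by (simp add: H_def)
qed

section \<open>Integral means and mixed norms\<close>

text \<open>Normalized Lebesgue measure on the unit sphere: by polar coordinates, \<open>\<sigma>(A)\<close> is the volume of the
  cone \<open>{t\<zeta> | 0 < t < 1, \<zeta> \<in> A}\<close> divided by the volume of the unit ball, that is, the image of
  the uniform distribution on the ball under \<open>z \<mapsto> z / |z|\<close> (\<open>sgn 0 = 0\<close>, but \<open>{0}\<close> is a null set).\<close>

definition sphere_measure :: "(complex ^ 'n) measure" where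
  "sphere_measure = restrict_space (distr (uniform_measure lborel unit_ball) borel sgn) (sphere 0 1)"

lemma prob_space_sphere_measure: "prob_space (sphere_measure :: (complex ^ 'n) measure)"
proof
  let ?B = "unit_ball :: (complex ^ 'n) set" and ?S = "sphere 0 1 :: (complex ^ 'n) set"
  have sgn: "sgn \<in> borel_measurable (borel :: (complex ^ 'n) measure)"
    unfolding sgn_div_norm[abs_def] by measurable
  have B: "emeasure lborel ?B \<noteq> 0" "emeasure lborel ?B \<noteq> \<infinity>"
    using less_imp_neq[OF unit_ball_vol_pos, of "real CARD('n) * 2"] by (auto simp: emeasure_ball)
  interpret U: prob_space "uniform_measure lborel ?B"
    using B by (rule prob_space_uniform_measure)
  have S: "?S \<in> sets borel" by simp
  have pre: "sgn -` ?S = - {0 :: complex ^ 'n}"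
    by (auto simp: norm_sgn split: if_splits)
  have "emeasure sphere_measure (space sphere_measure :: (complex ^ 'n) set)
      = emeasure (distr (uniform_measure lborel ?B) borel sgn) ?S"
    unfolding sphere_measure_def using S by (simp add: space_restrict_space emeasure_restrict_space)
  also have "\<dots> = emeasure (uniform_measure lborel ?B) (- {0})"
    using sgn S by (subst emeasure_distr) (auto simp: pre)
  also have "\<dots> = emeasure lborel (?B - {0}) / emeasure lborel ?B"
    by (simp add: Diff_eq)
  also have "emeasure lborel (?B - {0}) = emeasure lborel ?B"
    by (intro emeasure_Diff_null_set) auto
  also have "emeasure lborel ?B / emeasure lborel ?B = 1"
    using B by (simp add: ennreal_divide_self top.not_eq_extremum)
  finally show "emeasure sphere_measure (space sphere_measure :: (complex ^ 'n) set) = 1" .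
qed

text \<open>\<open>x\<^sup>a\<close> on \<open>[0, \<infinity>]\<close> for \<open>a > 0\<close>.\<close>

definition ennpowr :: "ennreal \<Rightarrow> real \<Rightarrow> ennreal" where
  "ennpowr x a = (if x = \<infinity> then \<infinity> else ennreal (enn2real x powr a))"

definition integral_mean :: "ennreal \<Rightarrow> real \<Rightarrow> (complex ^ 'n \<Rightarrow> complex) \<Rightarrow> ennreal" where
  "integral_mean p r g =
     (if p = \<infinity> then esssup sphere_measure (\<lambda>\<zeta>. ennreal (norm (g (r *\<^sub>R \<zeta>))))
      else ennpowr (\<integral>\<^sup>+ \<zeta>. ennreal (norm (g (r *\<^sub>R \<zeta>)) powr enn2real p) \<partial>sphere_measure)
             (1 / enn2real p))"

definition hardy_norm :: "ennreal \<Rightarrow> (complex ^ 'n \<Rightarrow> complex) \<Rightarrow> ennreal" where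
  "hardy_norm p f = (SUP r\<in>{0<..<1}. integral_mean p r f)"

definition hardy_space :: "ennreal \<Rightarrow> (complex ^ 'n \<Rightarrow> complex) set" where
  "hardy_space p = {f. holomorphic_cvec_on f unit_ball \<and> hardy_norm p f < \<infinity>}"

definition mixed_norm :: "ennreal \<Rightarrow> ennreal \<Rightarrow> real \<Rightarrow> (complex ^ 'n \<Rightarrow> complex) \<Rightarrow> ennreal" where
  "mixed_norm p q \<beta> g =
     (if q = \<infinity> then
        esssup (restrict_space lborel {0..<1})
          (\<lambda>r. ennreal ((1 - r\<^sup>2) powr \<beta>) * integral_mean p r g)
      else
        ennpowr
          (2 * of_nat CARD('n) *
            (\<integral>\<^sup>+ r\<in>{0<..<1}. ennpowr (integral_mean p r g) (enn2real q) *
               ennreal ((1 - r\<^sup>2) powr (enn2real q * \<beta> - 1) * r ^ (2 * CARD('n) - 1)) \<partial>lborel))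
          (1 / enn2real q))"

section \<open>The spaces \<open>\<Lambda>\<close> and best approximation\<close>

definition radial_derivative :: "real \<Rightarrow> (complex ^ 'n \<Rightarrow> complex) \<Rightarrow> complex ^ 'n \<Rightarrow> complex" where
  "radial_derivative s f z =
     (\<Sum>j. of_real (real (Suc j) powr s) * homogeneous_part f (Suc j) z)"

definition Lambda_space ::
    "ennreal \<Rightarrow> ennreal \<Rightarrow> real \<Rightarrow> (complex ^ 'n \<Rightarrow> complex) set" where
  "Lambda_space p q \<alpha> =
     {f. holomorphic_cvec_on f unit_ball \<and>
         (let s = real_of_int (LEAST k :: int. \<alpha> < real_of_int k)
          in mixed_norm p q (s - \<alpha>) (radial_derivative s f) < \<infinity>)}"

definition best_approx :: "nat \<Rightarrow> ennreal \<Rightarrow> (complex ^ 'n \<Rightarrow> complex) \<Rightarrow> ennreal" where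
  "best_approx m p f = (INF P\<in>polynomials_le m. hardy_norm p (\<lambda>z. f z - P z))"

text \<open>\<open>\<ell>\<^sup>q\<close>, for sequences in \<open>[0, \<infinity>]\<close>; an infinite term rules out membership.\<close>

definition ell :: "ennreal \<Rightarrow> (nat \<Rightarrow> ennreal) set" where
  "ell q = {x. if q = \<infinity> then (SUP n. x n) < \<infinity> else (\<Sum>n. ennpowr (x n) (enn2real q)) < \<infinity>}"

end

theory Submission
  imports Defs
begin

text \<open>
  Write \<open>M(r, g)\<close> for the \<open>L\<^sup>p\<close> mean over the sphere of radius \<open>r\<close>, \<open>f = \<Sum>k. f\<^sub>k\<close> for the homogeneous
  expansion, \<open>R\<^sup>s f\<close> for the radial derivative, \<open>s\<close> for the smallest integer above \<open>\<alpha>\<close>, \<open>E\<^sub>m\<close> for the error of best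
  approximation by polynomials of degree \<open>m\<close>, and \<open>A \<lesssim> B\<close> for an inequality up to a constant factor.
  The theorem follows from two estimates that compare \<open>R\<^sup>s f\<close> at radius \<open>1 - 2\<^sup>-\<^sup>n\<close> with approximation by
  polynomials of degree about \<open>2\<^sup>n\<close>:

  \<^item> \<open>M(r, R\<^sup>s f) \<lesssim> \<parallel>f\<parallel> + \<Sum>\<nu><n. 2\<^sup>\<nu>\<^sup>s E(2\<^sup>\<nu>)\<close> when \<open>1 - r\<close> is comparable to \<open>2\<^sup>-\<^sup>n\<close>
    (\<open>radial_derivative_le_best_approx\<close>);
  \<^item> \<open>E(2\<^sup>\<nu>) \<lesssim> \<Sum>\<mu>\<ge>\<nu>. 2\<^sup>-\<^sup>\<mu>\<^sup>s M(1 - 2\<^sup>-\<^sup>\<mu>\<^sup>-\<^sup>1, R\<^sup>s f)\<close> for \<open>\<nu> \<ge> 1\<close> (\<open>best_approx_le_radial_derivative\<close>).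

  Since \<open>M(r, R\<^sup>s f)\<close> increases with \<open>r\<close>, finiteness of the mixed norm means that the sequence
  \<open>2\<^sup>-\<^sup>n\<^sup>(\<^sup>s\<^sup>-\<^sup>\<alpha>\<^sup>) M(1 - 2\<^sup>-\<^sup>n, R\<^sup>s f)\<close> belongs to \<open>\<ell>\<^sup>q\<close>.  After multiplication by \<open>2\<^sup>-\<^sup>n\<^sup>(\<^sup>s\<^sup>-\<^sup>\<alpha>\<^sup>)\<close> and \<open>2\<^sup>\<nu>\<^sup>\<alpha>\<close>,
  respectively, both estimates become convolutions with geometric sequences, with ratios
  \<open>2\<^sup>-\<^sup>(\<^sup>s\<^sup>-\<^sup>\<alpha>\<^sup>)\<close> and \<open>2\<^sup>-\<^sup>\<alpha>\<close>; these preserve \<open>\<ell>\<^sup>q\<close> by Minkowski's inequality.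

  Both estimates come from one principle about operators \<open>\<Sum>k. f\<^sub>k \<mapsto> \<Sum>k. \<lambda>\<^sub>k f\<^sub>k\<close>.  The sphere measure is invariant
  under multiplication by unimodular scalars, hence the Fejer means, which are averages of rotations
  of \<open>f\<close> with a positive kernel, do not increase the means (\<open>series_mean_fejer\<close>).  Summation by parts turns
  this into bounds for all convex weights: \<open>\<lambda>\<^sub>0\<close> if they are nonnegative and decreasing, and
  \<open>\<lambda>\<^sub>0 + 2 n (\<lambda>\<^sub>n - \<lambda>\<^sub>n\<^sub>-\<^sub>1)\<close> on polynomials of degree \<open>n\<close> if they end with an increase.  The weights \<open>t\<^sup>k\<close>, \<open>k\<close>, \<open>1/k\<close>, \<open>(k + c) t\<^sup>k\<close> and
  \<open>t\<^sup>n\<^sup>-\<^sup>k\<close> then give, in turn, monotonicity of the means, Bernstein's inequality, its inverse on high frequencies,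
  the bound \<open>(1 - t)\<^sup>-\<^sup>1\<close> for the derivative of a dilation, and the comparison of a polynomial at two
  nearby radii.  Differences of Fejer means are the de la Vallee Poussin means, which approximate as well as the best
  polynomial up to a factor \<open>4\<close>, and their dyadic differences decompose \<open>f\<close>.

  The homogeneous expansion itself exists because the Taylor coefficients of \<open>w \<mapsto> f(wz)\<close> are, on every
  complex line, entire functions of polynomial growth in \<open>z\<close>, hence polynomials; interpolation in one coordinate after the other
  makes them polynomials on \<open>\<complex>\<^sup>N\<close>.
\<close>

section \<open>\<open>L\<^sup>p\<close> norms of functions with values in \<open>[0, \<infinity>]\<close>\<close>

lemma ennpowr_mono:
  assumes "0 < a" "x \<le> y" shows "ennpowr x a \<le> ennpowr y a"
proof (cases "y = \<infinity>")
  case False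
  then show ?thesis using assms False
    by (cases x; cases y) (auto simp: ennpowr_def top_unique intro!: ennreal_leI powr_mono2)
qed (simp add: ennpowr_def)

lemma ennpowr_ennreal: "0 \<le> x \<Longrightarrow> ennpowr (ennreal x) a = ennreal (x powr a)"
  by (simp add: ennpowr_def)

lemma ennpowr_ennpowr: "ennpowr (ennpowr x a) b = ennpowr x (a * b)"
  by (cases x) (auto simp: ennpowr_def powr_powr)

lemma ennpowr_one: "ennpowr x 1 = x"
  by (cases x) (auto simp: ennpowr_def)

lemma ennpowr_zero: "ennpowr 0 a = 0"
  by (simp add: ennpowr_def)

lemma ennpowr_mult: "ennpowr (x * y) a = ennpowr x a * ennpowr y a" if "0 < a"
proof (cases "x = 0 \<or> y = 0")
  case False
  with that show ?thesis
    by (cases x; cases y)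
       (auto simp: ennpowr_def ennreal_mult_eq_top_iff ennreal_mult_top ennreal_top_mult powr_mult
             simp flip: ennreal_mult)
qed (auto simp: ennpowr_zero)

lemma ennpowr_le_iff:
  assumes "0 < a" shows "ennpowr x (1 / a) \<le> y \<longleftrightarrow> x \<le> ennpowr y a"
  using ennpowr_mono[of a "ennpowr x (1/a)" y] ennpowr_mono[of "1/a" x "ennpowr y a"] assms
  by (auto simp: ennpowr_ennpowr ennpowr_one)

lemma ennpowr_less_top_iff: "ennpowr x a < top \<longleftrightarrow> x < top"
  by (auto simp: ennpowr_def less_top[symmetric])

lemma tendsto_ennpowr:
  assumes "0 < a" "(g \<longlongrightarrow> l) F" shows "((\<lambda>n. ennpowr (g n) a) \<longlongrightarrow> ennpowr l a) F"
proof -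
  have "range (\<lambda>x. ennpowr x a) = UNIV"
    using assms by (intro surjI[of _ "\<lambda>x. ennpowr x (1 / a)"]) (simp add: ennpowr_ennpowr ennpowr_one)
  then have "continuous_on UNIV (\<lambda>x. ennpowr x a)"
    using assms by (intro continuous_onI_mono) (auto intro: ennpowr_mono)
  then show ?thesis
    by (rule continuous_on_tendsto_compose) (use assms(2) in auto)
qed

lemma borel_measurable_ennpowr [measurable]:
  assumes [measurable]: "g \<in> borel_measurable M"
  shows "(\<lambda>x. ennpowr (g x) a) \<in> borel_measurable M"
  unfolding ennpowr_def by measurable

text \<open>The norm is taken over an arbitrary measure because it is used for the sphere, where it is the
  integral mean, and for counting measure, where it is the norm of \<open>\<ell>\<^sup>q\<close>.\<close>

definition lnorm :: "ennreal \<Rightarrow> 'a measure \<Rightarrow> ('a \<Rightarrow> ennreal) \<Rightarrow> ennreal" where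
  "lnorm p M g =
     (if p = top then esssup M g
      else ennpowr (\<integral>\<^sup>+ x. ennpowr (g x) (enn2real p) \<partial>M) (1 / enn2real p))"

lemma enn2real_ge_1: "1 \<le> p \<Longrightarrow> p \<noteq> top \<Longrightarrow> 1 \<le> enn2real p"
  by (cases p) (auto simp flip: ennreal_1)

lemma lnorm_le_iff_finite:
  assumes "1 \<le> p" "p \<noteq> top"
  shows "lnorm p M g \<le> B \<longleftrightarrow> (\<integral>\<^sup>+ x. ennpowr (g x) (enn2real p) \<partial>M) \<le> ennpowr B (enn2real p)"
  using enn2real_ge_1[OF assms] assms by (simp add: lnorm_def ennpowr_le_iff)

lemma lnorm_le_iff_infinite:
  assumes "g \<in> borel_measurable M"
  shows "lnorm top M g \<le> B \<longleftrightarrow> (AE x in M. g x \<le> B)"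
  using assms esssup_AE[of g M] by (auto simp: lnorm_def intro: order_trans elim: eventually_mono)

lemma lnorm_mono:
  assumes "1 \<le> p" "g \<in> borel_measurable M" "\<And>x. x \<in> space M \<Longrightarrow> g x \<le> h x"
  shows "lnorm p M g \<le> lnorm p M h"
proof (cases "p = top")
  case True
  then show ?thesis using assms by (auto simp: lnorm_def intro!: esssup_AE_mono)
next
  case False
  then show ?thesis using assms enn2real_ge_1[of p]
    by (auto simp: lnorm_def intro!: ennpowr_mono nn_integral_mono)
qed

lemma lnorm_cong: "(\<And>x. x \<in> space M \<Longrightarrow> g x = h x) \<Longrightarrow> lnorm p M g = lnorm p M h"
  unfolding lnorm_def esssup_def
  by (auto cong: measurable_cong intro!: Limsup_eq nn_integral_cong arg_cong2[where f = ennpowr])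

lemma lnorm_zero: "1 \<le> p \<Longrightarrow> lnorm p M (\<lambda>x. 0) = 0"
  using enn2real_ge_1[of p] lnorm_le_iff_infinite[of "\<lambda>_. 0" M 0]
  by (cases "p = top") (auto simp: lnorm_def ennpowr_zero)

lemma lnorm_cmult:
  assumes "1 \<le> p" "g \<in> borel_measurable M" "c < top"
  shows "lnorm p M (\<lambda>x. c * g x) = c * lnorm p M g"
proof (cases "c = 0")
  case c: False
  show ?thesis
  proof (cases "p = top")
    case True
    have *: "lnorm top M (\<lambda>x. c * g x) \<le> c * lnorm top M g" if "g \<in> borel_measurable M" for c g
      using that esssup_AE[of g M]
      by (auto simp: lnorm_le_iff_infinite lnorm_def intro!: mult_left_mono elim!: eventually_mono)
    define d where "d = inverse c"
    have cd: "c * d = 1" "d * c = 1"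
      using c assms unfolding d_def
      by (auto simp: ennreal_inverse_mult less_top mult.commute divide_ennreal_def[symmetric]
               intro!: ennreal_divide_self)
    have "c * lnorm top M g = c * lnorm top M (\<lambda>x. d * (c * g x))"
      by (simp add: mult.assoc[symmetric] cd)
    also have "\<dots> \<le> c * (d * lnorm top M (\<lambda>x. c * g x))"
      using assms by (intro mult_left_mono *) auto
    also have "\<dots> = lnorm top M (\<lambda>x. c * g x)"
      by (simp add: mult.assoc[symmetric] cd)
    finally show ?thesis using * assms True by (auto intro: antisym)
  next
    case False
    with assms enn2real_ge_1[of p] have "0 < enn2real p" by auto
    then show ?thesis using False assms
      by (simp add: lnorm_def ennpowr_mult nn_integral_cmult ennpowr_ennpowr ennpowr_one)
  qed
qed (use assms lnorm_zero in auto)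

text \<open>Convexity of \<open>t \<mapsto> t\<^sup>p\<close> is applied to \<open>(u + v)/(a + b)\<close>, the average of \<open>u/a\<close> and \<open>v/b\<close> with
  weights \<open>a/(a+b)\<close> and \<open>b/(a+b)\<close>; integrated, it is Minkowski's inequality.\<close>

lemma powr_add_le_weighted:
  fixes u v a b p :: real
  assumes "0 \<le> u" "0 \<le> v" "0 < a" "0 < b" "1 \<le> p"
  shows "(u + v) powr p \<le> (a + b) powr (p - 1) * (a powr (1 - p) * u powr p + b powr (1 - p) * v powr p)"
proof -
  have zero: "v powr p \<le> (a + b) powr (p - 1) * (b powr (1 - p) * v powr p)"
    if "0 < a" "0 < b" for a b v :: real
  proof -
    have "1 = b powr (p - 1) * b powr (1 - p)"
      using that by (simp flip: powr_add)
    also have "\<dots> \<le> (a + b) powr (p - 1) * b powr (1 - p)"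
      using that assms by (intro mult_right_mono powr_mono2) auto
    finally have "1 * v powr p \<le> ((a + b) powr (p - 1) * b powr (1 - p)) * v powr p"
      by (intro mult_right_mono) auto
    then show ?thesis by (simp add: mult_ac)
  qed
  consider "u = 0" | "v = 0" | "0 < u" "0 < v" using assms by fastforce
  then show ?thesis
  proof cases
    case 1 then show ?thesis using zero[of a b v] assms by simp
  next
    case 2 then show ?thesis using zero[of b a u] assms by (simp add: add.commute)
  next
    case 3
    define s where "s = b / (a + b)"
    have s: "0 \<le> s" "s \<le> 1" "1 - s = a / (a + b)" using assms by (auto simp: s_def field_simps)
    have "((1 - s) * (u / a) + s * (v / b)) powr p \<le> (1 - s) * (u / a) powr p + s * (v / b) powr p"
      using convex_onD[OF powr_convex[OF assms(5)], of s "u / a" "v / b"] s 3 assms by simp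
    moreover have "(1 - s) * (u / a) + s * (v / b) = (u + v) / (a + b)"
      using assms 3 by (simp only: s(3)) (simp add: s_def add_divide_distrib)
    ultimately have "((u + v) / (a + b)) powr p \<le> a / (a + b) * (u / a) powr p + b / (a + b) * (v / b) powr p"
      by (simp only: s(3)) (simp add: s_def)
    then have "(a + b) powr p * ((u + v) / (a + b)) powr p
        \<le> (a + b) powr p * (a / (a + b) * (u / a) powr p + b / (a + b) * (v / b) powr p)"
      by (intro mult_left_mono) auto
    moreover have "(a + b) powr p * ((u + v) / (a + b)) powr p = (u + v) powr p"
      using assms 3 by (simp flip: powr_mult)
    moreover have "(a + b) powr p * (a / (a + b) * (u / a) powr p + b / (a + b) * (v / b) powr p)
        = (a + b) powr (p - 1) * (a powr (1 - p) * u powr p + b powr (1 - p) * v powr p)"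
      using assms 3 by (simp add: powr_diff powr_divide divide_simps)
    ultimately show ?thesis by simp
  qed
qed

lemma lnorm_add:
  assumes p: "1 \<le> p"
    and meas [measurable]: "g \<in> borel_measurable M" "h \<in> borel_measurable M"
  shows "lnorm p M (\<lambda>x. g x + h x) \<le> lnorm p M g + lnorm p M h"
proof (cases "p = top")
  case True
  have "AE x in M. g x + h x \<le> lnorm top M g + lnorm top M h"
    using esssup_AE[of g M] esssup_AE[of h M]
    by eventually_elim (auto simp: lnorm_def intro: add_mono)
  then show ?thesis using True by (simp add: lnorm_le_iff_infinite)
next
  case pf: False
  define r where "r = enn2real p"
  have r: "1 \<le> r" using enn2real_ge_1 p pf by (simp add: r_def)
  have *: "lnorm p M (\<lambda>x. g x + h x) \<le> ennreal (a + b)"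
    if ab: "0 < a" "0 < b" and g: "lnorm p M g \<le> ennreal a" and h: "lnorm p M h \<le> ennreal b" for a b
  proof -
    define c where "c = (a + b) powr (r - 1)"
    have gi: "(\<integral>\<^sup>+ x. ennpowr (g x) r \<partial>M) \<le> ennreal (a powr r)"
      and hi: "(\<integral>\<^sup>+ x. ennpowr (h x) r \<partial>M) \<le> ennreal (b powr r)"
      using g h p pf ab by (simp_all add: lnorm_le_iff_finite r_def ennpowr_ennreal)
    have pt: "ennpowr (u + v) r \<le> ennreal c * (ennreal (a powr (1 - r)) * ennpowr u r
                + ennreal (b powr (1 - r)) * ennpowr v r)" for u v
    proof (cases "u = top \<or> v = top")
      case True
      then show ?thesis using ab by (auto simp: ennpowr_def ennreal_mult_top c_def)
    next
      case False
      then obtain u' v' where "u = ennreal u'" "v = ennreal v'" "0 \<le> u'" "0 \<le> v'"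
        by (metis ennreal_cases infinity_ennreal_def)
      then show ?thesis
        using powr_add_le_weighted[of u' v' a b r] ab r
        by (simp add: ennpowr_ennreal c_def flip: ennreal_plus ennreal_mult)
    qed
    have "(\<integral>\<^sup>+ x. ennpowr (g x + h x) r \<partial>M) \<le> (\<integral>\<^sup>+ x. ennreal c * (ennreal (a powr (1 - r)) * ennpowr (g x) r
                + ennreal (b powr (1 - r)) * ennpowr (h x) r) \<partial>M)"
      by (intro nn_integral_mono pt)
    also have "\<dots> = ennreal c * (ennreal (a powr (1 - r)) * (\<integral>\<^sup>+ x. ennpowr (g x) r \<partial>M)
                + ennreal (b powr (1 - r)) * (\<integral>\<^sup>+ x. ennpowr (h x) r \<partial>M))"
      by (simp add: nn_integral_cmult nn_integral_add)
    also have "\<dots> \<le> ennreal c * (ennreal (a powr (1 - r)) * ennreal (a powr r)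
                + ennreal (b powr (1 - r)) * ennreal (b powr r))"
      by (intro mult_left_mono add_mono gi hi) auto
    also have "\<dots> = ennreal (c * (a + b))"
      using ab by (simp add: c_def flip: ennreal_mult ennreal_plus powr_add)
    also have "c * (a + b) = (a + b) powr r"
      using ab by (simp add: c_def powr_diff)
    finally show ?thesis using p pf ab
      by (simp add: lnorm_le_iff_finite r_def ennpowr_ennreal del: ennreal_plus)
  qed
  show ?thesis
  proof (rule ennreal_le_epsilon)
    fix e :: real assume top: "lnorm p M g + lnorm p M h < top" and e: "0 < e"
    then obtain a b where ab: "lnorm p M g = ennreal a" "lnorm p M h = ennreal b" "0 \<le> a" "0 \<le> b"
      by (cases "lnorm p M g"; cases "lnorm p M h") auto
    have "lnorm p M (\<lambda>x. g x + h x) \<le> ennreal ((a + e / 2) + (b + e / 2))"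
      using ab e by (intro *) (auto intro!: ennreal_leI)
    also have "\<dots> = lnorm p M g + lnorm p M h + ennreal e"
      using ab e by (simp flip: ennreal_plus)
    finally show "lnorm p M (\<lambda>x. g x + h x) \<le> lnorm p M g + lnorm p M h + ennreal e" .
  qed
qed

lemma lnorm_sum:
  assumes "1 \<le> p" "finite I" "\<And>i. i \<in> I \<Longrightarrow> g i \<in> borel_measurable M"
  shows "lnorm p M (\<lambda>x. \<Sum>i\<in>I. g i x) \<le> (\<Sum>i\<in>I. lnorm p M (g i))"
  using assms(2,3)
proof (induction I rule: finite_induct)
  case (insert i I)
  have "lnorm p M (\<lambda>x. \<Sum>i\<in>insert i I. g i x) = lnorm p M (\<lambda>x. g i x + (\<Sum>i\<in>I. g i x))"
    using insert by simp
  also have "\<dots> \<le> lnorm p M (g i) + lnorm p M (\<lambda>x. \<Sum>i\<in>I. g i x)"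
    using insert.prems assms(1) by (intro lnorm_add) auto
  also have "\<dots> \<le> lnorm p M (g i) + (\<Sum>i\<in>I. lnorm p M (g i))"
    using insert by (intro add_left_mono) auto
  finally show ?case using insert by simp
qed (use assms lnorm_zero in auto)

text \<open>Fatou's lemma, as lower semicontinuity of the norm under pointwise convergence.\<close>

lemma lnorm_limit_le:
  assumes p: "1 \<le> p" and [measurable]: "\<And>n. g n \<in> borel_measurable M"
    and lim: "\<And>x. x \<in> space M \<Longrightarrow> (\<lambda>n. g n x) \<longlonglongrightarrow> h x"
    and B: "\<And>n. lnorm p M (g n) \<le> B"
  shows "lnorm p M h \<le> B"
proof -
  have [measurable]: "h \<in> borel_measurable M"
    by (rule borel_measurable_LIMSEQ_order[OF lim]) auto
  show ?thesis
  proof (cases "p = top")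
    case True
    have "AE x in M. \<forall>n. g n x \<le> B"
      using B True by (auto simp: AE_all_countable lnorm_le_iff_infinite[symmetric])
    then have "AE x in M. h x \<le> B"
      using AE_space by eventually_elim (auto intro: LIMSEQ_le_const2[OF lim])
    then show ?thesis using True by (simp add: lnorm_le_iff_infinite)
  next
    case False
    with enn2real_ge_1 p have r: "0 < enn2real p" by force
    have "(\<integral>\<^sup>+ x. ennpowr (h x) (enn2real p) \<partial>M)
        = (\<integral>\<^sup>+ x. liminf (\<lambda>n. ennpowr (g n x) (enn2real p)) \<partial>M)"
      by (intro nn_integral_cong lim_imp_Liminf[symmetric] tendsto_ennpowr lim r) auto
    also have "\<dots> \<le> liminf (\<lambda>n. \<integral>\<^sup>+ x. ennpowr (g n x) (enn2real p) \<partial>M)"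
      by (rule nn_integral_liminf) auto
    also have "\<dots> \<le> ennpowr B (enn2real p)"
      using B p False by (intro Liminf_le always_eventually) (auto simp: lnorm_le_iff_finite)
    finally show ?thesis using p False by (simp add: lnorm_le_iff_finite)
  qed
qed

lemma lnorm_suminf:
  assumes "1 \<le> p" and [measurable]: "\<And>i. g i \<in> borel_measurable M"
  shows "lnorm p M (\<lambda>x. \<Sum>i. g i x) \<le> (\<Sum>i. lnorm p M (g i))"
proof (rule lnorm_limit_le[OF assms(1)])
  show "(\<lambda>n. \<Sum>i<n. g i x) \<longlonglongrightarrow> (\<Sum>i. g i x)" for x
    by (rule summable_LIMSEQ) auto
  show "lnorm p M (\<lambda>x. \<Sum>i<n. g i x) \<le> (\<Sum>i. lnorm p M (g i))" for n
  proof -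
    have "lnorm p M (\<lambda>x. \<Sum>i<n. g i x) \<le> (\<Sum>i<n. lnorm p M (g i))"
      by (rule lnorm_sum) (auto simp: assms)
    also have "\<dots> \<le> (\<Sum>i. lnorm p M (g i))"
      by (rule sum_le_suminf) auto
    finally show ?thesis .
  qed
qed auto

text \<open>Membership in \<open>\<ell>\<^sup>q\<close> thus becomes accessible to Minkowski's inequality for infinite sums.\<close>

lemma ell_iff_lnorm: "x \<in> ell q \<longleftrightarrow> lnorm q (count_space UNIV) x < top" if "1 \<le> q"
proof (cases "q = top")
  case True
  have "lnorm top (count_space UNIV) x \<le> B \<longleftrightarrow> (SUP n. x n) \<le> B" for B
    by (simp add: lnorm_le_iff_infinite AE_count_space SUP_le_iff)
  then have "lnorm top (count_space UNIV) x = (SUP n. x n)"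
    by (metis order_antisym order_refl)
  then show ?thesis using True by (simp add: ell_def)
next
  case False
  then show ?thesis
    by (simp add: ell_def lnorm_def ennpowr_less_top_iff nn_integral_count_space_nat)
qed

lemma ell_mono: "y \<in> ell q \<Longrightarrow> 1 \<le> q \<Longrightarrow> (\<And>n. x n \<le> y n) \<Longrightarrow> x \<in> ell q"
  using lnorm_mono[of q x "count_space UNIV" y] by (auto simp: ell_iff_lnorm)

lemma ell_cmult: "y \<in> ell q \<Longrightarrow> 1 \<le> q \<Longrightarrow> c < top \<Longrightarrow> (\<lambda>n. c * y n) \<in> ell q"
  by (simp add: ell_iff_lnorm lnorm_cmult ennreal_mult_less_top)

text \<open>A convolution with a geometric sequence is a convergent series of shifts, each with a norm that is at
  most the norm of the given sequence.\<close>

lemma ell_geometric_series: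
  assumes q: "1 \<le> q" and t: "0 \<le> t" "t < (1::real)" and y: "y \<in> ell q"
    and shift: "\<And>d. lnorm q (count_space UNIV) (S d) \<le> lnorm q (count_space UNIV) y"
  shows "(\<lambda>n::nat. \<Sum>d. ennreal (t ^ d) * S d n) \<in> ell q"
proof -
  let ?L = "lnorm q (count_space (UNIV :: nat set))"
  have "?L (\<lambda>n. \<Sum>d. ennreal (t ^ d) * S d n) \<le> (\<Sum>d. ?L (\<lambda>n. ennreal (t ^ d) * S d n))"
    using q by (intro lnorm_suminf) auto
  also have "\<dots> = (\<Sum>d. ennreal (t ^ d) * ?L (S d))"
    using q by (simp add: lnorm_cmult)
  also have "\<dots> \<le> (\<Sum>d. ennreal (t ^ d) * ?L y)"
    by (intro suminf_le mult_left_mono shift) auto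
  also have "\<dots> = (\<Sum>d. ennreal (t ^ d)) * ?L y"
    by simp
  also have "(\<Sum>d. ennreal (t ^ d)) = ennreal (1 / (1 - t))"
    using t by (intro suminf_ennreal_eq) (auto intro!: geometric_sums)
  also have "ennreal (1 / (1 - t)) * ?L y < top"
    using y q by (simp add: ell_iff_lnorm ennreal_mult_less_top)
  finally show ?thesis using q by (simp add: ell_iff_lnorm)
qed

lemma ell_geometric_tail:
  assumes "1 \<le> q" "0 \<le> t" "t < (1::real)" "y \<in> ell q"
  shows "(\<lambda>n. \<Sum>d. ennreal (t ^ d) * y (n + d)) \<in> ell q"
proof (rule ell_geometric_series[OF assms])
  fix d
  show "lnorm q (count_space UNIV) (\<lambda>n. y (n + d)) \<le> lnorm q (count_space UNIV) y"
  proof (cases "q = top")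
    case True
    have "y n \<le> lnorm top (count_space UNIV) y" for n
      using lnorm_le_iff_infinite[of y "count_space UNIV"] by (auto simp: AE_count_space)
    then show ?thesis
      by (auto simp: True lnorm_le_iff_infinite AE_count_space)
  next
    case False
    have "(\<Sum>n. ennpowr (y (n + d)) (enn2real q)) \<le> (\<Sum>n. ennpowr (y n) (enn2real q))"
      by (subst suminf_offset[of _ d]) auto
    then show ?thesis using False assms(1) enn2real_ge_1[of q]
      by (auto simp: lnorm_def nn_integral_count_space_nat intro!: ennpowr_mono)
  qed
qed

lemma ell_geometric_head:
  assumes "1 \<le> q" "0 \<le> t" "t < (1::real)" "y \<in> ell q"
  shows "(\<lambda>n. \<Sum>k\<le>n. ennreal (t ^ (n - k)) * y k) \<in> ell q"
proof -
  have "(\<lambda>n. \<Sum>d. ennreal (t ^ d) * (if d \<le> n then y (n - d) else 0)) \<in> ell q"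
  proof (rule ell_geometric_series[OF assms])
    fix d
    show "lnorm q (count_space UNIV) (\<lambda>n. if d \<le> n then y (n - d) else 0)
       \<le> lnorm q (count_space UNIV) y"
    proof (cases "q = top")
      case True
      have "y n \<le> lnorm top (count_space UNIV) y" for n
        using lnorm_le_iff_infinite[of y "count_space UNIV"] by (auto simp: AE_count_space)
      then show ?thesis
        by (auto simp: True lnorm_le_iff_infinite AE_count_space)
    next
      case False
      have "(\<Sum>n. ennpowr (if d \<le> n then y (n - d) else 0) (enn2real q)) = (\<Sum>n. ennpowr (y n) (enn2real q))"
        by (subst suminf_offset[of _ d]) (auto simp: ennpowr_zero)
      then show ?thesis using False assms(1) 
        by (auto simp: lnorm_def nn_integral_count_space_nat)
    qed
  qed
  moreover have "(\<Sum>d. ennreal (t ^ d) * (if d \<le> n then y (n - d) else 0))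
      = (\<Sum>k\<le>n. ennreal (t ^ (n - k)) * y k)" for n
  proof -
    have "(\<Sum>d. ennreal (t ^ d) * (if d \<le> n then y (n - d) else 0))
        = (\<Sum>d\<le>n. ennreal (t ^ d) * (if d \<le> n then y (n - d) else 0))"
      by (rule suminf_finite) auto
    also have "\<dots> = (\<Sum>k\<le>n. ennreal (t ^ (n - k)) * y k)"
      by (rule sum.reindex_bij_witness[of _ "\<lambda>k. n - k" "\<lambda>k. n - k"]) auto
    finally show ?thesis .
  qed
  ultimately show ?thesis by simp
qed

section \<open>Rotation invariance of the measure on the sphere\<close>

text \<open>In the coordinates of \<open>\<real>\<^sup>2\<close>, multiplication by a unimodular number is an orthogonal map and preserves
  Lebesgue measure; the product \<open>\<complex>\<^sup>N\<close>, on which a scalar acts in each coordinate separately, inherits this.\<close>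

lemma lborel_complex_eq_distr:
  "lborel = distr (lborel :: (real^2) measure) borel (\<lambda>v. Complex (v $ 1) (v $ 2))"
proof (rule lborel_eqI)
  let ?f = "\<lambda>v :: real^2. Complex (v $ 1) (v $ 2)"
  fix l u :: complex
  assume lu: "\<And>b. b \<in> Basis \<Longrightarrow> l \<bullet> b \<le> u \<bullet> b"
  have [measurable]: "?f \<in> borel_measurable borel"
    by (auto intro!: borel_measurable_continuous_onI continuous_intros simp: Complex_eq)
  let ?l = "vector [Re l, Im l] :: real^2" and ?u = "vector [Re u, Im u] :: real^2"
  have B: "(Basis :: (real^2) set) = {axis 1 1, axis 2 1}"
    by (auto simp: Basis_vec_def UNIV_2)
  have ne: "axis 1 1 \<noteq> (axis 2 1 :: real^2)"
    by (simp add: axis_eq_axis)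
  have pre: "?f -` box l u = box ?l ?u"
    by (auto simp: mem_box Basis_complex_def B inner_axis)
  have "emeasure (distr lborel borel ?f) (box l u) = emeasure lborel (box ?l ?u)"
    by (simp add: emeasure_distr pre)
  also have "\<dots> = ennreal (\<Prod>b\<in>Basis. (?u - ?l) \<bullet> b)"
    using lu[of 1] lu[of \<i>] by (subst emeasure_lborel_box) (auto simp: B inner_axis Basis_complex_def)
  also have "(\<Prod>b\<in>Basis. (?u - ?l) \<bullet> b) = (\<Prod>b\<in>Basis. (u - l) \<bullet> b)"
    using ne by (simp add: B Basis_complex_def inner_axis)
  finally show "emeasure (distr lborel borel ?f) (box l u) = ennreal (\<Prod>b\<in>Basis. (u - l) \<bullet> b)" .
qed simp

lemma open_rotated_box: "open {w :: complex. c * w \<in> box l u}"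
proof -
  have "open ((\<lambda>w. c * w) -` box l u)"
    by (intro open_vimage open_box continuous_intros)
  then show ?thesis unfolding vimage_def .
qed

lemma emeasure_lborel_rotated_box:
  fixes c l u :: complex
  assumes c: "norm c = 1" and lu: "\<And>b. b \<in> Basis \<Longrightarrow> l \<bullet> b \<le> u \<bullet> b"
  shows "emeasure lborel {w. c * w \<in> box l u} = ennreal (\<Prod>b\<in>Basis. (u - l) \<bullet> b)"
proof -
  let ?f = "\<lambda>v :: real^2. Complex (v $ 1) (v $ 2)"
  let ?g = "\<lambda>w. vector [Re w, Im w] :: real^2"
  have [measurable]: "?f \<in> borel_measurable borel"
    by (auto intro!: borel_measurable_continuous_onI continuous_intros simp: Complex_eq)
  have cc: "c * cnj c = 1" "cnj c * c = 1"
    using c by (simp_all add: complex_norm_square[symmetric] mult.commute)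
  define T where "T = (\<lambda>v. ?g (cnj c * ?f v))"
  have fg: "?f (?g w) = w" for w by simp
  have gf: "?g (?f v) = v" for v
    by (simp add: vec_eq_iff forall_2)
  have norm_f: "norm (?f v) = norm v" for v
    by (simp add: norm_vec_def L2_set_def UNIV_2 cmod_def)
  have norm_g: "norm (?g w) = norm w" for w
    using norm_f[of "?g w"] by (simp only: fg)
  have T: "orthogonal_transformation T"
    unfolding orthogonal_transformation
  proof
    show "linear T"
      unfolding T_def
      by (rule linearI) (auto simp: vec_eq_iff forall_2 algebra_simps)
    show "\<forall>v. norm (T v) = norm v"
      using c unfolding T_def norm_g norm_mult norm_f by simp
  qed
  let ?A = "?f -` box l u"
  have oA: "open ?A"
    by (intro open_vimage) (auto intro!: continuous_intros simp: Complex_eq)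
  have eA: "emeasure lborel ?A = ennreal (\<Prod>b\<in>Basis. (u - l) \<bullet> b)"
  proof -
    have "emeasure lborel ?A = emeasure (distr lborel borel ?f) (box l u)"
      by (simp add: emeasure_distr)
    then show ?thesis using lu by (simp flip: lborel_complex_eq_distr)
  qed
  have lA: "?A \<in> lmeasurable"
    using eA oA by (intro fmeasurableI) auto
  have TA: "T ` ?A = ?f -` {w. c * w \<in> box l u}"
  proof (intro equalityI subsetI)
    fix x assume "x \<in> T ` ?A"
    then obtain v where v: "?f v \<in> box l u" "x = T v" by auto
    then have "c * ?f x = ?f v" unfolding v T_def fg by (simp add: mult.assoc[symmetric] cc)
    then show "x \<in> ?f -` {w. c * w \<in> box l u}" using v by simp
  next
    fix x assume x: "x \<in> ?f -` {w. c * w \<in> box l u}"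
    have "T (?g (c * ?f x)) = x"
      unfolding T_def fg by (simp only: mult.assoc[symmetric] cc mult_1_left gf)
    moreover have "?g (c * ?f x) \<in> ?A" using x by (simp only: vimage_eq fg mem_Collect_eq)
    ultimately show "x \<in> T ` ?A" by (rule image_eqI[OF sym])
  qed
  have o: "open {w. c * w \<in> box l u}"
    by (rule open_rotated_box)
  have oT: "open (T ` ?A)"
    unfolding TA by (intro open_vimage o) (auto intro!: continuous_intros simp: Complex_eq)
  have "emeasure lborel {w. c * w \<in> box l u} = emeasure (distr lborel borel ?f) {w. c * w \<in> box l u}"
    by (simp flip: lborel_complex_eq_distr)
  also have "\<dots> = emeasure lborel (T ` ?A)"
    using o by (simp add: emeasure_distr TA)
  also have "\<dots> = emeasure lebesgue (T ` ?A)"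
    using oT by simp
  also have "\<dots> = ennreal (measure lebesgue (T ` ?A))"
    using measurable_orthogonal_image[OF T lA] by (intro emeasure_eq_measure2) (auto simp: fmeasurable_def)
  also have "measure lebesgue (T ` ?A) = measure lebesgue ?A"
    by (rule measure_orthogonal_image[OF T lA])
  also have "ennreal \<dots> = emeasure lebesgue ?A"
    using lA by (intro emeasure_eq_measure2[symmetric]) (auto simp: fmeasurable_def)
  also have "\<dots> = emeasure lborel ?A"
    using oA by simp
  finally show ?thesis using eA by simp
qed

text \<open>A Borel measure is Lebesgue measure as soon as it gives boxes their volume.  The image measure does so for
  every unimodular \<open>c\<close>, because the preimage of a box is a product of rotated rectangles.\<close>

lemma lborel_cvec_eq_distr:
  fixes c :: complex
  assumes c: "norm c = 1"
  shows "lborel = distr (\<Pi>\<^sub>M i\<in>(UNIV :: 'n::finite set). (lborel :: complex measure)) borel (\<lambda>f. \<chi> i. c * f i)"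
proof (rule lborel_eqI)
  interpret product_sigma_finite "\<lambda>i :: 'n. lborel :: complex measure" ..
  let ?P = "\<Pi>\<^sub>M i\<in>(UNIV :: 'n set). (lborel :: complex measure)"
  let ?f = "\<lambda>f. \<chi> i :: 'n. c * f i"
  fix l u :: "complex ^ 'n"
  assume lu: "\<And>b. b \<in> Basis \<Longrightarrow> l \<bullet> b \<le> u \<bullet> b"
  have lu': "l $ i \<bullet> b \<le> u $ i \<bullet> b" if "b \<in> Basis" for i b
    using lu[of "axis i b"] that by (auto simp: inner_axis Basis_vec_def)
  have [measurable]: "?f \<in> ?P \<rightarrow>\<^sub>M borel"
  proof (subst borel_measurable_euclidean_space, intro ballI)
    fix b :: "complex ^ 'n" assume "b \<in> Basis"
    then obtain i d where "b = axis i d" by (auto simp: Basis_vec_def)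
    then show "(\<lambda>f. ?f f \<bullet> b) \<in> borel_measurable ?P"
      by (simp add: inner_axis) measurable
  qed
  have "emeasure (distr ?P borel ?f) (box l u) = emeasure ?P (?f -` box l u \<inter> space ?P)"
    by (simp add: emeasure_distr)
  also have "?f -` box l u \<inter> space ?P = (\<Pi>\<^sub>E i\<in>UNIV. {w. c * w \<in> box (l $ i) (u $ i)})"
    by (auto simp: mem_box Basis_vec_def inner_axis space_PiM PiE_UNIV_domain Pi_iff)
  also have "emeasure ?P \<dots> = (\<Prod>i\<in>UNIV. emeasure lborel {w. c * w \<in> box (l $ i) (u $ i)})"
  proof (rule emeasure_PiM)
    show "{w. c * w \<in> box (l $ i) (u $ i)} \<in> sets lborel" for i
      using open_rotated_box by simp
  qed simp
  also have "\<dots> = (\<Prod>i\<in>UNIV. ennreal (\<Prod>b\<in>Basis. (u $ i - l $ i) \<bullet> b))"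
    using lu' c by (intro prod.cong refl emeasure_lborel_rotated_box) auto
  also have "\<dots> = ennreal (\<Prod>i\<in>UNIV. \<Prod>b\<in>Basis. (u $ i - l $ i) \<bullet> b)"
    using lu' by (intro prod_ennreal prod_nonneg) (auto simp: inner_diff_left)
  also have "(\<Prod>i\<in>UNIV. \<Prod>b\<in>Basis. (u $ i - l $ i) \<bullet> b) = (\<Prod>b\<in>Basis. (u - l) \<bullet> b)"
  proof -
    have "(\<Prod>b\<in>Basis. (u - l) \<bullet> b) = (\<Prod>i\<in>UNIV. \<Prod>b\<in>(\<lambda>d. axis i d) ` Basis. (u - l) \<bullet> b)"
      unfolding Basis_vec_def
      by (subst prod.UNION_disjoint[symmetric])
         (auto simp: axis_eq_axis intro!: prod.cong)
    also have "\<dots> = (\<Prod>i\<in>UNIV. \<Prod>b\<in>Basis. (u $ i - l $ i) \<bullet> b)"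
      by (intro prod.cong refl, subst prod.reindex) (auto simp: inner_axis inj_on_def axis_eq_axis)
    finally show ?thesis by simp
  qed
  finally show "emeasure (distr ?P borel ?f) (box l u) = ennreal (\<Prod>b\<in>Basis. (u - l) \<bullet> b)" .
qed simp

lemma borel_measurable_scale_cvec [measurable]:
  "(\<lambda>z :: complex ^ 'n. c *s z) \<in> borel_measurable borel"
  by (intro borel_measurable_continuous_onI) (auto simp: vector_scalar_mult_def intro!: continuous_intros)

text \<open>The two representations of Lebesgue measure, for \<open>1\<close> and for \<open>c\<close>, differ by the rotation.\<close>

lemma lborel_rotation:
  fixes c :: complex
  assumes c: "norm c = 1"
  shows "distr lborel borel (\<lambda>z :: complex ^ 'n. c *s z) = lborel"
proof -
  let ?P = "\<Pi>\<^sub>M i\<in>(UNIV :: 'n set). (lborel :: complex measure)"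
  have m [measurable]: "(\<lambda>f. \<chi> i :: 'n. f i) \<in> ?P \<rightarrow>\<^sub>M borel"
  proof (subst borel_measurable_euclidean_space, intro ballI)
    fix b :: "complex ^ 'n" assume "b \<in> Basis"
    then obtain i d where "b = axis i d" by (auto simp: Basis_vec_def)
    then show "(\<lambda>f. (\<chi> i :: 'n. f i) \<bullet> b) \<in> borel_measurable ?P"
      by (simp add: inner_axis) measurable
  qed
  have 1: "lborel = distr ?P borel (\<lambda>f. \<chi> i :: 'n. f i)"
    using lborel_cvec_eq_distr[of 1] by simp
  have "distr lborel borel (\<lambda>z :: complex ^ 'n. c *s z) =
      distr (distr ?P borel (\<lambda>f. \<chi> i :: 'n. f i)) borel (\<lambda>z :: complex ^ 'n. c *s z)"
    by (simp flip: 1)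
  also have "\<dots> = distr ?P borel ((\<lambda>z :: complex ^ 'n. c *s z) \<circ> (\<lambda>f. \<chi> i :: 'n. f i))"
    by (rule distr_distr) measurable
  also have "((\<lambda>z :: complex ^ 'n. c *s z) \<circ> (\<lambda>f. \<chi> i :: 'n. f i)) = (\<lambda>f. \<chi> i. c * f i)"
    by (auto simp: vector_scalar_mult_def)
  finally show ?thesis using lborel_cvec_eq_distr[OF c, where 'n = 'n] by simp
qed

lemma norm_scale_cvec: "norm (c *s z) = norm c * norm (z :: complex ^ 'n)"
  by (simp add: norm_vec_def norm_mult L2_set_right_distrib)

lemma sets_sphere_measure [measurable_cong]:
  "sets (sphere_measure :: (complex ^ 'n) measure) = sets (restrict_space borel (sphere 0 1))"
  unfolding sphere_measure_def by (simp cong: sets_restrict_space_cong)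

lemma space_sphere_measure: "space (sphere_measure :: (complex ^ 'n) measure) = sphere 0 1"
  by (simp add: sphere_measure_def space_restrict_space)

lemma emeasure_sphere_measure:
  assumes A: "A \<in> sets borel" "A \<subseteq> sphere 0 1"
  shows "emeasure sphere_measure (A :: (complex ^ 'n) set)
    = emeasure lborel (unit_ball \<inter> sgn -` A) / emeasure lborel (unit_ball :: (complex ^ 'n) set)"
proof -
  have sgn: "sgn \<in> borel_measurable (borel :: (complex ^ 'n) measure)"
    unfolding sgn_div_norm[abs_def] by measurable
  have S: "sphere 0 1 \<in> sets (borel :: (complex ^ 'n) measure)" by simp
  have "emeasure sphere_measure A = emeasure (distr (uniform_measure lborel unit_ball) borel sgn) A"
    unfolding sphere_measure_def using A S by (simp add: emeasure_restrict_space)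
  also have "\<dots> = emeasure (uniform_measure lborel unit_ball) (sgn -` A)"
    using sgn A by (subst emeasure_distr) auto
  also have "\<dots> = emeasure lborel (unit_ball \<inter> sgn -` A) / emeasure lborel (unit_ball :: (complex ^ 'n) set)"
    using measurable_sets[OF sgn A(1)] by (intro emeasure_uniform_measure) auto
  finally show ?thesis .
qed

lemma measurable_sphere_rotation:
  "norm c = 1 \<Longrightarrow> (\<lambda>z :: complex ^ 'n. c *s z) \<in> sphere_measure \<rightarrow>\<^sub>M sphere_measure"
  by (subst measurable_cong_sets[OF sets_sphere_measure sets_sphere_measure],
      intro measurable_restrict_space3) (auto simp: norm_scale_cvec)

lemma sphere_measure_rotation:
  fixes c :: complex
  assumes c: "norm c = 1"
  shows "distr sphere_measure sphere_measure (\<lambda>z :: complex ^ 'n. c *s z) = sphere_measure"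
proof (rule measure_eqI)
  let ?r = "\<lambda>z :: complex ^ 'n. c *s z"
  have [measurable]: "?r \<in> sphere_measure \<rightarrow>\<^sub>M sphere_measure"
    using c by (rule measurable_sphere_rotation)
  fix A :: "(complex ^ 'n) set"
  assume "A \<in> sets (distr sphere_measure sphere_measure ?r)"
  then have A: "A \<in> sets borel" "A \<subseteq> sphere 0 1"
    by (auto simp: sets_sphere_measure sets_restrict_space_iff)
  have sgn: "sgn \<in> borel_measurable (borel :: (complex ^ 'n) measure)"
    unfolding sgn_div_norm[abs_def] by measurable
  have sgn_scale: "sgn (?r z) = ?r (sgn z)" for z
    using c by (simp add: sgn_div_norm norm_scale_cvec vec_eq_iff scaleR_conv_of_real)
  have pre: "?r -` A \<in> sets borel" "?r -` A \<subseteq> sphere 0 1"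
    using A c measurable_sets[OF borel_measurable_scale_cvec A(1), of c] by (auto simp: norm_scale_cvec)
  have "emeasure (distr sphere_measure sphere_measure ?r) A = emeasure sphere_measure (?r -` A)"
    using A pre by (subst emeasure_distr) 
       (auto simp: sets_sphere_measure sets_restrict_space_iff space_sphere_measure Int_absorb2)
  also have "\<dots> = emeasure lborel (unit_ball \<inter> sgn -` (?r -` A)) / emeasure lborel (unit_ball :: (complex ^ 'n) set)"
    by (rule emeasure_sphere_measure[OF pre])
  also have "unit_ball \<inter> sgn -` (?r -` A) = ?r -` (unit_ball \<inter> sgn -` A) "
    using c by (auto simp: sgn_scale norm_scale_cvec)
  also have "emeasure lborel (?r -` (unit_ball \<inter> sgn -` A)) = emeasure (distr lborel borel ?r) (unit_ball \<inter> sgn -` A)"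
    using measurable_sets[OF sgn A(1)] by (subst emeasure_distr) auto
  also have "\<dots> = emeasure lborel (unit_ball \<inter> sgn -` A)"
    by (simp add: lborel_rotation[OF c])
  also have "\<dots> / emeasure lborel (unit_ball :: (complex ^ 'n) set) = emeasure sphere_measure A"
    by (rule emeasure_sphere_measure[OF A, symmetric])
  finally show "emeasure (distr sphere_measure sphere_measure ?r) A = emeasure sphere_measure A" .
qed simp

lemma integral_mean_eq_lnorm:
  "integral_mean p r g = lnorm p sphere_measure (\<lambda>\<zeta>. ennreal (norm (g (r *\<^sub>R \<zeta>))))"
  by (simp add: integral_mean_def lnorm_def ennpowr_ennreal)

text \<open>Pointwise sums of series of polynomials on the ball have this property, and no other functions occur in
  the means below.\<close>

definition ball_measurable :: "(complex ^ 'n \<Rightarrow> complex) \<Rightarrow> bool" where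
  "ball_measurable g \<longleftrightarrow> g \<in> borel_measurable (restrict_space borel unit_ball)"

lemma ball_measurable_dilate:
  assumes g: "ball_measurable g" and r: "0 \<le> r" "r < 1"
  shows "(\<lambda>\<zeta>. ennreal (norm (g (r *\<^sub>R \<zeta>)))) \<in> borel_measurable sphere_measure"
proof -
  have [measurable]: "(\<lambda>\<zeta> :: complex ^ 'n. r *\<^sub>R \<zeta>) \<in> sphere_measure \<rightarrow>\<^sub>M restrict_space borel unit_ball"
    using r by (subst measurable_cong_sets[OF sets_sphere_measure refl],
        intro measurable_restrict_space3) auto
  have [measurable]: "g \<in> borel_measurable (restrict_space borel unit_ball)"
    using g by (simp add: ball_measurable_def)
  show ?thesis by measurable
qed

lemma integral_mean_rotation:
  assumes g: "ball_measurable g" and r: "0 \<le> r" "r < 1" and c: "norm c = 1" and p: "1 \<le> p"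
  shows "integral_mean p r (\<lambda>z. g (c *s z)) \<le> integral_mean p r (g :: complex ^ 'n \<Rightarrow> complex)"
proof -
  let ?h = "\<lambda>\<zeta>. ennreal (norm (g (r *\<^sub>R \<zeta>)))"
  let ?r = "\<lambda>z :: complex ^ 'n. c *s z"
  note [measurable] = ball_measurable_dilate[OF g r]
  have rm [measurable]: "?r \<in> sphere_measure \<rightarrow>\<^sub>M sphere_measure"
    using c by (rule measurable_sphere_rotation)
  have sc: "c *s (r *\<^sub>R \<zeta>) = r *\<^sub>R (c *s \<zeta>)" for \<zeta> :: "complex ^ 'n"
    by (simp add: vec_eq_iff)
  have "lnorm p sphere_measure (\<lambda>\<zeta>. ?h (?r \<zeta>)) \<le> lnorm p sphere_measure ?h"
  proof (cases "p = top")
    case True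
    have "AE \<zeta> in distr sphere_measure sphere_measure ?r. ?h \<zeta> \<le> lnorm top sphere_measure ?h"
      using esssup_AE[of ?h sphere_measure] unfolding sphere_measure_rotation[OF c] by (simp add: lnorm_def)
    then have "AE \<zeta> in sphere_measure. ?h (?r \<zeta>) \<le> lnorm top sphere_measure ?h"
      by (subst (asm) AE_distr_iff) auto
    then show ?thesis
      unfolding True
        lnorm_le_iff_infinite[OF measurable_compose[OF rm ball_measurable_dilate[OF g r]]] .
  next
    case False
    have "(\<integral>\<^sup>+ \<zeta>. ennpowr (?h (?r \<zeta>)) (enn2real p) \<partial>sphere_measure)
        = (\<integral>\<^sup>+ \<zeta>. ennpowr (?h \<zeta>) (enn2real p) \<partial>distr sphere_measure sphere_measure ?r)"
      by (subst nn_integral_distr) auto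
    then show ?thesis using False by (simp add: lnorm_def sphere_measure_rotation[OF c])
  qed
  then show ?thesis by (simp add: integral_mean_eq_lnorm sc)
qed

section \<open>Homogeneous expansions of holomorphic functions\<close>

lemma zero_in_homogeneous: "(\<lambda>z. 0) \<in> homogeneous_polynomials k"
  unfolding homogeneous_polynomials_def by (intro CollectI exI[of _ "\<lambda>_. 0"]) simp

lemma add_in_homogeneous:
  assumes "P \<in> homogeneous_polynomials k" "Q \<in> homogeneous_polynomials k"
  shows "(\<lambda>z. P z + Q z) \<in> homogeneous_polynomials k"
proof -
  obtain c d where "P = (\<lambda>z. \<Sum>a | (\<Sum>i\<in>UNIV. a i) = k. c a * monomial_cvec a z)"
    "Q = (\<lambda>z. \<Sum>a | (\<Sum>i\<in>UNIV. a i) = k. d a * monomial_cvec a z)"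
    using assms by (auto simp: homogeneous_polynomials_def)
  then show ?thesis
    unfolding homogeneous_polynomials_def
    by (intro CollectI exI[of _ "\<lambda>a. c a + d a"]) (simp add: algebra_simps sum.distrib)
qed

lemma cmult_in_homogeneous:
  assumes "P \<in> homogeneous_polynomials k"
  shows "(\<lambda>z. e * P z) \<in> homogeneous_polynomials k"
proof -
  obtain c where "P = (\<lambda>z. \<Sum>a | (\<Sum>i\<in>UNIV. a i) = k. c a * monomial_cvec a z)"
    using assms by (auto simp: homogeneous_polynomials_def)
  then show ?thesis
    unfolding homogeneous_polynomials_def
    by (intro CollectI exI[of _ "\<lambda>a. e * c a"]) (simp add: sum_distrib_left mult_ac)
qed

lemma sum_in_homogeneous:
  "(\<And>i. i \<in> I \<Longrightarrow> P i \<in> homogeneous_polynomials k) \<Longrightarrow> (\<lambda>z. \<Sum>i\<in>I. P i z) \<in> homogeneous_polynomials k"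
  by (induction I rule: infinite_finite_induct) (auto intro: zero_in_homogeneous add_in_homogeneous)

lemma monomial_in_homogeneous:
  fixes a :: "'n::finite \<Rightarrow> nat"
  shows "monomial_cvec a \<in> homogeneous_polynomials (\<Sum>i\<in>UNIV. a i)"
proof -
  let ?A = "{b :: 'n \<Rightarrow> nat. (\<Sum>i\<in>UNIV. b i) = (\<Sum>i\<in>UNIV. a i)}"
  have "monomial_cvec a z = (\<Sum>b\<in>?A. (if b = a then 1 else 0) * monomial_cvec b z)" for z
  proof -
    have "(\<Sum>b\<in>?A. (if b = a then 1 else 0) * monomial_cvec b z)
        = (\<Sum>b\<in>?A. if b = a then monomial_cvec b z else 0)"
      by (intro sum.cong) auto
    then show ?thesis by (simp add: finite_multi_indices_eq)
  qed
  then show ?thesis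
    unfolding homogeneous_polynomials_def by (intro CollectI exI[of _ "\<lambda>b. if b = a then 1 else 0"]) auto
qed

lemma coordinate_power_mult_homogeneous:
  fixes P :: "complex ^ 'n \<Rightarrow> complex"
  assumes "P \<in> homogeneous_polynomials k"
  shows "(\<lambda>z. (z $ i) ^ l * P z) \<in> homogeneous_polynomials (k + l)"
proof -
  obtain c where P: "P = (\<lambda>z. \<Sum>a | (\<Sum>i\<in>UNIV. a i) = k. c a * monomial_cvec a z)"
    using assms by (auto simp: homogeneous_polynomials_def)
  have upd: "(z $ i) ^ l * monomial_cvec a z = monomial_cvec (a(i := a i + l)) z" for a and z :: "complex ^ 'n"
    unfolding monomial_cvec_def
    by (simp add: prod.remove[of UNIV i] power_add mult_ac cong: prod.cong_simp)
  have deg: "(\<Sum>j\<in>UNIV. (a(i := a i + l)) j) = (\<Sum>j\<in>UNIV. a j) + l" for a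
    by (simp add: sum.remove[of UNIV i] cong: sum.cong_simp)
  have "(\<lambda>z. \<Sum>a | (\<Sum>i\<in>UNIV. a i) = k. c a * monomial_cvec (a(i := a i + l)) z) \<in> homogeneous_polynomials (k + l)"
  proof (intro sum_in_homogeneous cmult_in_homogeneous)
    fix a :: "'n \<Rightarrow> nat" assume "a \<in> {a. (\<Sum>i\<in>UNIV. a i) = k}"
    then show "monomial_cvec (a(i := a i + l)) \<in> homogeneous_polynomials (k + l)"
      using monomial_in_homogeneous[of "a(i := a i + l)"] unfolding deg by simp
  qed
  then show ?thesis by (simp add: P sum_distrib_left upd[symmetric] mult_ac)
qed

lemma polynomials_le_iff_sum_homogeneous:
  "P \<in> polynomials_le m \<longleftrightarrow> (\<exists>G. (\<forall>k. G k \<in> homogeneous_polynomials k) \<and> P = (\<lambda>z. \<Sum>k\<le>m. G k z))"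
proof
  have group: "(\<Sum>k\<le>m. \<Sum>a | (\<Sum>i\<in>UNIV. a i) = k. h a) = (\<Sum>a | (\<Sum>i\<in>UNIV. a i) \<le> m. h a)"
    for h :: "('a \<Rightarrow> nat) \<Rightarrow> complex"
  proof -
    have "(\<Sum>k\<le>m. \<Sum>a | (\<Sum>i\<in>UNIV. a i) = k. h a)
        = (\<Sum>k\<le>m. sum h {a \<in> {a. (\<Sum>i\<in>UNIV. a i) \<le> m}. (\<Sum>i\<in>UNIV. a i) = k})"
      by (intro sum.cong refl) auto
    also have "\<dots> = (\<Sum>a | (\<Sum>i\<in>UNIV. a i) \<le> m. h a)"
      by (rule sum.group) (auto simp: finite_multi_indices_le)
    finally show ?thesis .
  qed
  {
    assume "P \<in> polynomials_le m"
    then obtain c where "P = (\<lambda>z. \<Sum>a | (\<Sum>i\<in>UNIV. a i) \<le> m. c a * monomial_cvec a z)"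
      by (auto simp: polynomials_le_def)
    then show "\<exists>G. (\<forall>k. G k \<in> homogeneous_polynomials k) \<and> P = (\<lambda>z. \<Sum>k\<le>m. G k z)"
      by (intro exI[of _ "\<lambda>k z. \<Sum>a | (\<Sum>i\<in>UNIV. a i) = k. c a * monomial_cvec a z"])
         (auto simp: group homogeneous_polynomials_def)
  next
    assume "\<exists>G. (\<forall>k. G k \<in> homogeneous_polynomials k) \<and> P = (\<lambda>z. \<Sum>k\<le>m. G k z)"
    then obtain G where G: "\<And>k. G k \<in> homogeneous_polynomials k" and P: "P = (\<lambda>z. \<Sum>k\<le>m. G k z)"
      by blast
    from G have "\<exists>c. G k = (\<lambda>z. \<Sum>a | (\<Sum>i\<in>UNIV. a i) = k. c a * monomial_cvec a z)" for k
      by (auto simp: homogeneous_polynomials_def)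
    then obtain c where c: "\<And>k. G k = (\<lambda>z. \<Sum>a | (\<Sum>i\<in>UNIV. a i) = k. c k a * monomial_cvec a z)"
      by metis
    have "P = (\<lambda>z. \<Sum>k\<le>m. \<Sum>a | (\<Sum>i\<in>UNIV. a i) = k. c (\<Sum>i\<in>UNIV. a i) a * monomial_cvec a z)"
      unfolding P c by (intro ext sum.cong refl) auto
    then show "P \<in> polynomials_le m"
      unfolding group polynomials_le_def by (intro CollectI exI[of _ "\<lambda>a. c (\<Sum>i\<in>UNIV. a i) a"])
  }
qed

lemma polynomials_le_mono:
  assumes "P \<in> polynomials_le m" "m \<le> n" shows "P \<in> polynomials_le n"
proof -
  obtain G where G: "\<And>k. G k \<in> homogeneous_polynomials k" and P: "P = (\<lambda>z. \<Sum>k\<le>m. G k z)"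
    using assms(1) by (auto simp: polynomials_le_iff_sum_homogeneous)
  have "P = (\<lambda>z. \<Sum>k\<le>n. (if k \<le> m then G k else (\<lambda>z. 0)) z)"
    unfolding P using assms(2) by (intro ext sum.mono_neutral_cong_left) auto
  then show ?thesis
    unfolding polynomials_le_iff_sum_homogeneous
    by (intro exI[of _ "\<lambda>k. if k \<le> m then G k else (\<lambda>z. 0)"]) (auto intro: G zero_in_homogeneous)
qed

lemma add_in_polynomials_le:
  assumes "P \<in> polynomials_le m" "Q \<in> polynomials_le m"
  shows "(\<lambda>z. P z + Q z) \<in> polynomials_le m"
proof -
  obtain G H where "\<And>k. G k \<in> homogeneous_polynomials k" "P = (\<lambda>z. \<Sum>k\<le>m. G k z)"
      "\<And>k. H k \<in> homogeneous_polynomials k" "Q = (\<lambda>z. \<Sum>k\<le>m. H k z)"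
    using assms by (auto simp: polynomials_le_iff_sum_homogeneous)
  then show ?thesis
    unfolding polynomials_le_iff_sum_homogeneous
    by (intro exI[of _ "\<lambda>k z. G k z + H k z"]) (auto intro: add_in_homogeneous simp: sum.distrib)
qed

lemma coordinate_power_mult_polynomials_le:
  fixes P :: "complex ^ 'n \<Rightarrow> complex"
  assumes "P \<in> polynomials_le m"
  shows "(\<lambda>z. e * (z $ i) ^ l * P z) \<in> polynomials_le (m + l)"
proof -
  obtain G where G: "\<And>k. G k \<in> homogeneous_polynomials k" and P: "P = (\<lambda>z. \<Sum>k\<le>m. G k z)"
    using assms(1) by (auto simp: polynomials_le_iff_sum_homogeneous)
  define H where "H k = (if l \<le> k then (\<lambda>z. e * ((z $ i) ^ l * G (k - l) z)) else (\<lambda>z. 0))" for k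
  have "H k \<in> homogeneous_polynomials k" for k
    using coordinate_power_mult_homogeneous[OF G[of "k - l"], of i l]
    by (auto simp: H_def intro: cmult_in_homogeneous zero_in_homogeneous)
  moreover have "e * (z $ i) ^ l * P z = (\<Sum>k\<le>m + l. H k z)" for z
  proof -
    have "(\<Sum>k\<le>m + l. H k z) = (\<Sum>k\<in>{l..m + l}. H k z)"
      by (rule sum.mono_neutral_right) (auto simp: H_def)
    also have "\<dots> = (\<Sum>k\<le>m. H (k + l) z)"
      by (rule sum.reindex_bij_witness[of _ "\<lambda>k. k + l" "\<lambda>k. k - l"]) auto
    also have "\<dots> = e * (z $ i) ^ l * P z"
      by (simp add: H_def P sum_distrib_left mult.assoc)
    finally show ?thesis by simp
  qed
  ultimately show ?thesis
    unfolding polynomials_le_iff_sum_homogeneous by (intro exI[of _ H]) auto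
qed

lemma finite_sum_is_polynomial:
  assumes "finite I" "\<And>i. i \<in> I \<Longrightarrow> \<exists>d. P i \<in> polynomials_le d"
  shows "\<exists>d. (\<lambda>z. \<Sum>i\<in>I. P i z) \<in> polynomials_le d"
  using assms
proof (induction I rule: finite_induct)
  case empty
  have "(\<lambda>z. 0) \<in> polynomials_le 0"
    unfolding polynomials_le_iff_sum_homogeneous
    by (intro exI[of _ "\<lambda>k z. 0"]) (auto intro: zero_in_homogeneous)
  then show ?case by auto
next
  case (insert i I)
  obtain d where "P i \<in> polynomials_le d" using insert.prems[of i] by auto
  moreover obtain e where "(\<lambda>z. \<Sum>i\<in>I. P i z) \<in> polynomials_le e" using insert by auto
  ultimately have "(\<lambda>z. P i z + (\<Sum>i\<in>I. P i z)) \<in> polynomials_le (max d e)"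
    by (intro add_in_polynomials_le) (auto elim: polynomials_le_mono)
  then show ?case using insert by auto
qed

text \<open>The \<open>k\<close>-th Taylor coefficient of the slice \<open>w \<mapsto> f(wz)\<close> at \<open>w = 0\<close>, which will be the homogeneous part of degree \<open>k\<close>.\<close>

definition taylor_slice :: "(complex ^ 'n \<Rightarrow> complex) \<Rightarrow> nat \<Rightarrow> complex ^ 'n \<Rightarrow> complex" where
  "taylor_slice f k z = (deriv ^^ k) (\<lambda>w. f (w *s z)) 0 / fact k"

lemma holomorphic_on_complex_line:
  assumes f: "holomorphic_cvec_on f unit_ball" and S: "\<And>w. w \<in> S \<Longrightarrow> y + w *s v \<in> unit_ball"
  shows "(\<lambda>w. f (y + w *s v)) holomorphic_on S"
  unfolding holomorphic_on_def
proof
  fix w assume "w \<in> S"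
  then obtain D where D: "(f has_derivative D) (at (y + w *s v))" and lin: "\<And>c v. D (c *s v) = c * D v"
    using f S unfolding holomorphic_cvec_on_def by metis
  have "((\<lambda>w. y + w *s v) has_derivative (\<lambda>h. h *s v)) (at w within S)"
  proof -
    have "bounded_linear (\<lambda>h. h *s v)"
      by (rule bounded_linear_intro[where K = "norm v"])
         (auto simp: norm_scale_cvec vec_eq_iff algebra_simps)
    then show ?thesis
      by (auto intro!: derivative_eq_intros bounded_linear_imp_has_derivative)
  qed
  from has_derivative_compose[OF this D]
  have "((\<lambda>w. f (y + w *s v)) has_derivative (\<lambda>h. D v * h)) (at w within S)"
    by (simp add: lin mult.commute)
  then have "((\<lambda>w. f (y + w *s v)) has_field_derivative D v) (at w within S)"
    by (simp add: has_field_derivative_def)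
  then show "(\<lambda>w. f (y + w *s v)) field_differentiable at w within S"
    unfolding field_differentiable_def by blast
qed

lemma holomorphic_on_slice:
  assumes "holomorphic_cvec_on f unit_ball" "r * norm z \<le> 1"
  shows "(\<lambda>w. f (w *s z)) holomorphic_on ball 0 r"
proof -
  have "norm w * norm z < 1" if "norm w < r" for w :: complex
  proof (cases "z = 0")
    case False
    with that have "norm w * norm z < r * norm z" by (intro mult_strict_right_mono) auto
    with assms show ?thesis by simp
  qed simp
  then show ?thesis
    using holomorphic_on_complex_line[OF assms(1), of "ball 0 r" 0 z] by (simp add: norm_scale_cvec)
qed

lemma taylor_slice_sums:
  assumes "holomorphic_cvec_on f unit_ball" "norm z < 1"
  shows "(\<lambda>k. taylor_slice f k z) sums f z"
proof -
  \<comment> \<open>a radius between \<open>1\<close> and \<open>1 / |z|\<close>, so that the power series may be evaluated at \<open>w = 1\<close>\<close>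
  define r where "r = 2 / (1 + norm z)"
  have r: "1 < r" "r * norm z \<le> 1"
    using assms(2) norm_ge_zero[of z] by (auto simp: r_def field_simps add_pos_nonneg)
  show ?thesis
    using holomorphic_power_series[OF holomorphic_on_slice[OF assms(1) r(2)], of 1] r(1)
    by (simp add: taylor_slice_def)
qed

lemma taylor_slice_scale:
  assumes "holomorphic_cvec_on f unit_ball"
  shows "taylor_slice f k (c *s z) = c ^ k * taylor_slice f k z"
proof -
  define r where "r = 1 / (1 + norm z)"
  define r' where "r' = r / (1 + norm c)"
  have r: "0 < r" "r * norm z \<le> 1" "0 < r'"
    by (auto simp: r_def r'_def field_simps add_pos_nonneg)
  have "c * w \<in> ball 0 r" if "w \<in> ball 0 r'" for w
  proof -
    have "norm (c * w) \<le> norm c * r'"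
      using that by (auto simp: norm_mult intro!: mult_left_mono)
    also have "\<dots> < r"
      using r(1) norm_ge_zero[of c] by (simp add: r'_def field_simps add_pos_nonneg)
    finally show ?thesis by simp
  qed
  then have "(deriv ^^ k) (\<lambda>w. f ((c * w) *s z)) 0 = c ^ k * (deriv ^^ k) (\<lambda>w. f (w *s z)) (c * 0)"
    using r by (intro higher_deriv_compose_linear[OF holomorphic_on_slice[OF assms r(2)], of "ball 0 r'"]) auto
  then show ?thesis
    by (simp add: taylor_slice_def vector_smult_assoc mult.commute)
qed

lemma taylor_slice_bounded:
  assumes "holomorphic_cvec_on f unit_ball"
  obtains B where "0 < B" "\<And>k z. norm z \<le> 1 / 2 \<Longrightarrow> norm (taylor_slice f k z) \<le> B"
proof -
  have "continuous_on unit_ball f"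
    using assms has_derivative_continuous unfolding holomorphic_cvec_on_def
    by (metis continuous_at_imp_continuous_on)
  then have "continuous_on (cball 0 (1 / 2)) f"
    by (rule continuous_on_subset) auto
  then have "bounded (f ` cball 0 (1 / 2))"
    by (intro compact_imp_bounded compact_continuous_image) auto
  then obtain B where B: "0 < B" "\<And>z. norm z \<le> 1 / 2 \<Longrightarrow> norm (f z) \<le> B"
    by (auto simp: bounded_pos)
  have "norm (taylor_slice f k z) \<le> B" if z: "norm z \<le> 1 / 2" for k z
  proof -
    have hol: "(\<lambda>w. f (w *s z)) holomorphic_on ball 0 2"
      using z by (intro holomorphic_on_slice[OF assms]) auto
    have "norm ((deriv ^^ k) (\<lambda>w. f (w *s z)) 0) \<le> fact k * B / 1 ^ k"
    proof (rule Cauchy_inequality)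
      show "(\<lambda>w. f (w *s z)) holomorphic_on ball 0 1"
        by (rule holomorphic_on_subset[OF hol]) auto
      show "continuous_on (cball 0 1) (\<lambda>w. f (w *s z))"
        by (rule continuous_on_subset[OF holomorphic_on_imp_continuous_on[OF hol]]) auto
      show "norm (f (w *s z)) \<le> B" if "norm (0 - w) = 1" for w
        using that z by (intro B) (auto simp: norm_scale_cvec)
    qed auto
    then show ?thesis by (simp add: taylor_slice_def norm_divide divide_simps mult.commute)
  qed
  with B(1) show ?thesis by (rule that)
qed

text \<open>The coefficients are obtained one after the other as limits of difference quotients
  \<open>(f(tx) - \<Sum>j<k. t\<^sup>j f\<^sub>j(x)) / t\<^sup>k\<close> for \<open>t \<rightarrow> 0\<close>.  The limits are uniform by the Cauchy estimates, so each
  coefficient inherits holomorphy on lines from \<open>f\<close>.\<close>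

lemma taylor_slice_holomorphic_near_0:
  assumes f: "holomorphic_cvec_on f unit_ball"
  shows "(\<lambda>w. taylor_slice f k (y + w *s v)) holomorphic_on {w. norm (y + w *s v) < 1 / 2}"
proof (induction k rule: less_induct)
  case (less k)
  let ?U = "{w. norm (y + w *s v) < 1 / 2}"
  define t :: "nat \<Rightarrow> real" where "t n = 1 / real (n + 2)" for n
  have t: "0 < t n" "t n \<le> 1 / 2" for n by (auto simp: t_def)
  have t0: "t \<longlonglongrightarrow> 0"
    unfolding t_def by real_asymp
  obtain B where B: "0 < B" "\<And>k z. norm z \<le> 1 / 2 \<Longrightarrow> norm (taylor_slice f k z) \<le> B"
    using taylor_slice_bounded[OF f] by blast
  define h where "h n w = (f (of_real (t n) *s (y + w *s v))
      - (\<Sum>j<k. of_real (t n) ^ j * taylor_slice f j (y + w *s v))) / of_real (t n) ^ k" for n w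
  have est: "norm (h n w - taylor_slice f k (y + w *s v)) \<le> 2 * B * t n" if w: "w \<in> ?U" for n w
  proof -
    define x where "x = y + w *s v"
    have x: "norm x \<le> 1 / 2" using w by (simp add: x_def)
    let ?t = "of_real (t n) :: complex"
    have "norm (?t *s x) < 1"
      using x t[of n] mult_mono[of "t n" "1 / 2" "norm x" "1 / 2"] by (simp add: norm_scale_cvec)
    from taylor_slice_sums[OF f this]
    have sums: "(\<lambda>j. ?t ^ j * taylor_slice f j x) sums f (?t *s x)"
      by (simp add: taylor_slice_scale[OF f])
    have "(\<lambda>i. ?t ^ (i + Suc k) * taylor_slice f (i + Suc k) x) sums
        (f (?t *s x) - (\<Sum>j<Suc k. ?t ^ j * taylor_slice f j x))"
      by (rule sums_split_initial_segment[OF sums])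
    from sums_divide[OF this, of "?t ^ k"]
    have s1: "(\<lambda>i. ?t ^ Suc i * taylor_slice f (i + Suc k) x) sums (h n w - taylor_slice f k x)"
      using t[of n] by (simp add: h_def x_def power_add field_simps)
    have s2: "(\<lambda>i. B * t n * t n ^ i) sums (B * t n * (1 / (1 - t n)))"
      using t[of n] by (intro sums_mult geometric_sums) auto
    have "norm (h n w - taylor_slice f k x) \<le> B * t n * (1 / (1 - t n))"
    proof (rule norm_sums_le[OF s1 s2])
      fix i
      have "t n * t n ^ i * norm (taylor_slice f (i + Suc k) x) \<le> t n * t n ^ i * B"
        using t[of n] x by (intro mult_left_mono B) auto
      then show "norm (?t ^ Suc i * taylor_slice f (i + Suc k) x) \<le> B * t n * t n ^ i"
        using t[of n] by (simp add: norm_mult norm_power mult_ac)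
    qed
    also have "\<dots> \<le> B * t n * 2"
      using t[of n] B(1) by (intro mult_left_mono) (auto simp: field_simps)
    finally show ?thesis by (simp add: x_def mult_ac)
  qed
  have openU: "open ?U"
    by (intro open_Collect_less continuous_intros) (auto simp: vector_scalar_mult_def intro!: continuous_intros)
  show ?case
  proof (rule holomorphic_uniform_sequence[OF openU])
    fix n
    have "(\<lambda>w. f (of_real (t n) *s y + w *s (of_real (t n) *s v))) holomorphic_on ?U"
    proof (rule holomorphic_on_complex_line[OF f])
      fix w assume "w \<in> ?U"
      then have "norm (of_real (t n) *s (y + w *s v)) < 1"
        unfolding norm_scale_cvec
        using t[of n] mult_mono[of "t n" "1 / 2" "norm (y + w *s v)" "1 / 2"] by simp
      moreover have "of_real (t n) *s y + w *s (of_real (t n) *s v) = of_real (t n) *s (y + w *s v)"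
        by (simp add: vector_smult_assoc vec.scale_right_distrib mult.commute)
      ultimately show "of_real (t n) *s y + w *s (of_real (t n) *s v) \<in> unit_ball"
        by (simp only: mem_ball_0)
    qed
    moreover have "of_real (t n) *s y + w *s (of_real (t n) *s v) = of_real (t n) *s (y + w *s v)" for w
      by (simp add: vector_smult_assoc vec.scale_right_distrib mult.commute)
    ultimately have "(\<lambda>w. f (of_real (t n) *s (y + w *s v))) holomorphic_on ?U"
      by (simp only:)
    then show "h n holomorphic_on ?U"
      unfolding h_def using t(1)[of n]
      by (intro holomorphic_on_divide holomorphic_on_diff holomorphic_on_sum holomorphic_on_mult
          holomorphic_on_const less.IH) auto
  next
    fix x assume "x \<in> ?U"
    then obtain d where d: "0 < d" "cball x d \<subseteq> ?U"
      using openU open_contains_cball by blast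
    have "uniform_limit (cball x d) h (\<lambda>w. taylor_slice f k (y + w *s v)) sequentially"
    proof (rule uniform_limitI)
      fix e :: real assume e: "0 < e"
      have "(\<lambda>n. 2 * B * t n) \<longlonglongrightarrow> 2 * B * 0" by (intro tendsto_intros t0)
      then have "eventually (\<lambda>n. 2 * B * t n < e) sequentially"
        using e by (auto dest: order_tendstoD(2))
      then show "eventually (\<lambda>n. \<forall>w\<in>cball x d. dist (h n w) (taylor_slice f k (y + w *s v)) < e) sequentially"
        proof eventually_elim
        case (elim n)
        show ?case
        proof
          fix w assume "w \<in> cball x d"
          then have "w \<in> ?U" using d by blast
          from est[OF this, of n] elim show "dist (h n w) (taylor_slice f k (y + w *s v)) < e"
            unfolding dist_norm by linarith
        qed
      qed
    qed
    with d show "\<exists>d>0. cball x d \<subseteq> ?U \<and> uniform_limit (cball x d) h (\<lambda>w. taylor_slice f k (y + w *s v)) sequentially"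
      by (intro exI[of _ d] conjI)
  qed
qed

text \<open>Homogeneity extends the holomorphy from small arguments to the whole line and gives growth of order \<open>k\<close>;
  Liouville's theorem does the rest.\<close>

lemma taylor_slice_polynomial_on_line:
  fixes f :: "complex ^ 'n \<Rightarrow> complex"
  assumes f: "holomorphic_cvec_on f unit_ball"
  shows "\<exists>c. \<forall>w. taylor_slice f k (y + w *s v) = (\<Sum>j\<le>k. c j * w ^ j)"
proof -
  let ?g = "\<lambda>w. taylor_slice f k (y + w *s v)"
  obtain B where B: "0 < B" "\<And>k z. norm z \<le> 1 / 2 \<Longrightarrow> norm (taylor_slice f k z) \<le> B"
    using taylor_slice_bounded[OF f] by blast
  have growth: "norm (taylor_slice f k x) \<le> B * (2 * norm x) ^ k" for x
  proof (cases "x = 0")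
    case True
    show ?thesis
      using B(2)[of 0 k] taylor_slice_scale[OF f, of k 0 0] B(1) by (cases k) (auto simp: True)
  next
    case False
    let ?e = "of_real (2 * norm x) :: complex"
    have "?e *s (inverse ?e *s x) = x" using False by (simp add: vector_smult_assoc)
    then have "taylor_slice f k x = ?e ^ k * taylor_slice f k (inverse ?e *s x)"
      by (metis taylor_slice_scale[OF f])
    then have "norm (taylor_slice f k x) = (2 * norm x) ^ k * norm (taylor_slice f k (inverse ?e *s x))"
      by (simp add: norm_mult norm_power)
    also have "\<dots> \<le> (2 * norm x) ^ k * B"
      using False by (intro mult_left_mono B(2)) (auto simp: norm_scale_cvec norm_inverse norm_mult)
    finally show ?thesis by (simp add: mult.commute)
  qed
  have hol: "?g holomorphic_on UNIV"
    unfolding holomorphic_on_def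
  proof
    fix w0 :: complex
    define e :: real where "e = 1 / (4 * (1 + norm (y + w0 *s v)))"
    have e: "0 < e" "e * norm (y + w0 *s v) < 1 / 2"
      by (auto simp: e_def field_simps add_pos_nonneg)
    let ?e = "of_real e :: complex"
    let ?U = "{w. norm (?e *s y + w *s (?e *s v)) < 1 / 2}"
    have eq: "?e *s y + w *s (?e *s v) = ?e *s (y + w *s v)" for w
      by (simp add: vector_smult_assoc vec.scale_right_distrib mult.commute)
    have "open ?U"
      by (intro open_Collect_less continuous_intros) (auto simp: vector_scalar_mult_def intro!: continuous_intros)
    moreover have "w0 \<in> ?U" using e by (simp only: mem_Collect_eq eq norm_scale_cvec) simp
    moreover have "(\<lambda>w. taylor_slice f k (?e *s y + w *s (?e *s v)) / ?e ^ k) holomorphic_on ?U"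
      using e by (intro holomorphic_intros taylor_slice_holomorphic_near_0[OF f]) auto
    moreover have "taylor_slice f k (?e *s y + w *s (?e *s v)) / ?e ^ k = ?g w" for w
      unfolding eq taylor_slice_scale[OF f] using e by simp
    ultimately show "?g field_differentiable at w0 within UNIV"
      by (auto dest: holomorphic_on_imp_differentiable_at)
  qed
  have "?g w = (\<Sum>j\<le>k. (deriv ^^ j) ?g 0 / fact j * w ^ j)" for w
  proof (rule Liouville_polynomial[OF hol])
    fix w :: complex assume w: "1 \<le> norm w"
    have tri: "norm (y + w *s v) \<le> norm w * norm y + norm w * norm v"
      using w mult_right_mono[OF w, of "norm y"] norm_triangle_ineq[of y "w *s v"]
      by (simp add: norm_scale_cvec)
    have "norm (?g w) \<le> B * (2 * norm (y + w *s v)) ^ k" by (rule growth)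
    also have "\<dots> \<le> B * (2 * (norm w * norm y + norm w * norm v)) ^ k"
      using B(1) tri by (intro mult_left_mono power_mono) auto
    also have "\<dots> = B * (2 * (norm y + norm v)) ^ k * norm w ^ k"
      by (simp add: algebra_simps flip: power_mult_distrib)
    finally show "norm (?g w) \<le> B * (2 * (norm y + norm v)) ^ k * norm w ^ k" .
  qed
  then show ?thesis by (intro exI[of _ "\<lambda>j. (deriv ^^ j) ?g 0 / fact j"] allI)
qed

definition lagrange_basis :: "nat \<Rightarrow> nat \<Rightarrow> complex poly" where
  "lagrange_basis k j = (\<Prod>i\<in>{..k} - {j}. smult (1 / (of_nat j - of_nat i)) [:- of_nat i, 1:])"

lemma degree_lagrange_basis:
  assumes "j \<le> k" shows "degree (lagrange_basis k j) \<le> k"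
proof -
  have "degree (lagrange_basis k j) \<le> (\<Sum>i\<in>{..k} - {j}. 1)"
    unfolding lagrange_basis_def
    by (rule order_trans[OF degree_prod_sum_le]) (auto intro!: sum_mono order_trans[OF degree_smult_le])
  then show ?thesis using assms by simp
qed

lemma lagrange_interpolation:
  "(\<Sum>l\<le>k. c l * w ^ l) = (\<Sum>j\<le>k. (\<Sum>l\<le>k. c l * of_nat j ^ l) * poly (lagrange_basis k j) w)"
proof -
  let ?A = "of_nat ` {..k} :: complex set"
  define p where "p = (\<Sum>l\<le>k. monom (c l) l)"
  define q where "q = (\<Sum>j\<le>k. smult (\<Sum>l\<le>k. c l * of_nat j ^ l) (lagrange_basis k j))"
  have poly_p: "poly p w = (\<Sum>l\<le>k. c l * w ^ l)" for w
    by (simp add: p_def poly_sum poly_monom)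
  have basis: "poly (lagrange_basis k j) (of_nat i) = (if i = j then 1 else 0)" if "i \<le> k" for i j
  proof -
    have "poly (lagrange_basis k j) (of_nat i)
        = (\<Prod>m\<in>{..k} - {j}. (of_nat i - of_nat m) / (of_nat j - of_nat m))"
      by (simp add: lagrange_basis_def poly_prod diff_divide_distrib)
    also have "\<dots> = (if i = j then 1 else 0)"
      using that by (auto intro!: prod.neutral)
    finally show ?thesis .
  qed
  have cardA: "card ?A = Suc k"
    by (subst card_image) (auto simp: inj_on_def)
  have "degree q \<le> k"
    unfolding q_def
    by (intro degree_sum_le) (auto intro: order_trans[OF degree_smult_le] degree_lagrange_basis)
  moreover have "degree p \<le> k"
    unfolding p_def by (intro degree_sum_le) (auto intro: order_trans[OF degree_monom_le])
  moreover have "poly p x = poly q x" if "x \<in> ?A" for x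
  proof -
    obtain i where i: "i \<le> k" "x = of_nat i" using \<open>x \<in> ?A\<close> by auto
    have "poly q x = (\<Sum>j\<le>k. (\<Sum>l\<le>k. c l * of_nat j ^ l) * (if i = j then 1 else 0))"
      using i by (simp add: q_def poly_sum basis)
    also have "\<dots> = poly p x"
      using i by (simp add: poly_p if_distrib[where f = "\<lambda>x. _ * x"] cong: if_cong)
    finally show ?thesis by simp
  qed
  ultimately have "p = q"
    by (intro poly_eqI_degree[of ?A]) (auto simp: cardA)
  then show ?thesis
    using poly_p[of w] by (simp add: q_def poly_sum)
qed

text \<open>Interpolation at \<open>0, \<dots>, k\<close> makes the coefficients of the expansion in one coordinate values of the function
  itself, so that they are again polynomial in each of the other coordinates.\<close>

lemma separately_polynomial_imp_polynomial:
  fixes g :: "complex ^ 'n \<Rightarrow> complex"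
  assumes g: "\<And>y v. \<exists>c. \<forall>w. g (y + w *s v) = (\<Sum>j\<le>k. c j * w ^ j)"
  shows "\<exists>d. g \<in> polynomials_le d"
proof -
  have "\<exists>d. (\<lambda>z. g (\<chi> l. if l \<in> S then z $ l else y $ l)) \<in> polynomials_le d" if "finite S" for S y
    using that
  proof (induction S arbitrary: y rule: finite_induct)
    case empty
    have "(\<lambda>z :: complex ^ 'n. g (\<chi> l. y $ l)) \<in> homogeneous_polynomials 0"
      using cmult_in_homogeneous[OF monomial_in_homogeneous[of "\<lambda>_ :: 'n. 0"], of "g y"]
      by (simp add: monomial_cvec_def)
    then have "(\<lambda>z :: complex ^ 'n. g (\<chi> l. y $ l)) \<in> polynomials_le 0"
      unfolding polynomials_le_iff_sum_homogeneous
      by (intro exI[of _ "\<lambda>k. if k = 0 then \<lambda>z. g (\<chi> l. y $ l) else (\<lambda>z. 0)"]) (auto intro: zero_in_homogeneous)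
    then show ?case by auto
  next
    case (insert i S)
    define b where "b t z = (\<chi> l. if l \<in> S then z $ l else if l = i then t else y $ l)" for t and z :: "complex ^ 'n"
    have eq: "g (\<chi> l. if l \<in> insert i S then z $ l else y $ l)
        = (\<Sum>j\<le>k. \<Sum>m\<le>k. coeff (lagrange_basis k j) m * (z $ i) ^ m * g (b (of_nat j) z))" for z
    proof -
      obtain c where c: "\<And>w. g (b 0 z + w *s axis i 1) = (\<Sum>j\<le>k. c j * w ^ j)" using g by metis
      have b: "b 0 z + w *s axis i 1 = b w z" for w
        using insert.hyps by (auto simp: b_def vec_eq_iff axis_def)
      have "(\<chi> l. if l \<in> insert i S then z $ l else y $ l) = b (z $ i) z"
        using insert.hyps by (auto simp: b_def vec_eq_iff)
      then have "g (\<chi> l. if l \<in> insert i S then z $ l else y $ l) = (\<Sum>j\<le>k. c j * (z $ i) ^ j)"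
        using c[of "z $ i"] by (simp add: b)
      also have "\<dots> = (\<Sum>j\<le>k. g (b (of_nat j) z) * poly (lagrange_basis k j) (z $ i))"
        by (subst lagrange_interpolation) (simp add: c[unfolded b])
      also have "\<dots> = (\<Sum>j\<le>k. \<Sum>m\<le>k. coeff (lagrange_basis k j) m * (z $ i) ^ m * g (b (of_nat j) z))"
      proof (intro sum.cong refl)
        fix j assume "j \<in> {..k}"
        then have "degree (lagrange_basis k j) \<le> k" by (simp add: degree_lagrange_basis)
        then have "poly (lagrange_basis k j) (z $ i) = (\<Sum>m\<le>k. coeff (lagrange_basis k j) m * (z $ i) ^ m)"
          unfolding poly_altdef by (intro sum.mono_neutral_left) (auto simp: coeff_eq_0)
        then show "g (b (of_nat j) z) * poly (lagrange_basis k j) (z $ i)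
            = (\<Sum>m\<le>k. coeff (lagrange_basis k j) m * (z $ i) ^ m * g (b (of_nat j) z))"
          by (simp add: sum_distrib_left mult_ac)
      qed
      finally show ?thesis .
    qed
    have bpoly: "\<exists>d. (\<lambda>z. g (b (of_nat j) z)) \<in> polynomials_le d" for j
      using insert.IH[of "\<chi> l. if l = i then of_nat j else y $ l"] unfolding b_def by (simp only: vec_lambda_beta)
    show ?case
      unfolding eq
      by (intro finite_sum_is_polynomial) (use bpoly coordinate_power_mult_polynomials_le in blast)+
  qed
  from this[of UNIV 0] show ?thesis by simp
qed

text \<open>A polynomial that is homogeneous of degree \<open>k\<close> as a function equals its own part of degree \<open>k\<close>.\<close>

lemma taylor_slice_homogeneous:
  fixes f :: "complex ^ 'n \<Rightarrow> complex"
  assumes f: "holomorphic_cvec_on f unit_ball"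
  shows "taylor_slice f k \<in> homogeneous_polynomials k"
proof -
  obtain d where "taylor_slice f k \<in> polynomials_le d"
    using separately_polynomial_imp_polynomial taylor_slice_polynomial_on_line[OF f] by blast
  then have "taylor_slice f k \<in> polynomials_le (d + k)"
    by (rule polynomials_le_mono) simp
  then obtain G where G: "\<And>j. G j \<in> homogeneous_polynomials j"
    and eq: "taylor_slice f k = (\<lambda>z. \<Sum>j\<le>d + k. G j z)"
    by (auto simp: polynomials_le_iff_sum_homogeneous)
  have "G k z = taylor_slice f k z" for z
  proof -
    have "(\<Sum>j\<le>d + k. G j z * w ^ j) = (\<Sum>j\<le>d + k. (if j = k then taylor_slice f k z else 0) * w ^ j)" for w
    proof -
      have "(\<Sum>j\<le>d + k. G j z * w ^ j) = taylor_slice f k (w *s z)"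
        unfolding eq by (intro sum.cong refl) (simp add: homogeneous_polynomials_scale[OF G])
      also have "\<dots> = (\<Sum>j\<le>d + k. (if j = k then taylor_slice f k z else 0) * w ^ j)"
        by (simp add: taylor_slice_scale[OF f] if_distrib[where f = "\<lambda>x. x * _"] cong: if_cong)
      finally show ?thesis .
    qed
    then have "\<forall>j\<le>d + k. G j z = (if j = k then taylor_slice f k z else 0)"
      by (subst polyfun_eq_coeffs[symmetric]) auto
    then show ?thesis by auto
  qed
  then have "taylor_slice f k = G k" by auto
  then show ?thesis using G by simp
qed

lemma homogeneous_expansion_homogeneous_part:
  assumes "holomorphic_cvec_on f unit_ball"
  shows "homogeneous_expansion f (homogeneous_part f)"
  unfolding homogeneous_part_def
proof (rule theI[of _ "taylor_slice f"])
  show "homogeneous_expansion f (taylor_slice f)"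
    using taylor_slice_homogeneous[OF assms] taylor_slice_sums[OF assms]
    by (auto simp: homogeneous_expansion_def)
  then show "F = taylor_slice f" if "homogeneous_expansion f F" for F
    using homogeneous_expansion_unique that by blast
qed

section \<open>Integral means of homogeneous series\<close>

text \<open>Operators that multiply the homogeneous parts by numbers act on the sequence of parts, so this sequence
  replaces the function from here on.\<close>

definition homogeneous_series :: "(nat \<Rightarrow> complex ^ 'n \<Rightarrow> complex) \<Rightarrow> bool" where
  "homogeneous_series F \<longleftrightarrow>
     (\<forall>k. F k \<in> homogeneous_polynomials k) \<and> (\<forall>z\<in>unit_ball. summable (\<lambda>k. F k z))"

definition weighted :: "(nat \<Rightarrow> real) \<Rightarrow> (nat \<Rightarrow> complex ^ 'n \<Rightarrow> complex) \<Rightarrow> nat \<Rightarrow> complex ^ 'n \<Rightarrow> complex" where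
  "weighted l F = (\<lambda>k z. of_real (l k) * F k z)"

definition series_mean :: "ennreal \<Rightarrow> real \<Rightarrow> (nat \<Rightarrow> complex ^ 'n \<Rightarrow> complex) \<Rightarrow> ennreal" where
  "series_mean p r F = integral_mean p r (\<lambda>z. \<Sum>k. F k z)"

lemma weighted_weighted: "weighted l (weighted m F) = weighted (\<lambda>k. l k * m k) F"
  by (simp add: weighted_def mult.assoc)

lemma weighted_one: "weighted (\<lambda>k. 1) F = F"
  by (simp add: weighted_def)

lemma homogeneous_polynomial_continuous:
  "P \<in> homogeneous_polynomials k \<Longrightarrow> continuous_on UNIV P"
  by (auto simp: homogeneous_polynomials_def monomial_cvec_def intro!: continuous_intros)

lemma ball_measurable_series:
  assumes "homogeneous_series F"
  shows "ball_measurable (\<lambda>z. \<Sum>k. F k z)"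
proof -
  have [measurable]: "F k \<in> borel_measurable (restrict_space borel unit_ball)" for k
    using assms homogeneous_polynomial_continuous[of "F k" k]
    by (intro measurable_restrict_space1 borel_measurable_continuous_onI) (auto simp: homogeneous_series_def)
  show ?thesis
    unfolding ball_measurable_def by measurable
qed

lemma ball_measurable_cmult: "ball_measurable g \<Longrightarrow> ball_measurable (\<lambda>z. c * g z)"
  unfolding ball_measurable_def by (intro borel_measurable_times borel_measurable_const)

lemma ball_measurable_sum: "(\<And>i. i \<in> I \<Longrightarrow> ball_measurable (g i)) \<Longrightarrow> ball_measurable (\<lambda>z. \<Sum>i\<in>I. g i z)"
  unfolding ball_measurable_def by (rule borel_measurable_sum)

lemma ball_measurable_rotate:
  assumes "ball_measurable g" "norm c = 1"
  shows "ball_measurable (\<lambda>z. g (c *s z))"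
proof -
  have "(\<lambda>z. c *s z) \<in> restrict_space borel unit_ball \<rightarrow>\<^sub>M restrict_space borel unit_ball"
    using assms(2) by (intro measurable_restrict_space3) (auto simp: norm_scale_cvec)
  then show ?thesis
    using assms(1) unfolding ball_measurable_def by (rule measurable_compose)
qed

lemma integral_mean_cong:
  "0 \<le> r \<Longrightarrow> r < 1 \<Longrightarrow> (\<And>z. z \<in> unit_ball \<Longrightarrow> g z = h z) \<Longrightarrow> integral_mean p r g = integral_mean p r h"
  unfolding integral_mean_eq_lnorm by (intro lnorm_cong) (auto simp: space_sphere_measure)

lemma integral_mean_cmult:
  assumes "1 \<le> p" "ball_measurable g" "0 \<le> r" "r < 1"
  shows "integral_mean p r (\<lambda>z. c * g z) = ennreal (norm c) * integral_mean p r g"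
  using assms lnorm_cmult[OF assms(1) ball_measurable_dilate[OF assms(2-4)], of "ennreal (norm c)"]
  by (simp add: integral_mean_eq_lnorm norm_mult ennreal_mult)

lemma integral_mean_sum:
  assumes "1 \<le> p" "finite I" "\<And>i. i \<in> I \<Longrightarrow> ball_measurable (g i)" "0 \<le> r" "r < 1"
  shows "integral_mean p r (\<lambda>z. \<Sum>i\<in>I. g i z) \<le> (\<Sum>i\<in>I. integral_mean p r (g i))"
proof -
  have "lnorm p sphere_measure (\<lambda>\<zeta>. ennreal (norm (\<Sum>i\<in>I. g i (r *\<^sub>R \<zeta>))))
      \<le> lnorm p sphere_measure (\<lambda>\<zeta>. \<Sum>i\<in>I. ennreal (norm (g i (r *\<^sub>R \<zeta>))))"
    using assms ball_measurable_dilate[OF ball_measurable_sum[of I g], of r]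
    by (intro lnorm_mono) (auto simp: sum_ennreal intro!: ennreal_leI norm_sum)
  also have "\<dots> \<le> (\<Sum>i\<in>I. lnorm p sphere_measure (\<lambda>\<zeta>. ennreal (norm (g i (r *\<^sub>R \<zeta>)))))"
    using assms by (intro lnorm_sum ball_measurable_dilate) auto
  finally show ?thesis by (simp add: integral_mean_eq_lnorm)
qed

lemma integral_mean_add:
  assumes "1 \<le> p" "ball_measurable g" "ball_measurable h" "0 \<le> r" "r < 1"
  shows "integral_mean p r (\<lambda>z. g z + h z) \<le> integral_mean p r g + integral_mean p r h"
  using integral_mean_sum[of p "UNIV :: bool set" "\<lambda>b. if b then g else h" r] assms
  by (simp add: UNIV_bool add.commute)

lemma integral_mean_limit_le:
  assumes "1 \<le> p" "\<And>n. ball_measurable (g n)" "0 \<le> r" "r < 1"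
    and "\<And>z. z \<in> unit_ball \<Longrightarrow> (\<lambda>n. g n z) \<longlonglongrightarrow> h z" "\<And>n. integral_mean p r (g n) \<le> B"
  shows "integral_mean p r h \<le> B"
  unfolding integral_mean_eq_lnorm
proof (rule lnorm_limit_le[OF assms(1)])
  show "(\<lambda>\<zeta>. ennreal (norm (g n (r *\<^sub>R \<zeta>)))) \<in> borel_measurable sphere_measure" for n
    using assms by (intro ball_measurable_dilate) auto
  show "(\<lambda>n. ennreal (norm (g n (r *\<^sub>R \<zeta>)))) \<longlonglongrightarrow> ennreal (norm (h (r *\<^sub>R \<zeta>)))"
    if "\<zeta> \<in> space sphere_measure" for \<zeta>
    using assms that by (intro tendsto_ennrealI tendsto_norm assms(5)) (auto simp: space_sphere_measure)
  show "lnorm p sphere_measure (\<lambda>\<zeta>. ennreal (norm (g n (r *\<^sub>R \<zeta>)))) \<le> B" for n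
    using assms(6)[of n] by (simp add: integral_mean_eq_lnorm)
qed

lemma homogeneous_series_scale: "homogeneous_series F \<Longrightarrow> F k (w *s z) = w ^ k * F k z"
  by (rule homogeneous_polynomials_scale) (simp add: homogeneous_series_def)

text \<open>On the line through \<open>z\<close> the series is a power series in \<open>w\<close> that converges at some \<open>w > 1\<close>.\<close>

lemma homogeneous_series_line:
  assumes F: "homogeneous_series F" and z: "z \<in> unit_ball"
  shows "\<exists>u>1. \<forall>w :: complex. norm w < u \<longrightarrow> summable (\<lambda>k. F k z * w ^ k)"
proof -
  define u where "u = 2 / (1 + norm z)"
  have u: "1 < u" "u * norm z \<le> 1"
    using z norm_ge_zero[of z] by (auto simp: u_def field_simps add_pos_nonneg)
  have "summable (\<lambda>k. F k z * w ^ k)" if w: "norm w < u" for w :: complex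
  proof -
  have "norm (w *s z) < 1"
  proof (cases "z = 0")
    case False
    then have "norm w * norm z < u * norm z" using w by simp
    then show ?thesis using u by (simp add: norm_scale_cvec)
  qed simp
  then have "summable (\<lambda>k. F k (w *s z))" using F by (auto simp: homogeneous_series_def)
  then show ?thesis by (simp add: homogeneous_series_scale[OF F] mult.commute)
  qed
  with u(1) show ?thesis by blast
qed

lemma homogeneous_series_summable_norm:
  assumes F: "homogeneous_series F" and z: "z \<in> unit_ball"
  shows "summable (\<lambda>k. norm (F k z))"
proof -
  obtain u :: real where u: "1 < u" "\<And>w :: complex. norm w < u \<Longrightarrow> summable (\<lambda>k. F k z * w ^ k)"
    using homogeneous_series_line[OF F z] by blast
  have "summable (\<lambda>k. norm (F k z * 1 ^ k))"
    using u by (intro powser_insidea[of _ "of_real ((1 + u) / 2)"]) (auto simp del: of_real_add of_real_divide)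
  then show ?thesis by simp
qed

lemma homogeneous_series_weighted_bounded:
  assumes F: "homogeneous_series F" and l: "\<And>k. \<bar>l k\<bar> \<le> B"
  shows "homogeneous_series (weighted l F)"
  unfolding homogeneous_series_def
proof (intro conjI ballI allI)
  show "weighted l F k \<in> homogeneous_polynomials k" for k
    using F by (auto simp: weighted_def homogeneous_series_def intro: cmult_in_homogeneous)
  fix z :: "complex ^ 'a" assume z: "z \<in> unit_ball"
  show "summable (\<lambda>k. weighted l F k z)"
  proof (rule summable_comparison_test')
    show "summable (\<lambda>k. B * norm (F k z))"
      using homogeneous_series_summable_norm[OF F z] by (rule summable_mult)
    show "norm (weighted l F k z) \<le> B * norm (F k z)" for k
      using l[of k] by (simp add: weighted_def norm_mult mult_right_mono)
  qed
qed

lemma homogeneous_series_weighted_index: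
  assumes F: "homogeneous_series F"
  shows "homogeneous_series (weighted real F)"
  unfolding homogeneous_series_def
proof (intro conjI ballI allI)
  show "weighted real F k \<in> homogeneous_polynomials k" for k
    using F by (auto simp: weighted_def homogeneous_series_def intro: cmult_in_homogeneous)
  fix z :: "complex ^ 'a" assume z: "z \<in> unit_ball"
  obtain u :: real where u: "1 < u" "\<And>w :: complex. norm w < u \<Longrightarrow> summable (\<lambda>k. F k z * w ^ k)"
    using homogeneous_series_line[OF F z] by blast
  have "summable (\<lambda>n. diffs (\<lambda>k. F k z) n * 1 ^ n)"
    using u by (intro termdiff_converges[of _ u]) auto
  then have "summable (\<lambda>n. weighted real F (Suc n) z)"
    by (simp add: diffs_def weighted_def)
  then show "summable (\<lambda>k. weighted real F k z)"
    by (simp only: summable_Suc_iff[of "\<lambda>k. weighted real F k z"])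
qed

lemma homogeneous_series_weighted_power:
  assumes F: "homogeneous_series F"
  shows "homogeneous_series (weighted (\<lambda>k. real k ^ s) F)"
proof (induction s)
  case (Suc s)
  from homogeneous_series_weighted_index[OF this] show ?case
    by (simp add: weighted_weighted)
qed (simp add: weighted_one F)

text \<open>Tannery's theorem, with the absolutely convergent series \<open>\<Sum>k. C |f\<^sub>k(z)|\<close> as a majorant.\<close>

lemma tendsto_series_weights:
  fixes c :: "nat \<Rightarrow> nat \<Rightarrow> complex"
  assumes F: "homogeneous_series F" and z: "z \<in> unit_ball"
    and lim: "\<And>k. (\<lambda>n. c n k) \<longlonglongrightarrow> d k" and bnd: "\<And>n k. norm (c n k) \<le> C"
  shows "(\<lambda>n. \<Sum>k. c n k * F k z) \<longlonglongrightarrow> (\<Sum>k. d k * F k z)"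
proof -
  show ?thesis
  proof (rule tannerys_theorem[THEN conjunct2, THEN conjunct2])
    show "(\<lambda>n. c n k * F k z) \<longlonglongrightarrow> d k * F k z" for k
      by (intro tendsto_intros lim)
    show "summable (\<lambda>k. C * norm (F k z))"
      using homogeneous_series_summable_norm[OF F z] by (rule summable_mult)
    show "\<forall>\<^sub>F (k, n) in sequentially \<times>\<^sub>F sequentially. norm (c n k * F k z) \<le> C * norm (F k z)"
      using bnd by (intro always_eventually) (auto simp: norm_mult intro!: mult_right_mono)
  qed simp
qed

section \<open>Fejer means\<close>

lemma root_of_unity_orthogonality:
  fixes M a b :: nat
  assumes "a < M" "b < M"
  defines "\<omega> \<equiv> exp (2 * of_real pi * \<i> / of_nat M)"
  shows "(\<Sum>j<M. (\<omega> ^ j) ^ a * cnj ((\<omega> ^ j) ^ b)) = (if a = b then of_nat M else 0)"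
proof -
  have M: "1 \<le> M" using assms by simp
  have norm: "norm \<omega> = 1"
    by (simp add: \<omega>_def)
  have pow: "\<omega> ^ d = exp (2 * of_real pi * \<i> * of_nat d / of_nat M)" for d
    by (simp add: \<omega>_def exp_of_nat_mult[symmetric] mult_ac)
  have geom: "(\<Sum>j<M. (\<omega> ^ d) ^ j) = 0" if d: "0 < d" "d < M" for d
  proof -
    have "\<omega> ^ d \<noteq> 1"
      using complex_root_unity_eq_1[OF M, of d] d by (auto simp: pow dest: dvd_imp_le)
    moreover have "(\<omega> ^ d) ^ M = 1"
    proof -
      have "\<omega> ^ M = 1" using complex_root_unity_eq_1[OF M, of M] by (simp add: pow)
      then show ?thesis by (metis power_commutes power_mult mult.commute power_one)
    qed
    ultimately show ?thesis by (simp add: geometric_sum)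
  qed
  have unit: "\<omega> ^ e * cnj (\<omega> ^ e) = 1" for e
  proof -
    have "\<omega> ^ e * cnj (\<omega> ^ e) = of_real ((norm (\<omega> ^ e))\<^sup>2)" by (simp only: complex_norm_square)
    then show ?thesis by (simp add: norm_power norm)
  qed
  have key: "(\<Sum>j<M. (\<omega> ^ j) ^ a * cnj ((\<omega> ^ j) ^ b)) = 0" if "b < a" "a < M" for a b
  proof -
    have "(\<omega> ^ j) ^ a * cnj ((\<omega> ^ j) ^ b) = (\<omega> ^ (a - b)) ^ j" for j
    proof -
      have "(\<omega> ^ j) ^ a = (\<omega> ^ (a - b)) ^ j * \<omega> ^ (j * b)"
        using that by (simp flip: power_mult power_add) (metis add_mult_distrib2 le_add_diff_inverse2 less_imp_le mult.commute)
      then show ?thesis using unit[of "j * b"] by (simp add: mult.assoc flip: power_mult)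
    qed
    then show ?thesis using geom[of "a - b"] that by simp
  qed
  consider "a = b" | "b < a" | "a < b" by linarith
  then show ?thesis
  proof cases
    case 1
    then show ?thesis using unit by (simp flip: power_mult)
  next
    case 2
    then show ?thesis using key assms by simp
  next
    case 3
    have "(\<Sum>j<M. (\<omega> ^ j) ^ a * cnj ((\<omega> ^ j) ^ b)) = cnj (\<Sum>j<M. (\<omega> ^ j) ^ b * cnj ((\<omega> ^ j) ^ a))"
      by (simp add: mult.commute)
    also have "\<dots> = 0"
      unfolding key[OF 3 assms(2)] by simp
    finally show ?thesis using 3 by simp
  qed
qed

text \<open>In the expanded square, orthogonality keeps the pairs with \<open>k + l = m\<close>, of which there are \<open>n - k\<close>.\<close>

lemma fejer_kernel_coefficient:
  fixes M n k :: nat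
  defines "\<omega> \<equiv> exp (2 * of_real pi * \<i> / of_nat M)"
  assumes "n + k \<le> M" "0 < M"
  shows "(\<Sum>j<M. of_real ((norm (\<Sum>l<n. (\<omega> ^ j) ^ l))\<^sup>2) * (\<omega> ^ j) ^ k) = of_nat M * of_nat (n - k)"
proof -
  have "(\<Sum>j<M. of_real ((norm (\<Sum>l<n. (\<omega> ^ j) ^ l))\<^sup>2) * (\<omega> ^ j) ^ k)
      = (\<Sum>j<M. \<Sum>l<n. \<Sum>m<n. (\<omega> ^ j) ^ (k + l) * cnj ((\<omega> ^ j) ^ m))"
  proof (intro sum.cong refl)
    fix j
    have "of_real ((norm (\<Sum>l<n. (\<omega> ^ j) ^ l))\<^sup>2) = (\<Sum>l<n. \<Sum>m<n. (\<omega> ^ j) ^ l * cnj ((\<omega> ^ j) ^ m))"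
      by (simp only: complex_norm_square cnj_sum sum_product)
    then show "of_real ((norm (\<Sum>l<n. (\<omega> ^ j) ^ l))\<^sup>2) * (\<omega> ^ j) ^ k
        = (\<Sum>l<n. \<Sum>m<n. (\<omega> ^ j) ^ (k + l) * cnj ((\<omega> ^ j) ^ m))"
      by (simp only: sum_distrib_right sum_distrib_left power_add mult_ac)
  qed
  also have "\<dots> = (\<Sum>l<n. \<Sum>m<n. \<Sum>j<M. (\<omega> ^ j) ^ (k + l) * cnj ((\<omega> ^ j) ^ m))"
    by (subst sum.swap, intro sum.cong refl sum.swap)
  also have "\<dots> = (\<Sum>l<n. \<Sum>m<n. if k + l = m then of_nat M else 0)"
    unfolding \<omega>_def using assms by (intro sum.cong refl root_of_unity_orthogonality) auto
  also have "\<dots> = (\<Sum>l<n. if l < n - k then of_nat M else 0)"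
    by (intro sum.cong refl) (auto simp: sum.delta')
  also have "\<dots> = (\<Sum>l<n - k. of_nat M)"
    by (rule sum.mono_neutral_cong_right) auto
  finally show ?thesis by simp
qed

text \<open>The weights \<open>max 0 (n - k)\<close> are the Fourier coefficients of the nonnegative kernel
  \<open>|1 + w + \<dots> + w\<^sup>n\<^sup>-\<^sup>1|\<^sup>2\<close>, whose mean over the unit circle is \<open>n\<close>.  Hence the weighted series is \<open>n\<close> times an
  average of rotations of \<open>f\<close>, and these all have the same means.  Averages over the \<open>M\<close>-th roots of unity
  replace integrals over the circle; letting \<open>M\<close> tend to infinity removes the aliasing.\<close>

lemma series_mean_fejer:
  fixes F :: "nat \<Rightarrow> complex ^ 'n \<Rightarrow> complex"
  assumes p: "1 \<le> p" and F: "homogeneous_series F" and r: "0 \<le> r" "r < 1"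
  shows "series_mean p r (weighted (\<lambda>k. real (n - k)) F) \<le> ennreal (real n) * series_mean p r F"
proof -
  \<comment> \<open>at least \<open>n\<close> roots, so that the average of the kernel is exactly \<open>n\<close>\<close>
  define M where "M i = n + Suc i" for i
  define \<omega> where "\<omega> i = exp (2 * of_real pi * \<i> / of_nat (M i))" for i
  define K where "K i j = (norm (\<Sum>l<n. (\<omega> i ^ j) ^ l))\<^sup>2 / real (M i)" for i j
  define f where "f z = (\<Sum>k. F k z)" for z
  define g where "g i z = (\<Sum>j<M i. of_real (K i j) * f (\<omega> i ^ j *s z))" for i z
  define \<kappa> where "\<kappa> i k = (\<Sum>j<M i. of_real (K i j) * (\<omega> i ^ j) ^ k)" for i k
  have M_pos: "0 < M i" for i by (simp add: M_def)
  have norm_\<omega>: "norm (\<omega> i ^ j) = 1" for i j by (simp add: \<omega>_def norm_power)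
  have K0: "0 \<le> K i j" for i j by (simp add: K_def)
  have \<kappa>: "\<kappa> i k = of_nat (n - k)" if "n + k \<le> M i" for i k
  proof -
    have "\<kappa> i k = (\<Sum>j<M i. of_real ((norm (\<Sum>l<n. (\<omega> i ^ j) ^ l))\<^sup>2) * (\<omega> i ^ j) ^ k) / of_nat (M i)"
      by (simp add: \<kappa>_def K_def sum_divide_distrib)
    also have "\<dots> = of_nat (n - k)"
      using fejer_kernel_coefficient[of n k "M i", folded \<omega>_def] that M_pos[of i] by simp
    finally show ?thesis .
  qed
  have K_sum: "(\<Sum>j<M i. K i j) = real n" for i
  proof -
    have "of_real (\<Sum>j<M i. K i j) = (of_real (real n) :: complex)"
      using \<kappa>[of 0 i] by (simp add: \<kappa>_def M_def)
    then show ?thesis by (simp only: of_real_eq_iff)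
  qed
  have \<kappa>_bound: "norm (\<kappa> i k) \<le> real n" for i k
  proof -
    have "norm (\<kappa> i k) \<le> (\<Sum>j<M i. norm (of_real (K i j) * (\<omega> i ^ j) ^ k))"
      unfolding \<kappa>_def by (rule norm_sum)
    also have "\<dots> = real n"
      using K0 by (simp add: norm_mult norm_power[of "\<omega> i ^ _"] norm_\<omega> K_sum)
    finally show ?thesis .
  qed
  have fm: "ball_measurable f"
    unfolding f_def by (rule ball_measurable_series[OF F])
  have gm: "ball_measurable (g i)" for i
    unfolding g_def
    by (intro ball_measurable_sum ball_measurable_cmult ball_measurable_rotate fm norm_\<omega>)
  have g_eq: "g i z = (\<Sum>k. \<kappa> i k * F k z)" if z: "z \<in> unit_ball" for i z
  proof -
    have "summable (\<lambda>k. F k (\<omega> i ^ j *s z))" for j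
      using F z norm_\<omega>[of i j] by (auto simp: homogeneous_series_def norm_scale_cvec)
    then have sj: "summable (\<lambda>k. (\<omega> i ^ j) ^ k * F k z)" for j
      by (simp add: homogeneous_series_scale[OF F])
    have "g i z = (\<Sum>j<M i. \<Sum>k. of_real (K i j) * ((\<omega> i ^ j) ^ k * F k z))"
      unfolding g_def f_def
      by (intro sum.cong refl) (simp add: homogeneous_series_scale[OF F] suminf_mult[OF sj])
    also have "\<dots> = (\<Sum>k. \<Sum>j<M i. of_real (K i j) * ((\<omega> i ^ j) ^ k * F k z))"
      by (intro suminf_sum[symmetric] summable_mult sj)
    also have "\<dots> = (\<Sum>k. \<kappa> i k * F k z)"
      by (simp add: \<kappa>_def sum_distrib_right mult.assoc)
    finally show ?thesis .
  qed
  have "integral_mean p r (\<lambda>z. \<Sum>k. of_nat (n - k) * F k z) \<le> ennreal (real n) * series_mean p r F"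
  proof (rule integral_mean_limit_le[OF p gm r])
    fix z :: "complex ^ 'n" assume z: "z \<in> unit_ball"
    show "(\<lambda>i. g i z) \<longlonglongrightarrow> (\<Sum>k. of_nat (n - k) * F k z)"
      unfolding g_eq[OF z]
    proof (rule tendsto_series_weights[OF F z _ \<kappa>_bound])
      show "(\<lambda>i. \<kappa> i k) \<longlonglongrightarrow> of_nat (n - k)" for k
        by (rule tendsto_eventually) (auto simp: M_def intro!: \<kappa> eventually_sequentiallyI[of k])
    qed
  next
    fix i
    have "integral_mean p r (g i) \<le> (\<Sum>j<M i. integral_mean p r (\<lambda>z. of_real (K i j) * f (\<omega> i ^ j *s z)))"
      unfolding g_def
      by (intro integral_mean_sum p r ball_measurable_cmult ball_measurable_rotate fm norm_\<omega>) auto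
    also have "\<dots> = (\<Sum>j<M i. ennreal (K i j) * integral_mean p r (\<lambda>z. f (\<omega> i ^ j *s z)))"
      using K0 by (simp add: integral_mean_cmult[OF p ball_measurable_rotate[OF fm norm_\<omega>] r])
    also have "\<dots> \<le> (\<Sum>j<M i. ennreal (K i j) * integral_mean p r f)"
      by (intro sum_mono mult_left_mono integral_mean_rotation[OF fm r norm_\<omega> p]) auto
    also have "\<dots> = ennreal (real n) * integral_mean p r f"
      using K0 by (simp add: K_sum flip: sum_distrib_right)
    finally show "integral_mean p r (g i) \<le> ennreal (real n) * series_mean p r F"
      by (simp add: series_mean_def f_def[abs_def])
  qed
  then show ?thesis by (simp add: series_mean_def weighted_def)
qed

section \<open>Convex weights\<close>

text \<open>The triangle inequality, which extends bounds from the Fejer weights to their linear combinations.\<close>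

lemma series_mean_weight_combination:
  fixes F :: "nat \<Rightarrow> complex ^ 'n \<Rightarrow> complex"
  assumes p: "1 \<le> p" and F: "homogeneous_series F" and r: "0 \<le> r" "r < 1" and I: "finite I"
    and m: "\<And>i k. i \<in> I \<Longrightarrow> \<bar>m i k\<bar> \<le> B i" and c: "\<And>i. i \<in> I \<Longrightarrow> 0 \<le> b i"
    and bound: "\<And>i. i \<in> I \<Longrightarrow> series_mean p r (weighted (m i) F) \<le> ennreal (b i) * X"
  shows "series_mean p r (weighted (\<lambda>k. \<Sum>i\<in>I. c i * m i k) F) \<le> ennreal (\<Sum>i\<in>I. \<bar>c i\<bar> * b i) * X"
proof -
  have hs: "homogeneous_series (weighted (m i) F)" if "i \<in> I" for i
    using m[OF that] by (rule homogeneous_series_weighted_bounded[OF F])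
  have eq: "(\<Sum>k. weighted (\<lambda>k. \<Sum>i\<in>I. c i * m i k) F k z) = (\<Sum>i\<in>I. of_real (c i) * (\<Sum>k. weighted (m i) F k z))"
    if z: "z \<in> unit_ball" for z
  proof -
    have s: "summable (\<lambda>k. weighted (m i) F k z)" if "i \<in> I" for i
      using hs[OF that] z by (auto simp: homogeneous_series_def)
    have "(\<Sum>i\<in>I. of_real (c i) * (\<Sum>k. weighted (m i) F k z)) = (\<Sum>i\<in>I. \<Sum>k. of_real (c i) * weighted (m i) F k z)"
      by (intro sum.cong refl suminf_mult[symmetric] s)
    also have "\<dots> = (\<Sum>k. \<Sum>i\<in>I. of_real (c i) * weighted (m i) F k z)"
      by (intro suminf_sum[symmetric] summable_mult s)
    finally show ?thesis by (simp add: weighted_def sum_distrib_right mult.assoc)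
  qed
  have bm: "ball_measurable (\<lambda>z. \<Sum>k. weighted (m i) F k z)" if "i \<in> I" for i
    using ball_measurable_series[OF hs[OF that]] .
  have "series_mean p r (weighted (\<lambda>k. \<Sum>i\<in>I. c i * m i k) F)
      = integral_mean p r (\<lambda>z. \<Sum>i\<in>I. of_real (c i) * (\<Sum>k. weighted (m i) F k z))"
    unfolding series_mean_def by (intro integral_mean_cong r eq)
  also have "\<dots> \<le> (\<Sum>i\<in>I. integral_mean p r (\<lambda>z. of_real (c i) * (\<Sum>k. weighted (m i) F k z)))"
    by (intro integral_mean_sum p I r ball_measurable_cmult bm)
  also have "\<dots> = (\<Sum>i\<in>I. ennreal \<bar>c i\<bar> * series_mean p r (weighted (m i) F))"
    by (intro sum.cong refl) (simp add: integral_mean_cmult[OF p bm r] series_mean_def)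
  also have "\<dots> \<le> (\<Sum>i\<in>I. ennreal \<bar>c i\<bar> * (ennreal (b i) * X))"
    by (intro sum_mono mult_left_mono bound) auto
  also have "\<dots> = (\<Sum>i\<in>I. ennreal (\<bar>c i\<bar> * b i)) * X"
    using c by (simp add: ennreal_mult sum_distrib_right mult.assoc)
  also have "(\<Sum>i\<in>I. ennreal (\<bar>c i\<bar> * b i)) = ennreal (\<Sum>i\<in>I. \<bar>c i\<bar> * b i)"
    using c by (intro sum_ennreal) auto
  finally show ?thesis .
qed

lemma second_difference_summation:
  fixes l :: "nat \<Rightarrow> real"
  assumes "k \<le> Suc n"
  shows "l k = l (Suc n) + (l n - l (Suc n)) * real (Suc n - k)
      + (\<Sum>m<n. (l m - 2 * l (Suc m) + l (Suc (Suc m))) * real (Suc m - k))"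
  using assms
proof (induction n)
  case 0
  then have "k = 0 \<or> k = 1" by auto
  then show ?case by auto
next
  case (Suc n)
  show ?case
  proof (cases "k \<le> Suc n")
    case True
    have "real (Suc (Suc n) - k) = real (Suc n - k) + 1" using True by simp
    then show ?thesis
      using Suc.IH[OF True] by (simp add: algebra_simps)
  next
    case False
    with Suc.prems have "k = Suc (Suc n)" by simp
    then show ?thesis by simp
  qed
qed

text \<open>Summation by parts, twice, writes a polynomial with weights \<open>l\<close> as a combination of Fejer means with the
  second differences of \<open>l\<close> as coefficients.  For convex weights these are nonnegative, so that the
  sum of their absolute values telescopes.\<close>

lemma series_mean_convex_weight_polynomial:
  fixes F :: "nat \<Rightarrow> complex ^ 'n \<Rightarrow> complex"
  assumes p: "1 \<le> p" and F: "homogeneous_series F" and r: "0 \<le> r" "r < 1"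
    and deg: "\<And>k z. Suc n < k \<Longrightarrow> F k z = 0"
    and convex: "\<And>m. m < n \<Longrightarrow> 2 * l (Suc m) \<le> l m + l (Suc (Suc m))"
    and nonneg: "0 \<le> l (Suc n)"
  shows "series_mean p r (weighted l F)
      \<le> ennreal (l 0 + 2 * real (Suc n) * max 0 (l (Suc n) - l n)) * series_mean p r F"
proof -
  \<comment> \<open>the combination: Fejer weights \<open>max 0 (m + 1 - k)\<close> for \<open>m \<le> n\<close>, and the identity in position \<open>n + 1\<close>\<close>
  define c where "c m = (if m < n then l m - 2 * l (Suc m) + l (Suc (Suc m))
      else if m = n then l n - l (Suc n) else l (Suc n))" for m
  define t where "t m k = (if m \<le> n then real (Suc m - k) else 1)" for m k :: nat
  define b where "b m = (if m \<le> n then real (Suc m) else 1)" for m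
  have l: "l k = (\<Sum>m<n + 2. c m * t m k)" if "k \<le> Suc n" for k
    using second_difference_summation[OF that, of l] by (simp add: c_def t_def)
  have w: "weighted l F = weighted (\<lambda>k. \<Sum>m<n + 2. c m * t m k) F"
  proof (intro ext)
    fix k z
    show "weighted l F k z = weighted (\<lambda>k. \<Sum>m<n + 2. c m * t m k) F k z"
      using l[of k] deg[of k z] by (cases "k \<le> Suc n") (simp_all only: weighted_def not_le mult_zero_right)
  qed
  have "series_mean p r (weighted l F) \<le> ennreal (\<Sum>m<n + 2. \<bar>c m\<bar> * b m) * series_mean p r F"
    unfolding w
  proof (rule series_mean_weight_combination[OF p F r, where B = b])
    show "\<bar>t m k\<bar> \<le> b m" for m k by (auto simp: t_def b_def)
    show "0 \<le> b m" for m by (simp add: b_def)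
    show "series_mean p r (weighted (t m) F) \<le> ennreal (b m) * series_mean p r F" for m
    proof (cases "m \<le> n")
      case True
      then have "t m = (\<lambda>k. real (Suc m - k))" by (auto simp: t_def)
      then show ?thesis using series_mean_fejer[OF p F r, of "Suc m"] True by (simp only: b_def if_True)
    next
      case False
      then have "t m = (\<lambda>k. 1)" by (auto simp: t_def)
      then show ?thesis using False by (simp add: b_def weighted_one)
    qed
  qed simp
  also have "(\<Sum>m<n + 2. \<bar>c m\<bar> * b m) = l 0 + 2 * real (Suc n) * max 0 (l (Suc n) - l n)"
  proof -
    have "(\<Sum>m<n. \<bar>c m\<bar> * b m) = (\<Sum>m<n. (l m - 2 * l (Suc m) + l (Suc (Suc m))) * real (Suc m))"
    proof (intro sum.cong refl)
      fix m assume "m \<in> {..<n}"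
      then show "\<bar>c m\<bar> * b m = (l m - 2 * l (Suc m) + l (Suc (Suc m))) * real (Suc m)"
        using convex[of m] by (simp add: c_def b_def)
    qed
    also have "\<dots> = l 0 - l (Suc n) - (l n - l (Suc n)) * real (Suc n)"
      using second_difference_summation[of 0 n l] by simp
    finally have "(\<Sum>m<n + 2. \<bar>c m\<bar> * b m)
        = l 0 - l (Suc n) - (l n - l (Suc n)) * real (Suc n) + \<bar>l n - l (Suc n)\<bar> * real (Suc n) + l (Suc n)"
      using nonneg by (simp add: c_def b_def)
    then show ?thesis
      by (simp only:) (cases "l n \<le> l (Suc n)"; simp add: max_def algebra_simps)
  qed
  finally show ?thesis .
qed

text \<open>The polynomial case applies to the Fejer means of the series, and the bound is independent of their degree.\<close>

lemma series_mean_convex_decreasing_weight: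
  fixes F :: "nat \<Rightarrow> complex ^ 'n \<Rightarrow> complex"
  assumes p: "1 \<le> p" and F: "homogeneous_series F" and r: "0 \<le> r" "r < 1"
    and convex: "\<And>m. 2 * l (Suc m) \<le> l m + l (Suc (Suc m))"
    and nonneg: "\<And>m. 0 \<le> l m" and dec: "\<And>m. l (Suc m) \<le> l m"
  shows "series_mean p r (weighted l F) \<le> ennreal (l 0) * series_mean p r F"
proof -
  have l0: "l k \<le> l 0" for k
    using dec lift_Suc_antimono_le[of l 0 k] by simp
  define T where "T n = weighted (\<lambda>k. real (Suc n - k) / real (Suc n)) F" for n
  have Ts: "homogeneous_series (T n)" for n
    unfolding T_def by (rule homogeneous_series_weighted_bounded[OF F, of _ 1]) (simp add: divide_simps)
  have TF: "series_mean p r (T n) \<le> series_mean p r F" for n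
  proof -
    have "series_mean p r (weighted (\<lambda>k. \<Sum>i\<in>{()}. 1 / real (Suc n) * real (Suc n - k)) F)
        \<le> ennreal (\<Sum>i\<in>{()}. \<bar>1 / real (Suc n)\<bar> * real (Suc n)) * series_mean p r F"
      by (rule series_mean_weight_combination[OF p F r, where B = "\<lambda>_. real (Suc n)"])
         (use series_mean_fejer[OF p F r, of "Suc n"] in auto)
    then show ?thesis by (simp add: T_def)
  qed
  have "series_mean p r (weighted l (T n)) \<le> ennreal (l 0) * series_mean p r F" for n
  proof -
    have "series_mean p r (weighted l (T n))
        \<le> ennreal (l 0 + 2 * real (Suc n) * max 0 (l (Suc n) - l n)) * series_mean p r (T n)"
      using convex nonneg
      by (intro series_mean_convex_weight_polynomial p Ts r) (auto simp: T_def weighted_def)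
    also have "max 0 (l (Suc n) - l n) = 0" using dec[of n] by simp
    finally show ?thesis using mult_left_mono[OF TF[of n], of "ennreal (l 0)"] by (simp add: order_trans)
  qed
  then have bound: "integral_mean p r (\<lambda>z. \<Sum>k. weighted l (T n) k z) \<le> ennreal (l 0) * series_mean p r F" for n
    by (simp add: series_mean_def)
  have "integral_mean p r (\<lambda>z. \<Sum>k. weighted l F k z) \<le> ennreal (l 0) * series_mean p r F"
  proof (rule integral_mean_limit_le[OF p _ r _ bound])
    show "ball_measurable (\<lambda>z. \<Sum>k. weighted l (T n) k z)" for n
      using l0 nonneg
      by (intro ball_measurable_series homogeneous_series_weighted_bounded[OF Ts, of _ "l 0"]) auto
    fix z :: "complex ^ 'n" assume z: "z \<in> unit_ball"
    have "(\<lambda>n. \<Sum>k. of_real (l k * (real (Suc n - k) / real (Suc n))) * F k z) \<longlonglongrightarrow> (\<Sum>k. of_real (l k) * F k z)"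
    proof (rule tendsto_series_weights[OF F z])
      show "(\<lambda>n. of_real (l k * (real (Suc n - k) / real (Suc n)))) \<longlonglongrightarrow> (of_real (l k) :: complex)" for k
      proof -
        have "(\<lambda>n. 1 - real k / real (Suc n)) \<longlonglongrightarrow> 1" by real_asymp
        moreover have "\<forall>\<^sub>F n in sequentially. 1 - real k / real (Suc n) = real (Suc n - k) / real (Suc n)"
          by (intro eventually_sequentiallyI[of k]) (auto simp: field_simps)
        ultimately have "(\<lambda>n. real (Suc n - k) / real (Suc n)) \<longlonglongrightarrow> 1"
          by (rule Lim_transform_eventually)
        from tendsto_mult_left[OF this, of "l k"] show ?thesis
          by (intro tendsto_of_real) simp
      qed
      show "norm (of_real (l k * (real (Suc n - k) / real (Suc n))) :: complex) \<le> l 0" for n k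
      proof -
        have "l k * (real (Suc n - k) / real (Suc n)) \<le> l 0 * 1"
          using l0 nonneg by (intro mult_mono) auto
        then show ?thesis using nonneg[of k] by (simp add: norm_of_real abs_mult del: of_real_mult of_real_divide)
      qed
    qed
    then show "(\<lambda>n. \<Sum>k. weighted l (T n) k z) \<longlonglongrightarrow> (\<Sum>k. weighted l F k z)"
      by (simp add: T_def weighted_weighted) (simp add: weighted_def)
  qed
  then show ?thesis by (simp add: series_mean_def)
qed

section \<open>Dilations and inequalities of Bernstein type\<close>

lemma series_mean_dilate: "series_mean p (t * r) F = series_mean p r (weighted (\<lambda>k. t ^ k) F)"
  if "homogeneous_series F"
proof -
  have "F k ((t * r) *\<^sub>R z) = of_real (t ^ k) * F k (r *\<^sub>R z)" for k z
  proof -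
    have "(t * r) *\<^sub>R z = of_real t *s (r *\<^sub>R z)" by (simp add: vec_eq_iff) (simp add: scaleR_conv_of_real)
    then show ?thesis by (simp only: homogeneous_series_scale[OF that] of_real_power)
  qed
  then show ?thesis
    by (simp add: series_mean_def integral_mean_def weighted_def)
qed

lemma power_weight_convex: "2 * t ^ Suc m \<le> t ^ m + t ^ Suc (Suc m)" if "0 \<le> t" for t :: real
proof -
  have "0 \<le> t ^ m * (1 - t)\<^sup>2" using that by simp
  then show ?thesis by (simp add: power2_eq_square algebra_simps)
qed

text \<open>The dilation by \<open>t \<le> 1\<close> has the convex decreasing weights \<open>t\<^sup>k\<close>; this replaces subharmonicity.\<close>

lemma series_mean_mono:
  assumes p: "1 \<le> p" and F: "homogeneous_series F" and r: "0 \<le> r" "r \<le> r'" "r' < 1"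
  shows "series_mean p r F \<le> series_mean p r' F"
proof (cases "r' = 0")
  case False
  define t where "t = r / r'"
  have t: "0 \<le> t" "t \<le> 1" "t * r' = r" using False r by (auto simp: t_def)
  have "series_mean p r' (weighted (\<lambda>k. t ^ k) F) \<le> ennreal (t ^ 0) * series_mean p r' F"
    using t r False
    by (intro series_mean_convex_decreasing_weight p F power_weight_convex)
       (auto simp: mult_left_le_one_le)
  then show ?thesis
    using series_mean_dilate[OF F, of p t r'] t by simp
qed (use r in simp)

text \<open>The weights \<open>k\<close> are linear, so that only the boundary term of the summation by parts remains.\<close>

lemma series_mean_bernstein:
  assumes p: "1 \<le> p" and F: "homogeneous_series F" and r: "0 \<le> r" "r < 1"
    and deg: "\<And>k z. n < k \<Longrightarrow> F k z = 0" and n: "1 \<le> n"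
  shows "series_mean p r (weighted (\<lambda>k. real k ^ s) F) \<le> ennreal ((2 * real n) ^ s) * series_mean p r F"
proof (induction s)
  case (Suc s)
  let ?G = "weighted (\<lambda>k. real k ^ s) F"
  obtain m where m: "n = Suc m" using n by (cases n) auto
  have "series_mean p r (weighted real ?G)
      \<le> ennreal (real 0 + 2 * real (Suc m) * max 0 (real (Suc m) - real m)) * series_mean p r ?G"
    using deg by (intro series_mean_convex_weight_polynomial p r homogeneous_series_weighted_power F)
      (auto simp: weighted_def m)
  also have "\<dots> \<le> ennreal (2 * real n) * (ennreal ((2 * real n) ^ s) * series_mean p r F)"
    using Suc.IH by (intro mult_mono) (auto simp: m)
  also have "\<dots> = ennreal ((2 * real n) ^ Suc s) * series_mean p r F"
    by (simp add: ennreal_mult mult.assoc)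
  finally show ?case by (simp add: weighted_weighted)
qed (simp add: weighted_one)

text \<open>The weights \<open>k t\<^sup>k\<close> are neither convex nor monotone, but \<open>(k + c) t\<^sup>k\<close> and \<open>c t\<^sup>k\<close> are convex and
  decreasing as soon as \<open>c (1 - t) \<ge> 2 t\<close>.\<close>

lemma series_mean_index_power_weight:
  assumes p: "1 \<le> p" and F: "homogeneous_series F" and r: "0 \<le> r" "r < 1" and t: "0 \<le> t" "t < 1"
  shows "series_mean p r (weighted (\<lambda>k. real k * t ^ k) F) \<le> ennreal (4 / (1 - t)) * series_mean p r F"
proof -
  define c where "c = 2 / (1 - t)"
  have c: "0 < c" using t by (simp add: c_def)
  moreover have "c * (1 - t) = 2"
    by (rule nonzero_eq_divide_eq[THEN iffD1, OF _ c_def]) (use t in simp)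
  ultimately have c: "0 < c" "c * (1 - t) = 2" by auto
  define m where "m b k = (if b then (real k + c) * t ^ k else t ^ k)" for b k
  have cong: "m b = (if b then (\<lambda>k. (real k + c) * t ^ k) else (\<lambda>k. t ^ k))" for b
    by (auto simp: m_def)
  have nonneg: "0 \<le> m b k" for b k using t c by (auto simp: m_def)
  have conv: "2 * m b (Suc k) \<le> m b k + m b (Suc (Suc k))" for b k
  proof (cases b)
    case True
    have "0 \<le> t ^ k * ((1 - t) * (real k * (1 - t) + 2 * (1 - t)))"
      using t by (intro mult_nonneg_nonneg add_nonneg_nonneg) auto
    also have "2 * (1 - t) = c * (1 - t) - 2 * t" using c by simp
    also have "t ^ k * ((1 - t) * (real k * (1 - t) + (c * (1 - t) - 2 * t))) = m b k + m b (Suc (Suc k)) - 2 * m b (Suc k)"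
      using True by (simp add: m_def algebra_simps power2_eq_square)
    finally show ?thesis by simp
  qed (use t power_weight_convex[of t k] in \<open>simp add: m_def\<close>)
  have dec: "m b (Suc k) \<le> m b k" for b k
  proof (cases b)
    case True
    have "0 \<le> t ^ k * (real k * (1 - t) + (2 - t))"
      using t by (intro mult_nonneg_nonneg add_nonneg_nonneg) auto
    also have "2 - t = c * (1 - t) - t" using c by simp
    also have "t ^ k * (real k * (1 - t) + (c * (1 - t) - t)) = m b k - m b (Suc k)"
      using True by (simp add: m_def algebra_simps)
    finally show ?thesis by simp
  qed (use t in \<open>simp add: m_def mult_left_le_one_le\<close>)
  have m0: "\<bar>m b k\<bar> \<le> m b 0" for b k
    using lift_Suc_antimono_le[of "m b" 0 k] dec nonneg by simp
  have "series_mean p r (weighted (\<lambda>k. \<Sum>b\<in>UNIV. (if b then 1 else - c) * m b k) F)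
      \<le> ennreal (\<Sum>b\<in>UNIV. \<bar>if b then 1 else - c\<bar> * m b 0) * series_mean p r F"
    using nonneg conv dec
    by (intro series_mean_weight_combination[OF p F r _ m0] series_mean_convex_decreasing_weight p F r) auto
  moreover have "(\<Sum>b\<in>UNIV. (if b then 1 else - c) * m b k) = real k * t ^ k" for k
    by (simp add: UNIV_bool m_def algebra_simps)
  moreover have "(\<Sum>b\<in>UNIV. \<bar>if b then 1 else - c\<bar> * m b 0) = 4 / (1 - t)"
    using c(1) by (simp add: UNIV_bool m_def) (simp add: c_def)
  ultimately show ?thesis by simp
qed

text \<open>One factor \<open>k t\<^sup>k\<close> costs \<open>4 / (1 - t)\<close>.  The radius \<open>r\<close> is reached from some \<open>\<rho> < 1\<close> by \<open>s\<close> dilations with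
  \<open>1 - t\<close> comparable to \<open>1 - r\<close>.\<close>

lemma series_mean_radial_derivative_le:
  assumes p: "1 \<le> p" and F: "homogeneous_series F" and r: "0 \<le> r" "r < 1" and s: "1 \<le> s"
    and H: "\<And>\<rho>. 0 \<le> \<rho> \<Longrightarrow> \<rho> < 1 \<Longrightarrow> series_mean p \<rho> F \<le> H"
  shows "series_mean p r (weighted (\<lambda>k. real k ^ s) F) \<le> ennreal ((8 * real s / (1 - r)) ^ s) * H"
proof -
  define t where "t = 1 - (1 - r) / (2 * real s)"
  have t: "0 < t" "t < 1" using r s by (auto simp: t_def field_simps)
  have ts: "r < t ^ s"
  proof -
    have "1 + real s * (- ((1 - r) / (2 * real s))) \<le> (1 + - ((1 - r) / (2 * real s))) ^ s"
      using t by (intro Bernoulli_inequality) (auto simp: t_def)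
    then have "1 - (1 - r) / 2 \<le> t ^ s" using s by (simp add: t_def)
    moreover have "r < 1 - (1 - r) / 2" using r by (simp add: field_simps)
    ultimately show ?thesis by (rule order.strict_trans2[rotated])
  qed
  define \<rho> where "\<rho> = r / t ^ s"
  have \<rho>: "0 \<le> \<rho>" "\<rho> < 1" "t ^ s * \<rho> = r" using r t ts by (auto simp: \<rho>_def)
  have iter: "series_mean p \<rho> (weighted (\<lambda>k. (real k * t ^ k) ^ j) F)
      \<le> ennreal ((4 / (1 - t)) ^ j) * series_mean p \<rho> F \<and>
      homogeneous_series (weighted (\<lambda>k. (real k * t ^ k) ^ j) F)" for j
  proof (induction j)
    case (Suc j)
    let ?G = "weighted (\<lambda>k. (real k * t ^ k) ^ j) F"
    have "series_mean p \<rho> (weighted (\<lambda>k. real k * t ^ k) ?G) \<le> ennreal (4 / (1 - t)) * series_mean p \<rho> ?G"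
      using Suc t \<rho> by (intro series_mean_index_power_weight p) auto
    also have "\<dots> \<le> ennreal (4 / (1 - t)) * (ennreal ((4 / (1 - t)) ^ j) * series_mean p \<rho> F)"
      using Suc by (intro mult_left_mono) auto
    also have "\<dots> = ennreal ((4 / (1 - t)) ^ Suc j) * series_mean p \<rho> F"
      using t by (simp add: ennreal_mult mult.assoc del: times_divide_eq_left)
    finally have 1: "series_mean p \<rho> (weighted (\<lambda>k. real k * t ^ k) ?G)
        \<le> ennreal ((4 / (1 - t)) ^ Suc j) * series_mean p \<rho> F" .
    have "homogeneous_series (weighted (\<lambda>k. t ^ k) (weighted real ?G))"
      using Suc t
      by (intro homogeneous_series_weighted_bounded[where B = 1 and l = "\<lambda>k. t ^ k"]
          homogeneous_series_weighted_index) (auto intro: power_le_one)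
    with 1 show ?case by (simp add: weighted_weighted mult_ac)
  qed (simp add: weighted_one F)
  have "series_mean p r (weighted (\<lambda>k. real k ^ s) F)
      = series_mean p \<rho> (weighted (\<lambda>k. (real k * t ^ k) ^ s) F)"
    using series_mean_dilate[OF homogeneous_series_weighted_power[OF F, of s], of p "t ^ s" \<rho>] \<rho>(3)
    by (simp add: weighted_weighted power_mult_distrib mult.commute flip: power_mult)
  also have "\<dots> \<le> ennreal ((4 / (1 - t)) ^ s) * series_mean p \<rho> F" using iter by blast
  also have "\<dots> \<le> ennreal ((4 / (1 - t)) ^ s) * H" using H \<rho> by (intro mult_left_mono) auto
  also have "4 / (1 - t) = 8 * real s / (1 - r)" using s r by (simp add: t_def field_simps)
  finally show ?thesis .
qed

text \<open>Division by \<open>k\<close> on the frequencies \<open>k \<ge> m\<close>: the weights \<open>1 / k\<close> are convex and decreasing there, and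
  extending them by the chord through \<open>m\<close> and \<open>m + 1\<close> preserves this.\<close>

lemma series_mean_inverse_bernstein_step:
  assumes p: "1 \<le> p" and F: "homogeneous_series F" and r: "0 \<le> r" "r < 1"
    and freq: "\<And>k z. k < m \<Longrightarrow> F k z = 0" and m: "1 \<le> m"
  shows "series_mean p r F \<le> ennreal (2 / real m) * series_mean p r (weighted real F)"
proof -
  define l where "l k = (if k \<le> m then (2 * real m + 1 - real k) / (real m * (real m + 1)) else 1 / real k)" for k
  have lin: "l k = (2 * real m + 1 - real k) / (real m * (real m + 1))" if "k \<le> Suc m" for k
    using that m by (cases "k = Suc m") (auto simp: l_def divide_simps)
  have inv: "l k = 1 / real k" if "m \<le> k" for k
    using that m by (cases "k = m") (auto simp: l_def divide_simps)
  have conv: "2 * l (Suc k) \<le> l k + l (Suc (Suc k))" for k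
  proof (cases "m \<le> k")
    case True
    then have k: "0 < real k" using m by simp
    have "1 / real k + 1 / (real k + 2) - 2 / (real k + 1) = 2 / (real k * (real k + 1) * (real k + 2))"
      using k by (simp add: divide_simps) (simp add: algebra_simps)
    also have "\<dots> \<ge> 0" using k by simp
    finally have "2 / (real k + 1) \<le> 1 / real k + 1 / (real k + 2)" by simp
    then show ?thesis using True by (simp add: inv add.commute)
  next
    case False
    then show ?thesis by (simp add: lin diff_divide_distrib add_divide_distrib)
  qed
  have nonneg: "0 \<le> l k" for k using m by (auto simp: l_def)
  have dec: "l (Suc k) \<le> l k" for k
  proof (cases "m \<le> k")
    case True
    then show ?thesis using m by (simp add: inv frac_le)
  next
    case False
    then show ?thesis using m by (simp add: lin divide_right_mono)
  qed
  have "weighted l (weighted real F) = F"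
  proof (intro ext)
    fix k z
    show "weighted l (weighted real F) k z = F k z"
      using freq[of k z] inv[of k] m by (cases "k < m") (auto simp: weighted_def)
  qed
  moreover have "series_mean p r (weighted l (weighted real F)) \<le> ennreal (l 0) * series_mean p r (weighted real F)"
    using conv nonneg dec by (intro series_mean_convex_decreasing_weight p r homogeneous_series_weighted_index F)
  moreover have "l 0 \<le> 2 / real m"
  proof -
    have "l 0 \<le> (2 * (real m + 1)) / (real m * (real m + 1))"
      using m by (auto simp: l_def intro!: divide_right_mono)
    also have "\<dots> = 2 / real m"
      by (rule nonzero_mult_divide_mult_cancel_right) simp
    finally show ?thesis .
  qed
  ultimately show ?thesis
    using order_trans[OF _ mult_right_mono[OF ennreal_leI]] by simp
qed

lemma series_mean_inverse_bernstein:
  assumes p: "1 \<le> p" and F: "homogeneous_series F" and r: "0 \<le> r" "r < 1"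
    and freq: "\<And>k z. k < m \<Longrightarrow> F k z = 0" and m: "1 \<le> m"
  shows "series_mean p r F \<le> ennreal ((2 / real m) ^ s) * series_mean p r (weighted (\<lambda>k. real k ^ s) F)"
proof (induction s)
  case (Suc s)
  let ?G = "weighted (\<lambda>k. real k ^ s) F"
  have "series_mean p r ?G \<le> ennreal (2 / real m) * series_mean p r (weighted real ?G)"
    using freq m by (intro series_mean_inverse_bernstein_step p r homogeneous_series_weighted_power F)
      (auto simp: weighted_def)
  then have "ennreal ((2 / real m) ^ s) * series_mean p r ?G
      \<le> ennreal ((2 / real m) ^ s) * (ennreal (2 / real m) * series_mean p r (weighted real ?G))"
    by (rule mult_left_mono) simp
  also have "\<dots> = ennreal ((2 / real m) ^ Suc s) * series_mean p r (weighted (\<lambda>k. real k ^ Suc s) F)"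
    using m by (simp add: weighted_weighted ennreal_mult[symmetric] mult.assoc[symmetric] mult.commute
        del: times_divide_eq_left times_divide_eq_right)
  finally show ?case using Suc.IH by (rule order_trans[rotated])
qed (simp add: weighted_one)

text \<open>A polynomial of degree \<open>n\<close> hardly grows between the radii \<open>(1 - 1/n) r\<close> and \<open>r\<close>: the weights
  \<open>t\<^sup>n\<^sup>-\<^sup>k\<close>, which undo the dilation by \<open>t\<close> up to the factor \<open>t\<^sup>n\<close>, are convex on \<open>{0..n}\<close>.\<close>

lemma series_mean_polynomial_radius:
  assumes p: "1 \<le> p" and F: "homogeneous_series F" and r: "0 \<le> r" "r < 1"
    and deg: "\<And>k z. 2 * j < k \<Longrightarrow> F k z = 0" and j: "1 \<le> j"
  shows "series_mean p r F \<le> 9 * series_mean p ((1 - 1 / (2 * real j)) * r) F"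
proof -
  define t where "t = 1 - 1 / (2 * real j)"
  have t: "0 < t" "t \<le> 1" using j by (auto simp: t_def field_simps)
  obtain n where n: "2 * j = Suc n" using j by (cases "2 * j") auto
  have n': "real (Suc n) * (1 - t) = 1"
    using j by (simp add: n[symmetric] t_def)
  \<comment> \<open>Bernoulli's inequality for \<open>t\<^sup>j\<close>, squared; this is why the degree is taken even\<close>
  have tn: "1 / 4 \<le> t ^ Suc n"
  proof -
    have "1 + real j * (- (1 / (2 * real j))) \<le> (1 + - (1 / (2 * real j))) ^ j"
      using j by (intro Bernoulli_inequality) (auto simp: field_simps)
    then have "1 / 2 \<le> t ^ j" using j by (simp add: t_def)
    then have "(1 / 2)\<^sup>2 \<le> (t ^ j)\<^sup>2" by (intro power_mono) auto
    then show ?thesis by (simp add: n[symmetric] power2_eq_square power_mult[symmetric] mult.commute power_add[symmetric] mult_2_right)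
  qed
  define G where "G = weighted (\<lambda>k. t ^ k) F"
  define l where "l k = t ^ (Suc n - k)" for k
  have G: "homogeneous_series G"
    unfolding G_def using t by (intro homogeneous_series_weighted_bounded[OF F, of _ 1]) (auto intro: power_le_one)
  have "weighted l G = weighted (\<lambda>k. t ^ Suc n) F"
  proof (intro ext)
    fix k z
    show "weighted l G k z = weighted (\<lambda>k. t ^ Suc n) F k z"
    proof (cases "k \<le> Suc n")
      case True
      then have "t ^ (Suc n - k) * t ^ k = t ^ Suc n" by (simp flip: power_add)
      then show ?thesis unfolding weighted_def l_def G_def by (metis mult.assoc of_real_mult)
    next
      case False
      then show ?thesis using deg[of k z] n by (simp add: weighted_def G_def)
    qed
  qed
  moreover have "series_mean p r (weighted l G)
      \<le> ennreal (l 0 + 2 * real (Suc n) * max 0 (l (Suc n) - l n)) * series_mean p r G"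
  proof (intro series_mean_convex_weight_polynomial p G r)
    show "G k z = 0" if "Suc n < k" for k z using deg[of k z] that n by (simp add: G_def weighted_def)
    show "2 * l (Suc m) \<le> l m + l (Suc (Suc m))" if "m < n" for m
      using power_weight_convex[of t "n - Suc m"] t that
      by (simp add: l_def Suc_diff_Suc Suc_diff_le add.commute)
  qed (use t in \<open>simp add: l_def\<close>)
  moreover have "l 0 + 2 * real (Suc n) * max 0 (l (Suc n) - l n) = t ^ Suc n + 2"
    using t n' by (simp add: l_def max_def algebra_simps)
  moreover have "series_mean p r G = series_mean p (t * r) F"
    by (simp add: G_def series_mean_dilate[OF F])
  ultimately have 1: "series_mean p r (weighted (\<lambda>k. t ^ Suc n) F) \<le> ennreal (t ^ Suc n + 2) * series_mean p (t * r) F"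
    by simp
  have F_eq: "F = weighted (\<lambda>k. \<Sum>i\<in>{()}. 1 / t ^ Suc n * t ^ Suc n) F"
    using t by (simp add: weighted_one)
  have "series_mean p r (weighted (\<lambda>k. \<Sum>i\<in>{()}. 1 / t ^ Suc n * t ^ Suc n) F)
      \<le> ennreal (\<Sum>i\<in>{()}. \<bar>1 / t ^ Suc n\<bar> * (t ^ Suc n + 2)) * series_mean p (t * r) F"
    using 1 t by (intro series_mean_weight_combination[OF p F r, where B = "\<lambda>_. t ^ Suc n"]) auto
  also have "(\<Sum>i\<in>{()}. \<bar>1 / t ^ Suc n\<bar> * (t ^ Suc n + 2)) = 1 + 2 / t ^ Suc n"
    using t by (simp add: abs_of_pos field_simps)
  also have "ennreal (1 + 2 / t ^ Suc n) * series_mean p (t * r) F \<le> 9 * series_mean p (t * r) F"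
  proof (rule mult_right_mono)
    have "2 / t ^ Suc n \<le> 2 / (1 / 4)" using tn by (intro divide_left_mono) auto
    then have "ennreal (1 + 2 / t ^ Suc n) \<le> ennreal 9" by (intro ennreal_leI) simp
    then show "ennreal (1 + 2 / t ^ Suc n) \<le> 9" by simp
  qed simp
  finally have "series_mean p r F \<le> 9 * series_mean p (t * r) F"
    unfolding F_eq[symmetric] .
  then show ?thesis by (simp only: t_def)
qed

section \<open>De la Vallee Poussin means and best approximation\<close>

text \<open>The weights are \<open>1\<close> up to \<open>n\<close>, decrease linearly, and vanish from \<open>2 n\<close> on; the subtractions inside \<open>real\<close> are truncated at \<open>0\<close>.\<close>

definition vallee_poussin :: "nat \<Rightarrow> nat \<Rightarrow> real" where
  "vallee_poussin n k = (real (2 * n - k) - real (n - k)) / real n"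

lemma vallee_poussin_bounds: "0 \<le> vallee_poussin n k" "vallee_poussin n k \<le> 1"
  by (auto simp: vallee_poussin_def divide_simps)

lemma vallee_poussin_low: "1 \<le> n \<Longrightarrow> k \<le> n \<Longrightarrow> vallee_poussin n k = 1"
  by (simp add: vallee_poussin_def field_simps)

lemma vallee_poussin_high: "2 * n \<le> k \<Longrightarrow> vallee_poussin n k = 0"
  by (simp add: vallee_poussin_def)

lemma series_mean_sum:
  assumes p: "1 \<le> p" and r: "0 \<le> r" "r < 1" and I: "finite I"
    and F: "\<And>i. i \<in> I \<Longrightarrow> homogeneous_series (F i)"
  shows "series_mean p r (\<lambda>k z. \<Sum>i\<in>I. F i k z) \<le> (\<Sum>i\<in>I. series_mean p r (F i))"
proof -
  have "series_mean p r (\<lambda>k z. \<Sum>i\<in>I. F i k z) = integral_mean p r (\<lambda>z. \<Sum>i\<in>I. \<Sum>k. F i k z)"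
    unfolding series_mean_def
    using F by (intro integral_mean_cong r suminf_sum) (auto simp: homogeneous_series_def)
  also have "\<dots> \<le> (\<Sum>i\<in>I. series_mean p r (F i))"
    unfolding series_mean_def by (intro integral_mean_sum p r I ball_measurable_series F)
  finally show ?thesis .
qed

lemma series_mean_vallee_poussin:
  assumes p: "1 \<le> p" and F: "homogeneous_series F" and r: "0 \<le> r" "r < 1" and n: "1 \<le> n"
  shows "series_mean p r (weighted (vallee_poussin n) F) \<le> 3 * series_mean p r F"
    and "series_mean p r (weighted (\<lambda>k. 1 - vallee_poussin n k) F) \<le> 4 * series_mean p r F"
proof -
  define m where "m i k = (if i = 0 then real (2 * n - k) else if i = 1 then real (n - k) else 1)" for i k :: nat
  define b where "b i = (if i = 0 then real (2 * n) else if i = 1 then real n else 1)" for i :: nat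
  have mb: "\<bar>m i k\<bar> \<le> b i" for i k by (auto simp: m_def b_def)
  have b0: "0 \<le> b i" for i by (simp add: b_def)
  have bound: "series_mean p r (weighted (m i) F) \<le> ennreal (b i) * series_mean p r F" for i
  proof -
    consider "i = 0" | "i = 1" | "i \<noteq> 0" "i \<noteq> 1" by blast
    then show ?thesis
    proof cases
      case 1
      then have "m i = (\<lambda>k. real (2 * n - k))" by (auto simp: m_def)
      moreover have "b i = real (2 * n)" using 1 by (simp add: b_def)
      ultimately show ?thesis using series_mean_fejer[OF p F r, of "2 * n"] by simp
    next
      case 2
      then have "m i = (\<lambda>k. real (n - k))" by (auto simp: m_def)
      then show ?thesis using 2 series_mean_fejer[OF p F r, of n] by (simp add: b_def)
    next
      case 3
      then have "m i = (\<lambda>k. 1)" by (auto simp: m_def)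
      then show ?thesis using 3 by (simp add: b_def weighted_one)
    qed
  qed
  have comb: "series_mean p r (weighted (\<lambda>k. \<Sum>i\<in>{0, 1, 2}. c i * m i k) F)
      \<le> ennreal (\<Sum>i\<in>{0, 1, 2}. \<bar>c i\<bar> * b i) * series_mean p r F" for c :: "nat \<Rightarrow> real"
    by (rule series_mean_weight_combination[OF p F r _ mb b0 bound]) simp
  show "series_mean p r (weighted (vallee_poussin n) F) \<le> 3 * series_mean p r F"
    using comb[of "\<lambda>i. if i = 0 then 1 / real n else if i = 1 then - 1 / real n else 0"] n
    by (simp add: m_def b_def vallee_poussin_def[abs_def] diff_divide_distrib)
  show "series_mean p r (weighted (\<lambda>k. 1 - vallee_poussin n k) F) \<le> 4 * series_mean p r F"
    using comb[of "\<lambda>i. if i = 0 then - 1 / real n else if i = 1 then 1 / real n else 1"] n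
    by (simp add: m_def b_def vallee_poussin_def[abs_def] diff_divide_distrib algebra_simps)
qed

definition series_hardy_norm :: "ennreal \<Rightarrow> (nat \<Rightarrow> complex ^ 'n \<Rightarrow> complex) \<Rightarrow> ennreal" where
  "series_hardy_norm p F = (SUP r\<in>{0<..<1}. series_mean p r F)"

lemma series_mean_le_hardy:
  assumes "1 \<le> p" "homogeneous_series F" "0 \<le> r" "r < 1"
  shows "series_mean p r F \<le> series_hardy_norm p F"
proof -
  have "series_mean p r F \<le> series_mean p ((1 + r) / 2) F"
    using assms by (intro series_mean_mono) auto
  also have "\<dots> \<le> series_hardy_norm p F"
    unfolding series_hardy_norm_def using assms by (intro SUP_upper) auto
  finally show ?thesis .
qed

lemma series_hardy_norm_le:
  "(\<And>r. 0 < r \<Longrightarrow> r < 1 \<Longrightarrow> series_mean p r F \<le> B) \<Longrightarrow> series_hardy_norm p F \<le> B"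
  unfolding series_hardy_norm_def by (intro SUP_least) auto

lemma hardy_norm_eq_series:
  assumes "\<And>z. z \<in> unit_ball \<Longrightarrow> f z = (\<Sum>k. F k z)"
  shows "hardy_norm p f = series_hardy_norm p F"
  unfolding hardy_norm_def series_hardy_norm_def series_mean_def
  using assms by (intro SUP_cong refl integral_mean_cong) auto

lemma series_mean_add:
  assumes "1 \<le> p" "0 \<le> r" "r < 1" "homogeneous_series F" "homogeneous_series G"
  shows "series_mean p r (\<lambda>k z. F k z + G k z) \<le> series_mean p r F + series_mean p r G"
  using series_mean_sum[of p r "UNIV :: bool set" "\<lambda>b. if b then F else G"] assms
  by (simp add: UNIV_bool add.commute)

text \<open>Subtracting a polynomial of degree \<open>m\<close> changes the homogeneous parts up to \<open>m\<close> only.\<close>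

lemma best_approx_series:
  fixes f :: "complex ^ 'n \<Rightarrow> complex"
  assumes p: "1 \<le> p" and F: "homogeneous_series F"
    and f: "\<And>z. z \<in> unit_ball \<Longrightarrow> f z = (\<Sum>k. F k z)"
    and P: "P \<in> polynomials_le m"
  obtains Q where "homogeneous_series Q" "\<And>k z. m < k \<Longrightarrow> Q k z = F k z"
    "hardy_norm p (\<lambda>z. f z - P z) = series_hardy_norm p Q"
proof -
  obtain G where G: "\<And>k. G k \<in> homogeneous_polynomials k" and PG: "P = (\<lambda>z. \<Sum>k\<le>m. G k z)"
    using P by (auto simp: polynomials_le_iff_sum_homogeneous)
  define Q where "Q k z = F k z + (- (if k \<le> m then 1 else 0)) * G k z" for k z
  have Fs: "summable (\<lambda>k. F k z)" if "z \<in> unit_ball" for z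
    using F that by (auto simp: homogeneous_series_def)
  have Gs: "(\<lambda>k. (- (if k \<le> m then 1 else 0)) * G k z) sums - P z" for z
  proof -
    have "(\<lambda>k. (- (if k \<le> m then 1 else 0)) * G k z) sums (\<Sum>k\<le>m. (- (if k \<le> m then 1 else 0)) * G k z)"
      by (rule sums_finite) auto
    then show ?thesis by (simp add: PG sum_negf)
  qed
  have sums: "(\<lambda>k. Q k z) sums (f z - P z)" if "z \<in> unit_ball" for z
    using sums_add[OF summable_sums[OF Fs[OF that]] Gs[of z]] f[OF that] by (simp add: Q_def)
  show ?thesis
  proof
    show "homogeneous_series Q"
      unfolding homogeneous_series_def
    proof (intro conjI ballI allI)
      show "Q k \<in> homogeneous_polynomials k" for k
        unfolding Q_def using F G
        by (intro add_in_homogeneous cmult_in_homogeneous) (auto simp: homogeneous_series_def)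
    qed (use sums in \<open>auto intro: sums_summable\<close>)
    show "Q k z = F k z" if "m < k" for k z using that by (simp add: Q_def)
    show "hardy_norm p (\<lambda>z. f z - P z) = series_hardy_norm p Q"
      using sums by (intro hardy_norm_eq_series) (auto intro: sums_unique)
  qed
qed

text \<open>The de la Vallee Poussin means reproduce polynomials of degree \<open>n\<close>, so the error does not change when
  such a polynomial is subtracted from \<open>f\<close>: up to a factor they are best approximations.\<close>

lemma vallee_poussin_error_le_best_approx:
  fixes f :: "complex ^ 'n \<Rightarrow> complex"
  assumes p: "1 \<le> p" and F: "homogeneous_series F" and r: "0 \<le> r" "r < 1" and n: "1 \<le> n"
    and f: "\<And>z. z \<in> unit_ball \<Longrightarrow> f z = (\<Sum>k. F k z)"
  shows "series_mean p r (weighted (\<lambda>k. 1 - vallee_poussin n k) F) \<le> 4 * best_approx n p f"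
proof -
  have "series_mean p r (weighted (\<lambda>k. 1 - vallee_poussin n k) F) / 4 \<le> best_approx n p f"
    unfolding best_approx_def
  proof (rule INF_greatest)
    fix P :: "complex ^ 'n \<Rightarrow> complex" assume P: "P \<in> polynomials_le n"
    obtain Q where Q: "homogeneous_series Q" "\<And>k z. n < k \<Longrightarrow> Q k z = F k z"
      and H: "hardy_norm p (\<lambda>z. f z - P z) = series_hardy_norm p Q"
      using best_approx_series[OF p F f P] by blast
    have eq: "weighted (\<lambda>k. 1 - vallee_poussin n k) F = weighted (\<lambda>k. 1 - vallee_poussin n k) Q"
    proof (intro ext)
      fix k z
      show "weighted (\<lambda>k. 1 - vallee_poussin n k) F k z = weighted (\<lambda>k. 1 - vallee_poussin n k) Q k z"
        using Q(2)[of k z] vallee_poussin_low[OF n, of k] by (cases "k \<le> n") (auto simp: weighted_def)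
    qed
    have "series_mean p r (weighted (\<lambda>k. 1 - vallee_poussin n k) F) \<le> 4 * series_mean p r Q"
      unfolding eq by (rule series_mean_vallee_poussin(2)[OF p Q(1) r n])
    also have "\<dots> \<le> 4 * hardy_norm p (\<lambda>z. f z - P z)"
      unfolding H by (intro mult_left_mono series_mean_le_hardy p Q r) auto
    finally show "series_mean p r (weighted (\<lambda>k. 1 - vallee_poussin n k) F) / 4 \<le> hardy_norm p (\<lambda>z. f z - P z)"
      by (simp add: divide_le_posI_ennreal mult.commute)
  qed
  then have "4 * (series_mean p r (weighted (\<lambda>k. 1 - vallee_poussin n k) F) / 4) \<le> 4 * best_approx n p f"
    by (intro mult_left_mono) auto
  moreover have "4 * (x / 4) = x" for x :: ennreal
    unfolding ennreal_times_divide mult.commute[of 4] by (rule mult_divide_eq_ennreal) auto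
  ultimately show ?thesis by simp
qed

lemma best_approx_le_vallee_poussin_error:
  fixes f :: "complex ^ 'n \<Rightarrow> complex"
  assumes F: "homogeneous_series F" and f: "\<And>z. z \<in> unit_ball \<Longrightarrow> f z = (\<Sum>k. F k z)"
  shows "best_approx (2 * n) p f \<le> series_hardy_norm p (weighted (\<lambda>k. 1 - vallee_poussin n k) F)"
proof -
  define P where "P z = (\<Sum>k\<le>2 * n. weighted (vallee_poussin n) F k z)" for z
  have V: "homogeneous_series (weighted (vallee_poussin n) F)"
    using vallee_poussin_bounds[of n] by (intro homogeneous_series_weighted_bounded[OF F, of _ 1]) auto
  then have "P \<in> polynomials_le (2 * n)"
    unfolding polynomials_le_iff_sum_homogeneous P_def
    by (intro exI[of _ "weighted (vallee_poussin n) F"]) (auto simp: homogeneous_series_def)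
  then have "best_approx (2 * n) p f \<le> hardy_norm p (\<lambda>z. f z - P z)"
    unfolding best_approx_def by (rule INF_lower)
  also have "\<dots> = series_hardy_norm p (weighted (\<lambda>k. 1 - vallee_poussin n k) F)"
  proof (rule hardy_norm_eq_series)
    fix z :: "complex ^ 'n" assume z: "z \<in> unit_ball"
    have "(\<lambda>k. weighted (vallee_poussin n) F k z) sums P z"
      unfolding P_def by (rule sums_finite) (auto simp: weighted_def vallee_poussin_high)
    moreover have "(\<lambda>k. F k z) sums f z"
      using F z f by (auto simp: homogeneous_series_def intro: summable_sums)
    ultimately have "(\<lambda>k. F k z - weighted (vallee_poussin n) F k z) sums (f z - P z)"
      by (rule sums_diff[rotated])
    then show "f z - P z = (\<Sum>k. weighted (\<lambda>k. 1 - vallee_poussin n k) F k z)"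
      by (simp add: weighted_def algebra_simps sums_iff)
  qed
  finally show ?thesis .
qed

lemma best_approx_antimono: "m \<le> n \<Longrightarrow> best_approx n p f \<le> best_approx m p f"
  unfolding best_approx_def by (intro INF_superset_mono) (auto intro: polynomials_le_mono)

lemma best_approx_le_hardy_norm: "best_approx m p f \<le> hardy_norm p f"
proof -
  have "(\<lambda>z. 0) \<in> polynomials_le m"
    unfolding polynomials_le_iff_sum_homogeneous
    by (intro exI[of _ "\<lambda>k z. 0"]) (auto intro: zero_in_homogeneous)
  then have "best_approx m p f \<le> hardy_norm p (\<lambda>z. f z - 0)"
    unfolding best_approx_def by (rule INF_lower)
  then show ?thesis by simp
qed

section \<open>Radial derivative and best approximation\<close>

text \<open>Differences of consecutive dyadic de la Vallee Poussin means; block \<open>\<nu> \<ge> 1\<close> lives on the frequencies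
  strictly between \<open>2\<^sup>\<nu>\<^sup>-\<^sup>1\<close> and \<open>2\<^sup>\<nu>\<^sup>+\<^sup>1\<close>.\<close>

definition dyadic_block :: "nat \<Rightarrow> nat \<Rightarrow> real" where
  "dyadic_block \<nu> k = vallee_poussin (2 ^ \<nu>) k - (if \<nu> = 0 then 0 else vallee_poussin (2 ^ (\<nu> - 1)) k)"

lemma sum_dyadic_block: "(\<Sum>\<nu>\<le>n. dyadic_block \<nu> k) = vallee_poussin (2 ^ n) k"
  by (induction n) (auto simp: dyadic_block_def)

lemma dyadic_block_abs_le: "\<bar>dyadic_block \<nu> k\<bar> \<le> 1"
  using vallee_poussin_bounds[of "2 ^ \<nu>" k] vallee_poussin_bounds[of "2 ^ (\<nu> - 1)" k]
  by (auto simp: dyadic_block_def)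

lemma dyadic_block_high: "2 ^ (\<nu> + 1) \<le> k \<Longrightarrow> dyadic_block \<nu> k = 0"
  by (cases \<nu>) (auto simp: dyadic_block_def vallee_poussin_high)

lemma dyadic_block_low: "k \<le> 2 ^ j \<Longrightarrow> dyadic_block (Suc j) k = 0"
  by (simp add: dyadic_block_def vallee_poussin_low)

lemma homogeneous_series_dyadic_block: "homogeneous_series F \<Longrightarrow> homogeneous_series (weighted (dyadic_block \<nu>) F)"
  by (rule homogeneous_series_weighted_bounded[OF _ dyadic_block_abs_le])

text \<open>The sequence \<open>\<parallel>f\<parallel>, E\<^sub>1, E\<^sub>2, E\<^sub>4, \<dots>\<close>: the shift gives every dyadic block a bound by the entry with its
  own index, also the lowest block, which contains the constants.\<close>

definition approx_level :: "ennreal \<Rightarrow> (complex ^ 'n \<Rightarrow> complex) \<Rightarrow> nat \<Rightarrow> ennreal" where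
  "approx_level p f \<nu> = (if \<nu> = 0 then hardy_norm p f else best_approx (2 ^ (\<nu> - 1)) p f)"

lemma series_mean_block_le_approx_level:
  fixes f :: "complex ^ 'n \<Rightarrow> complex"
  assumes p: "1 \<le> p" and F: "homogeneous_series F" and r: "0 \<le> r" "r < 1"
    and f: "\<And>z. z \<in> unit_ball \<Longrightarrow> f z = (\<Sum>k. F k z)"
  shows "series_mean p r (weighted (dyadic_block \<nu>) F) \<le> 8 * approx_level p f \<nu>"
proof (cases \<nu>)
  case 0
  have hardy: "hardy_norm p f = series_hardy_norm p F"
    using f by (rule hardy_norm_eq_series)
  have "series_mean p r (weighted (vallee_poussin 1) F) \<le> 3 * series_mean p r F"
    by (rule series_mean_vallee_poussin(1)[OF p F r]) simp
  also have "\<dots> \<le> 8 * hardy_norm p f"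
    unfolding hardy by (intro mult_mono series_mean_le_hardy p F r) auto
  finally show ?thesis using 0 by (simp add: dyadic_block_def[abs_def] approx_level_def)
next
  case (Suc j)
  let ?E = "\<lambda>n. weighted (\<lambda>k. 1 - vallee_poussin n k) F"
  have hE: "homogeneous_series (?E n)" for n
    using vallee_poussin_bounds[of n] by (intro homogeneous_series_weighted_bounded[OF F, of _ 1]) auto
  have le: "series_mean p r (?E (2 ^ i)) \<le> 4 * best_approx (2 ^ j) p f" if "j \<le> i" for i
  proof -
    have "series_mean p r (?E (2 ^ i)) \<le> 4 * best_approx (2 ^ i) p f"
      by (rule vallee_poussin_error_le_best_approx[OF p F r _ f]) auto
    also have "\<dots> \<le> 4 * best_approx (2 ^ j) p f"
      using that by (intro mult_left_mono best_approx_antimono power_increasing) auto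
    finally show ?thesis .
  qed
  have "(\<Sum>k. weighted (dyadic_block \<nu>) F k z) = (\<Sum>k. ?E (2 ^ j) k z) + (-1) * (\<Sum>k. ?E (2 ^ \<nu>) k z)"
    if z: "z \<in> unit_ball" for z
  proof -
    have "summable (\<lambda>k. ?E n k z)" for n using hE z by (auto simp: homogeneous_series_def)
    then have "(\<Sum>k. ?E (2 ^ j) k z) + (-1) * (\<Sum>k. ?E (2 ^ \<nu>) k z) = (\<Sum>k. ?E (2 ^ j) k z - ?E (2 ^ \<nu>) k z)"
      by (simp add: suminf_diff)
    then show ?thesis by (simp add: Suc weighted_def dyadic_block_def algebra_simps)
  qed
  then have "series_mean p r (weighted (dyadic_block \<nu>) F)
      = integral_mean p r (\<lambda>z. (\<Sum>k. ?E (2 ^ j) k z) + (-1) * (\<Sum>k. ?E (2 ^ \<nu>) k z))"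
    unfolding series_mean_def by (intro integral_mean_cong r)
  also have "\<dots> \<le> integral_mean p r (\<lambda>z. \<Sum>k. ?E (2 ^ j) k z)
      + integral_mean p r (\<lambda>z. (-1) * (\<Sum>k. ?E (2 ^ \<nu>) k z))"
    by (intro integral_mean_add p r ball_measurable_cmult ball_measurable_series hE)
  also have "\<dots> = series_mean p r (?E (2 ^ j)) + series_mean p r (?E (2 ^ \<nu>))"
    by (subst integral_mean_cmult[OF p ball_measurable_series[OF hE] r]) (simp add: series_mean_def)
  also have "\<dots> \<le> 4 * best_approx (2 ^ j) p f + 4 * best_approx (2 ^ j) p f"
    using Suc by (intro add_mono le) auto
  also have "\<dots> = 8 * approx_level p f \<nu>"
    by (simp add: Suc approx_level_def flip: distrib_right)
  finally show ?thesis .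
qed

text \<open>Blocks of low frequency are differentiated with Bernstein's inequality; all frequencies above \<open>2\<^sup>n\<close>
  together, with \<open>2\<^sup>-\<^sup>n\<close> comparable to \<open>1 - r\<close>, with the smoothing of the dilation.\<close>

lemma radial_derivative_le_best_approx:
  fixes f :: "complex ^ 'n \<Rightarrow> complex"
  assumes p: "1 \<le> p" and F: "homogeneous_series F" and r: "0 \<le> r" "r < 1" and s: "1 \<le> s"
    and f: "\<And>z. z \<in> unit_ball \<Longrightarrow> f z = (\<Sum>k. F k z)" and n: "1 / 2 ^ Suc n \<le> 1 - r"
  shows "series_mean p r (weighted (\<lambda>k. real k ^ s) F)
    \<le> ennreal (8 * 4 ^ s + 4 * (16 * real s) ^ s) * (\<Sum>\<nu>\<le>n. ennreal (2 ^ (\<nu> * s)) * approx_level p f \<nu>)"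
proof -
  let ?D = "\<lambda>\<nu>. weighted (dyadic_block \<nu>) F"
  let ?E = "weighted (\<lambda>k. 1 - vallee_poussin (2 ^ n) k) F"
  let ?R = "weighted (\<lambda>k. real k ^ s)"
  let ?S = "\<Sum>\<nu>\<le>n. ennreal (2 ^ (\<nu> * s)) * approx_level p f \<nu>"
  have hD: "homogeneous_series (?D \<nu>)" for \<nu>
    by (rule homogeneous_series_dyadic_block[OF F])
  have hE: "homogeneous_series ?E"
    using vallee_poussin_bounds[of "2 ^ n"] by (intro homogeneous_series_weighted_bounded[OF F, of _ 1]) auto
  have hsum: "homogeneous_series (\<lambda>k z. \<Sum>\<nu>\<le>n. ?R (?D \<nu>) k z)"
    using homogeneous_series_weighted_power[OF hD, of s]
    by (auto simp: homogeneous_series_def intro!: sum_in_homogeneous summable_sum)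
  have split: "?R F = (\<lambda>k z. (\<Sum>\<nu>\<le>n. ?R (?D \<nu>) k z) + ?R ?E k z)"
  proof (intro ext)
    fix k z
    have "(\<Sum>\<nu>\<le>n. ?R (?D \<nu>) k z) = of_real (real k ^ s) * (of_real (\<Sum>\<nu>\<le>n. dyadic_block \<nu> k) * F k z)"
      by (simp add: weighted_def sum_distrib_left sum_distrib_right)
    then show "?R F k z = (\<Sum>\<nu>\<le>n. ?R (?D \<nu>) k z) + ?R ?E k z"
      by (simp add: sum_dyadic_block weighted_def algebra_simps)
  qed
  have low: "series_mean p r (?R (?D \<nu>)) \<le> ennreal (8 * 4 ^ s) * (ennreal (2 ^ (\<nu> * s)) * approx_level p f \<nu>)" for \<nu>
  proof -
    have "series_mean p r (?R (?D \<nu>)) \<le> ennreal ((2 * real (2 ^ (\<nu> + 1))) ^ s) * series_mean p r (?D \<nu>)"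
    proof (rule series_mean_bernstein[OF p hD r])
      show "?D \<nu> k z = 0" if "2 ^ (\<nu> + 1) < k" for k z
        using dyadic_block_high[of \<nu> k] that by (simp add: weighted_def)
    qed simp
    also have "(2 * real (2 ^ (\<nu> + 1))) ^ s = 4 ^ s * 2 ^ (\<nu> * s)"
    proof -
      have "2 * real (2 ^ (\<nu> + 1)) = 4 * 2 ^ \<nu>" by simp
      then show ?thesis by (simp only: power_mult_distrib power_mult)
    qed
    also have "ennreal (4 ^ s * 2 ^ (\<nu> * s)) * series_mean p r (?D \<nu>)
        \<le> ennreal (4 ^ s * 2 ^ (\<nu> * s)) * (8 * approx_level p f \<nu>)"
      by (intro mult_left_mono series_mean_block_le_approx_level[OF p F r f]) auto
    also have "\<dots> = ennreal (8 * 4 ^ s) * (ennreal (2 ^ (\<nu> * s)) * approx_level p f \<nu>)"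
      by (simp add: ennreal_mult mult_ac)
    finally show ?thesis .
  qed
  have "series_mean p \<rho> ?E \<le> 4 * approx_level p f n" if \<rho>: "0 \<le> \<rho>" "\<rho> < 1" for \<rho>
  proof -
    have "series_mean p \<rho> ?E \<le> 4 * best_approx (2 ^ n) p f"
      by (rule vallee_poussin_error_le_best_approx[OF p F \<rho> _ f]) auto
    also have "best_approx (2 ^ n) p f \<le> approx_level p f n"
      by (cases n) (auto simp: approx_level_def best_approx_le_hardy_norm intro!: best_approx_antimono)
    finally show ?thesis by (simp add: mult_left_mono)
  qed
  then have "series_mean p r (?R ?E) \<le> ennreal ((8 * real s / (1 - r)) ^ s) * (4 * approx_level p f n)"
    by (intro series_mean_radial_derivative_le p hE r s)
  also have "\<dots> \<le> ennreal ((16 * real s) ^ s * 2 ^ (n * s)) * (4 * approx_level p f n)"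
  proof (intro mult_right_mono ennreal_leI)
    have "8 * real s / (1 - r) \<le> 8 * real s / (1 / 2 ^ Suc n)"
      using n r by (intro divide_left_mono) auto
    then have "(8 * real s / (1 - r)) ^ s \<le> (16 * real s * 2 ^ n) ^ s"
      using r by (intro power_mono) auto
    then show "(8 * real s / (1 - r)) ^ s \<le> (16 * real s) ^ s * 2 ^ (n * s)"
      by (simp add: power_mult_distrib power_mult)
  qed auto
  also have "\<dots> = ennreal (4 * (16 * real s) ^ s) * (ennreal (2 ^ (n * s)) * approx_level p f n)"
    by (simp add: ennreal_mult mult_ac)
  also have "\<dots> \<le> ennreal (4 * (16 * real s) ^ s) * ?S"
    by (intro mult_left_mono member_le_sum) auto
  finally have high: "series_mean p r (?R ?E) \<le> ennreal (4 * (16 * real s) ^ s) * ?S" .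
  have "series_mean p r (?R F) \<le> series_mean p r (\<lambda>k z. \<Sum>\<nu>\<le>n. ?R (?D \<nu>) k z) + series_mean p r (?R ?E)"
    unfolding split by (intro series_mean_add p r hsum homogeneous_series_weighted_power hE)
  also have "\<dots> \<le> (\<Sum>\<nu>\<le>n. series_mean p r (?R (?D \<nu>))) + series_mean p r (?R ?E)"
    by (intro add_right_mono series_mean_sum p r homogeneous_series_weighted_power hD) auto
  also have "\<dots> \<le> (\<Sum>\<nu>\<le>n. ennreal (8 * 4 ^ s) * (ennreal (2 ^ (\<nu> * s)) * approx_level p f \<nu>))
      + ennreal (4 * (16 * real s) ^ s) * ?S"
    by (intro add_mono sum_mono low high)
  also have "\<dots> = ennreal (8 * 4 ^ s + 4 * (16 * real s) ^ s) * ?S"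
    by (subst ennreal_plus) (auto simp: sum_distrib_left distrib_right sum.distrib)
  finally show ?thesis .
qed

text \<open>A block of frequencies about \<open>2\<^sup>j\<close> is recovered from its derivative by the inverse Bernstein
  inequality, at a radius whose distance from \<open>1\<close> is the reciprocal of the degree.\<close>

lemma hardy_norm_block_le_radial_derivative:
  fixes F :: "nat \<Rightarrow> complex ^ 'n \<Rightarrow> complex"
  assumes p: "1 \<le> p" and F: "homogeneous_series F"
  shows "series_hardy_norm p (weighted (dyadic_block (Suc j)) F)
    \<le> ennreal (54 * 2 ^ s / 2 ^ (j * s)) * series_mean p (1 - 1 / 2 ^ (j + 2)) (weighted (\<lambda>k. real k ^ s) F)"
proof (rule series_hardy_norm_le)
  fix r :: real assume r: "0 < r" "r < 1"
  let ?D = "weighted (dyadic_block (Suc j)) F"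
  let ?R = "weighted (\<lambda>k. real k ^ s)"
  define t :: real where "t = 1 - 1 / 2 ^ (j + 2)"
  have "(1 :: real) \<le> 2 ^ (j + 2)" by (rule one_le_power) simp
  then have t: "0 \<le> t" "t < 1" by (auto simp: t_def field_simps)
  have "t * r \<le> t" using t r by (intro mult_left_le) auto
  then have tr: "0 \<le> t * r" "t * r < 1" "t * r \<le> t" using t r by auto
  have hD: "homogeneous_series ?D"
    by (rule homogeneous_series_dyadic_block[OF F])
  have hR: "homogeneous_series (?R F)"
    by (rule homogeneous_series_weighted_power[OF F])
  have "series_mean p r ?D \<le> 9 * series_mean p ((1 - 1 / (2 * real (2 ^ (j + 1)))) * r) ?D"
  proof (rule series_mean_polynomial_radius[OF p hD])
    show "?D k z = 0" if "2 * 2 ^ (j + 1) < k" for k z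
      using dyadic_block_high[of "Suc j" k] that by (simp add: weighted_def)
  qed (use r in auto)
  also have "(1 - 1 / (2 * real (2 ^ (j + 1)))) = t"
    by (simp add: t_def)
  also have "series_mean p (t * r) ?D \<le> ennreal ((2 / real (2 ^ j)) ^ s) * series_mean p (t * r) (?R ?D)"
  proof (rule series_mean_inverse_bernstein[OF p hD tr(1,2)])
    show "?D k z = 0" if "k < 2 ^ j" for k z
      using dyadic_block_low[of k j] that by (simp add: weighted_def)
  qed simp
  \<comment> \<open>a block is a difference of two de la Vallee Poussin means, each with bound \<open>3\<close>\<close>
  also have "series_mean p (t * r) (?R ?D) \<le> 6 * series_mean p (t * r) (?R F)"
  proof -
    have "series_mean p (t * r) (weighted (\<lambda>k. \<Sum>b\<in>UNIV. (if b then 1 else -1)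
          * vallee_poussin (if b then 2 ^ Suc j else 2 ^ j) k) (?R F))
        \<le> ennreal (\<Sum>b\<in>UNIV. \<bar>if b then 1 else - 1\<bar> * 3) * series_mean p (t * r) (?R F)"
      using series_mean_vallee_poussin(1)[OF p hR tr(1,2)] vallee_poussin_bounds
      by (intro series_mean_weight_combination[OF p hR tr(1,2), where B = "\<lambda>_. 1"]) auto
    then show ?thesis
      by (simp add: UNIV_bool weighted_weighted dyadic_block_def[abs_def] mult.commute)
  qed
  also have "series_mean p (t * r) (?R F) \<le> series_mean p t (?R F)"
    by (intro series_mean_mono p hR tr t)
  finally have "series_mean p r ?D \<le> 9 * (ennreal ((2 / real (2 ^ j)) ^ s) * (6 * series_mean p t (?R F)))"
    by (simp add: mult_left_mono)
  also have "\<dots> = ennreal (9 * (2 / real (2 ^ j)) ^ s * 6) * series_mean p t (?R F)"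
    by (simp add: ennreal_mult mult_ac)
  also have "9 * (2 / real (2 ^ j)) ^ s * 6 = 54 * 2 ^ s / 2 ^ (j * s)"
    by (simp add: power_divide power_mult)
  finally show "series_mean p r ?D \<le> ennreal (54 * 2 ^ s / 2 ^ (j * s)) * series_mean p (1 - 1 / 2 ^ (j + 2)) (?R F)"
    by (simp only: t_def)
qed

text \<open>The error of the de la Vallee Poussin mean of order \<open>2\<^sup>\<nu>\<close> is the sum of all later blocks.\<close>

lemma best_approx_le_radial_derivative:
  fixes f :: "complex ^ 'n \<Rightarrow> complex"
  assumes p: "1 \<le> p" and F: "homogeneous_series F"
    and f: "\<And>z. z \<in> unit_ball \<Longrightarrow> f z = (\<Sum>k. F k z)"
  shows "best_approx (2 ^ Suc \<nu>) p f \<le> ennreal (54 * 2 ^ s) * (\<Sum>d. ennreal (1 / 2 ^ ((\<nu> + d) * s))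
    * series_mean p (1 - 1 / 2 ^ (\<nu> + d + 2)) (weighted (\<lambda>k. real k ^ s) F))"
proof -
  let ?H = "\<lambda>d. series_hardy_norm p (weighted (dyadic_block (Suc (\<nu> + d))) F)"
  define l where "l n k = (\<Sum>d<n. dyadic_block (Suc (\<nu> + d)) k)" for n k
  have l: "l n k = vallee_poussin (2 ^ (\<nu> + n)) k - vallee_poussin (2 ^ \<nu>) k" for n k
    by (induction n) (auto simp: l_def dyadic_block_def)
  have lb: "\<bar>l n k\<bar> \<le> 1" for n k
    using vallee_poussin_bounds[of "2 ^ (\<nu> + n)" k] vallee_poussin_bounds[of "2 ^ \<nu>" k] by (auto simp: l)
  have "series_mean p r (weighted (\<lambda>k. 1 - vallee_poussin (2 ^ \<nu>) k) F) \<le> (\<Sum>d. ?H d)" if r: "0 < r" "r < 1" for r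
    unfolding series_mean_def
  proof (rule integral_mean_limit_le[OF p])
    show "ball_measurable (\<lambda>z. \<Sum>k. weighted (l n) F k z)" for n
      by (intro ball_measurable_series homogeneous_series_weighted_bounded[OF F lb])
    show "(\<lambda>n. \<Sum>k. weighted (l n) F k z) \<longlonglongrightarrow> (\<Sum>k. weighted (\<lambda>k. 1 - vallee_poussin (2 ^ \<nu>) k) F k z)"
      if z: "z \<in> unit_ball" for z
      unfolding weighted_def
    proof (rule tendsto_series_weights[OF F z])
      show "(\<lambda>n. complex_of_real (l n k)) \<longlonglongrightarrow> of_real (1 - vallee_poussin (2 ^ \<nu>) k)" for k
      proof (rule tendsto_eventually, rule eventually_sequentiallyI[of k])
        fix n assume "k \<le> n"
        then have "k \<le> 2 ^ (\<nu> + n)"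
          using less_exp[of "\<nu> + n"] by linarith
        then show "complex_of_real (l n k) = of_real (1 - vallee_poussin (2 ^ \<nu>) k)"
          by (simp add: l vallee_poussin_low)
      qed
      show "norm (complex_of_real (l n k)) \<le> 1" for n k using lb by simp
    qed
    show "integral_mean p r (\<lambda>z. \<Sum>k. weighted (l n) F k z) \<le> (\<Sum>d. ?H d)" for n
    proof -
      have "weighted (l n) F = (\<lambda>k z. \<Sum>d<n. weighted (dyadic_block (Suc (\<nu> + d))) F k z)"
        by (simp add: weighted_def l_def sum_distrib_right)
      then have "series_mean p r (weighted (l n) F) \<le> (\<Sum>d<n. series_mean p r (weighted (dyadic_block (Suc (\<nu> + d))) F))"
        using r by (simp only:) (intro series_mean_sum p homogeneous_series_dyadic_block F; simp)
      also have "\<dots> \<le> (\<Sum>d<n. ?H d)"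
        using r by (intro sum_mono series_mean_le_hardy p homogeneous_series_dyadic_block F) auto
      also have "\<dots> \<le> (\<Sum>d. ?H d)"
        by (rule sum_le_suminf) auto
      finally show ?thesis by (simp add: series_mean_def)
    qed
  qed (use r in auto)
  then have "series_hardy_norm p (weighted (\<lambda>k. 1 - vallee_poussin (2 ^ \<nu>) k) F) \<le> (\<Sum>d. ?H d)"
    by (rule series_hardy_norm_le)
  with best_approx_le_vallee_poussin_error[OF F f, where n = "2 ^ \<nu>" and p = p]
  have "best_approx (2 ^ Suc \<nu>) p f \<le> (\<Sum>d. ?H d)"
    by simp
  also have "\<dots> \<le> (\<Sum>d. ennreal (54 * 2 ^ s) * (ennreal (1 / 2 ^ ((\<nu> + d) * s))
      * series_mean p (1 - 1 / 2 ^ (\<nu> + d + 2)) (weighted (\<lambda>k. real k ^ s) F)))"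
  proof (intro suminf_le)
    fix d
    show "?H d \<le> ennreal (54 * 2 ^ s) * (ennreal (1 / 2 ^ ((\<nu> + d) * s))
        * series_mean p (1 - 1 / 2 ^ (\<nu> + d + 2)) (weighted (\<lambda>k. real k ^ s) F))"
      using hardy_norm_block_le_radial_derivative[OF p F, of "\<nu> + d" s]
      by (simp add: ennreal_mult[symmetric] mult.assoc[symmetric])
  qed auto
  finally show ?thesis by simp
qed

section \<open>Dyadic form of the mixed norm\<close>

definition dyadic_interval :: "nat \<Rightarrow> real set" where
  "dyadic_interval n = {1 - 1 / 2 ^ n..<1 - 1 / 2 ^ Suc n}"

lemma inverse_power_2_le_1: "1 / 2 ^ n \<le> (1 :: real)"
  using one_le_power[of "2 :: real" n] by (simp add: divide_le_eq_1)

lemma dyadic_interval_bounds: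
  assumes "r \<in> dyadic_interval n"
  shows "0 \<le> r" "r < 1" "1 / 2 ^ Suc n \<le> 1 - r" "1 - r \<le> 1 / 2 ^ n"
    "1 / 2 ^ Suc n \<le> 1 - r\<^sup>2" "1 - r\<^sup>2 \<le> 2 / 2 ^ n"
proof -
  show r: "0 \<le> r"
    using assms inverse_power_2_le_1[of n]
    unfolding dyadic_interval_def atLeastLessThan_iff by linarith
  show lo: "1 / 2 ^ Suc n \<le> 1 - r" and hi: "1 - r \<le> 1 / 2 ^ n"
    using assms unfolding dyadic_interval_def atLeastLessThan_iff by linarith+
  have "(0 :: real) < 1 / 2 ^ Suc n" by simp
  with lo show r1: "r < 1" by linarith
  have eq: "1 - r\<^sup>2 = (1 - r) * (1 + r)" by (simp add: algebra_simps power2_eq_square)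
  have "(1 - r) * 1 \<le> (1 - r) * (1 + r)" "(1 - r) * (1 + r) \<le> (1 - r) * 2"
    using r r1 by (intro mult_left_mono; simp)+
  then have "1 - r \<le> 1 - r\<^sup>2" "1 - r\<^sup>2 \<le> 2 * (1 - r)" unfolding eq by (simp_all add: mult.commute)
  note le = this
  show "1 / 2 ^ Suc n \<le> 1 - r\<^sup>2" using lo le(1) by (rule order_trans)
  have "2 * (1 - r) \<le> 2 * (1 / 2 ^ n)" using hi by (rule mult_left_mono) simp
  with le(2) show "1 - r\<^sup>2 \<le> 2 / 2 ^ n" by simp
qed

lemma dyadic_interval_cover:
  assumes "0 \<le> r" "r < 1" obtains n where "r \<in> dyadic_interval n"
proof -
  have "\<exists>n. 1 - r > 1 / 2 ^ n"
    using real_arch_pow_inv[of "1 - r" "1 / 2"] assms by (auto simp: power_divide)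
  then have ex: "\<exists>n. 1 - r > 1 / 2 ^ n" .
  define m where "m = (LEAST n. 1 - r > 1 / 2 ^ n)"
  have m: "1 - r > 1 / 2 ^ m" unfolding m_def using ex by (rule LeastI_ex)
  have "m \<noteq> 0" using m assms by (intro notI) simp
  then obtain n where n: "m = Suc n" by (cases m) auto
  have "\<not> 1 - r > 1 / 2 ^ n"
    using not_less_Least[of n "\<lambda>n. 1 - r > 1 / 2 ^ n"] by (simp add: m_def[symmetric] n)
  with m have "r \<in> dyadic_interval n" by (simp add: dyadic_interval_def n)
  then show ?thesis by (rule that)
qed

lemma disjoint_dyadic_intervals: "disjoint_family dyadic_interval"
proof -
  have "dyadic_interval m \<inter> dyadic_interval n = {}" if "m < n" for m n
  proof -
    have "(2::real) ^ Suc m \<le> 2 ^ n" using that by (intro power_increasing) auto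
    then have "1 / 2 ^ n \<le> (1::real) / 2 ^ Suc m" by (intro divide_left_mono) auto
    then show ?thesis by (auto simp: dyadic_interval_def)
  qed
  then show ?thesis
    unfolding disjoint_family_on_def by (metis inf_commute linorder_neqE_nat)
qed

lemma emeasure_dyadic_interval: "emeasure lborel (dyadic_interval n) = ennreal (1 / 2 ^ Suc n)"
proof -
  have "1 - 1 / 2 ^ n \<le> 1 - (1::real) / 2 ^ Suc n" by (simp add: field_simps)
  then have "emeasure lborel (dyadic_interval n) = ennreal ((1 - 1 / 2 ^ Suc n) - (1 - 1 / 2 ^ n))"
    unfolding dyadic_interval_def by (rule emeasure_lborel_Ico)
  also have "(1 - 1 / 2 ^ Suc n) - (1 - 1 / 2 ^ n) = (1::real) / 2 ^ Suc n" by (simp add: field_simps)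
  finally show ?thesis .
qed

lemma nn_integral_dyadic_steps:
  "(\<integral>\<^sup>+ r. (\<Sum>n. c n * indicator (dyadic_interval (n + j)) r) \<partial>lborel) = (\<Sum>n. c n * ennreal (1 / 2 ^ Suc (n + j)))"
proof -
  have [measurable, simp]: "dyadic_interval n \<in> sets borel" for n by (simp add: dyadic_interval_def)
  show ?thesis
    by (subst nn_integral_suminf) (auto simp: nn_integral_cmult_indicator emeasure_dyadic_interval)
qed

lemma inverse_power_2_powr: "(1 / 2 ^ m) powr a = 2 powr (- a * real m)"
proof -
  have "1 / 2 ^ m = 2 powr (- real m)" by (simp add: powr_minus_divide powr_realpow)
  then show ?thesis by (simp add: powr_powr mult.commute)
qed

lemma powr_weight_split: "x powr (a - 1) = x powr a / x" if "0 < x" for x a :: real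
  using that by (simp add: powr_diff)

text \<open>Measurability matters because the essential supremum of a function that is not measurable is \<open>\<infinity>\<close> by convention.\<close>

lemma borel_measurable_mono_on_unit_interval:
  fixes h :: "real \<Rightarrow> ennreal"
  assumes mono: "\<And>r r'. 0 \<le> r \<Longrightarrow> r \<le> r' \<Longrightarrow> r' < 1 \<Longrightarrow> h r \<le> h r'"
  shows "h \<in> borel_measurable (restrict_space lborel {0..<1})"
proof (rule borel_measurableI_greater)
  fix y
  let ?S = "{r \<in> space (restrict_space lborel {0..<1}). y < h r}"
  have "is_interval ?S"
    unfolding is_interval_1
  proof (intro ballI allI impI)
    fix a b x assume ab: "a \<in> ?S" "b \<in> ?S" "a \<le> x \<and> x \<le> b"
    then have x: "0 \<le> a" "a \<le> x" "x < 1" by (auto simp: space_restrict_space)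
    have "y < h a" using ab by auto
    also have "h a \<le> h x" by (rule mono[OF x])
    finally show "x \<in> ?S" using x by (auto simp: space_restrict_space)
  qed
  then have "?S \<in> sets borel" by (rule real_interval_borel_measurable)
  then show "?S \<in> sets (restrict_space lborel {0..<1})"
    by (subst sets_restrict_space_iff) (auto simp: space_restrict_space)
qed

text \<open>On the interval \<open>[1 - 2\<^sup>-\<^sup>n, 1 - 2\<^sup>-\<^sup>n\<^sup>-\<^sup>1)\<close> the weight \<open>(1 - r\<^sup>2)\<^sup>q\<^sup>\<beta>\<^sup>-\<^sup>1\<close> is comparable to
  \<open>2\<^sup>-\<^sup>n\<^sup>q\<^sup>\<beta>\<close> divided by the length, so that the norm is comparable to an \<open>\<ell>\<^sup>q\<close> norm of sampled means.  The bound from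
  below needs \<open>r\<close> to stay away from \<open>0\<close>, where \<open>r\<^sup>2\<^sup>N\<^sup>-\<^sup>1\<close> vanishes; it starts at \<open>r = 3/4\<close>.\<close>

lemma mixed_norm_finite_imp_ell:
  fixes g :: "complex ^ 'n \<Rightarrow> complex"
  assumes q: "1 \<le> q" and \<beta>: "0 < \<beta>"
    and mono: "\<And>r r'. 0 \<le> r \<Longrightarrow> r \<le> r' \<Longrightarrow> r' < 1 \<Longrightarrow> integral_mean p r g \<le> integral_mean p r' g"
    and fin: "mixed_norm p q \<beta> g < \<infinity>"
  shows "(\<lambda>n. ennreal (2 powr (- \<beta> * real n)) * integral_mean p (1 - 1 / 2 ^ (n + 2)) g) \<in> ell q"
proof -
  define \<Phi> where "\<Phi> r = integral_mean p r g" for r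
  define a where "a n = ennreal (2 powr (- \<beta> * real n)) * \<Phi> (1 - 1 / 2 ^ (n + 2))" for n
  have node: "\<Phi> (1 - 1 / 2 ^ (n + 2)) \<le> \<Phi> r" if "r \<in> dyadic_interval (n + 2)" for n r
    unfolding \<Phi>_def using that dyadic_interval_bounds(2)[OF that]
    using inverse_power_2_le_1[of "n + 2"] by (intro mono) (auto simp: dyadic_interval_def)
  have "a \<in> ell q"
  proof (cases "q = \<infinity>")
    case True
    define K where "K = mixed_norm p q \<beta> g"
    have "AE r in restrict_space lborel {0..<1}. ennreal ((1 - r\<^sup>2) powr \<beta>) * \<Phi> r \<le> K"
      unfolding K_def mixed_norm_def \<Phi>_def using True esssup_AE by simp
    then have AE: "AE r in lborel. r \<in> {0..<1} \<longrightarrow> ennreal ((1 - r\<^sup>2) powr \<beta>) * \<Phi> r \<le> K"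
      by (subst (asm) AE_restrict_space_iff) auto
    \<comment> \<open>the interval has positive measure, so that it contains a point where the bound holds\<close>
    have "a n \<le> ennreal (2 powr (3 * \<beta>)) * K" for n
    proof -
      obtain r where r: "r \<in> dyadic_interval (n + 2)" "ennreal ((1 - r\<^sup>2) powr \<beta>) * \<Phi> r \<le> K"
      proof (rule ccontr)
        assume "\<not> thesis"
        then have no: "\<not> (ennreal ((1 - r\<^sup>2) powr \<beta>) * \<Phi> r \<le> K)" if "r \<in> dyadic_interval (n + 2)" for r
          using \<open>\<And>r. r \<in> dyadic_interval (n + 2) \<Longrightarrow> ennreal ((1 - r\<^sup>2) powr \<beta>) * \<Phi> r \<le> K \<Longrightarrow> thesis\<close> that by blast
        have "AE r in lborel. r \<notin> dyadic_interval (n + 2)"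
          using AE by eventually_elim (use no dyadic_interval_bounds(1,2) in auto)
        moreover have "dyadic_interval (n + 2) \<in> sets lborel" by (simp add: dyadic_interval_def)
        ultimately have "emeasure lborel (dyadic_interval (n + 2)) = 0"
          using AE_iff_null_sets null_setsD1 by blast
        then show False by (simp add: emeasure_dyadic_interval)
      qed
      have "2 powr (- \<beta> * real n) = 2 powr (3 * \<beta>) * (1 / 2 ^ Suc (n + 2)) powr \<beta>"
        unfolding inverse_power_2_powr by (simp add: algebra_simps flip: powr_add)
      also have "\<dots> \<le> 2 powr (3 * \<beta>) * (1 - r\<^sup>2) powr \<beta>"
        using dyadic_interval_bounds(5)[OF r(1)] \<beta> by (intro mult_left_mono powr_mono2) auto
      finally have "a n \<le> ennreal (2 powr (3 * \<beta>) * (1 - r\<^sup>2) powr \<beta>) * \<Phi> r"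
        unfolding a_def by (intro mult_mono ennreal_leI node r) auto
      also have "\<dots> = ennreal (2 powr (3 * \<beta>)) * (ennreal ((1 - r\<^sup>2) powr \<beta>) * \<Phi> r)"
        by (simp add: ennreal_mult mult.assoc)
      also have "\<dots> \<le> ennreal (2 powr (3 * \<beta>)) * K"
        by (intro mult_left_mono r) auto
      finally show ?thesis .
    qed
    then have "(SUP n. a n) \<le> ennreal (2 powr (3 * \<beta>)) * K" by (rule SUP_least)
    also have "\<dots> < \<infinity>" using fin by (simp add: K_def ennreal_mult_less_top)
    finally show ?thesis using True by (simp add: ell_def)
  next
    case False
    define Q where "Q = enn2real q"
    have Q: "1 \<le> Q" using enn2real_ge_1[OF q] False by (simp add: Q_def)
    define w where "w r = (1 - r\<^sup>2) powr (Q * \<beta> - 1) * r ^ (2 * CARD('n) - 1)" for r :: real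
    define c where "c = 2 powr (- 3 * Q * \<beta>) * (1 / 2) ^ (2 * CARD('n) - 1)"
    have c: "0 < c" by (simp add: c_def)
    have w: "c * 2 powr (- \<beta> * real n * Q) * (2 ^ (n + 2) / 2) \<le> w r" if r: "r \<in> dyadic_interval (n + 2)" for n r
    proof -
      note b = dyadic_interval_bounds[OF r]
      have half: "1 / 2 \<le> r"
      proof -
        have "(1::real) / 2 ^ (n + 2) \<le> 1 / 2"
          using inverse_power_2_le_1[of "n + 1"] by simp
        with b(4) show ?thesis by linarith
      qed
      have pos: "0 < 1 - r\<^sup>2" using b(5) by (rule less_le_trans[rotated]) simp
      have "2 powr (- 3 * Q * \<beta>) * 2 powr (- \<beta> * real n * Q) = (1 / 2 ^ Suc (n + 2)) powr (Q * \<beta>)"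
        unfolding inverse_power_2_powr by (simp add: algebra_simps flip: powr_add)
      also have "\<dots> \<le> (1 - r\<^sup>2) powr (Q * \<beta>)"
        using b(5) \<beta> Q by (intro powr_mono2) auto
      finally have 1: "2 powr (- 3 * Q * \<beta>) * 2 powr (- \<beta> * real n * Q) \<le> (1 - r\<^sup>2) powr (Q * \<beta>)" .
      have 2: "2 ^ (n + 2) / 2 \<le> 1 / (1 - r\<^sup>2)"
        using b(6) pos by (simp add: field_simps)
      have 3: "(1 / 2) ^ (2 * CARD('n) - 1) \<le> r ^ (2 * CARD('n) - 1)"
        using half by (intro power_mono) auto
      have "(2 powr (- 3 * Q * \<beta>) * 2 powr (- \<beta> * real n * Q)) * (2 ^ (n + 2) / 2) * (1 / 2) ^ (2 * CARD('n) - 1)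
          \<le> (1 - r\<^sup>2) powr (Q * \<beta>) * (1 / (1 - r\<^sup>2)) * r ^ (2 * CARD('n) - 1)"
        using pos by (intro mult_mono 1 2 3) auto
      then show ?thesis using pos by (simp add: c_def w_def powr_weight_split mult_ac)
    qed
    define h where "h n = ennreal (c * 2 ^ (n + 2) / 2) * ennpowr (a n) Q" for n
    have step: "(\<Sum>n. h n * indicator (dyadic_interval (n + 2)) r)
        \<le> ennpowr (\<Phi> r) Q * ennreal (w r) * indicator {0<..<1} r" for r
    proof (cases "\<exists>n. r \<in> dyadic_interval (n + 2)")
      case True
      then obtain n where n: "r \<in> dyadic_interval (n + 2)" by blast
      have "disjoint_family (\<lambda>n. dyadic_interval (n + 2))"
        using disjoint_dyadic_intervals by (auto simp: disjoint_family_on_def)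
      then have "(\<Sum>n. h n * indicator (dyadic_interval (n + 2)) r) = h n"
        using n by (rule suminf_cmult_indicator)
      also have "\<dots> = ennreal (c * 2 powr (- \<beta> * real n * Q) * (2 ^ (n + 2) / 2)) * ennpowr (\<Phi> (1 - 1 / 2 ^ (n + 2))) Q"
        using Q c by (simp add: h_def a_def ennpowr_mult ennpowr_ennreal powr_powr mult.assoc[symmetric]
            flip: ennreal_mult) (simp add: mult_ac)
      also have "\<dots> \<le> ennreal (w r) * ennpowr (\<Phi> r) Q"
        using Q by (intro mult_mono ennreal_leI w n ennpowr_mono node) auto
      also have "\<dots> = ennpowr (\<Phi> r) Q * ennreal (w r) * indicator {0<..<1} r"
      proof -
        have "(1::real) / 2 ^ (n + 2) \<le> 1 / 2"
          using inverse_power_2_le_1[of "n + 1"] by simp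
        then have "0 < r" using dyadic_interval_bounds(4)[OF n] by linarith
        then show ?thesis using dyadic_interval_bounds(2)[OF n] by (simp add: mult.commute)
      qed
      finally show ?thesis .
    qed simp
    have "ennreal (c / 4) * (\<Sum>n. ennpowr (a n) Q) = (\<Sum>n. h n * ennreal (1 / 2 ^ Suc (n + 2)))"
    proof -
      have "ennreal (c / 4) * ennpowr (a n) Q = h n * ennreal (1 / 2 ^ Suc (n + 2))" for n
      proof -
        have "c / 4 = (c * 2 ^ (n + 2) / 2) * (1 / 2 ^ Suc (n + 2))" by (simp add: field_simps)
        then show ?thesis using c
          unfolding h_def by (simp only: mult.assoc mult.commute[of "ennpowr _ _"])
            (simp add: ennreal_mult[symmetric] mult.assoc[symmetric] del: power_Suc)
      qed
      then show ?thesis by (simp only: ennreal_suminf_cmult[symmetric])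
    qed
    also have "\<dots> = (\<integral>\<^sup>+ r. (\<Sum>n. h n * indicator (dyadic_interval (n + 2)) r) \<partial>lborel)"
      by (rule nn_integral_dyadic_steps[symmetric])
    also have "\<dots> \<le> (\<integral>\<^sup>+ r. ennpowr (\<Phi> r) Q * ennreal (w r) * indicator {0<..<1} r \<partial>lborel)"
      by (intro nn_integral_mono step)
    also have "\<dots> < \<infinity>"
    proof -
      have "2 * of_nat CARD('n) * (\<integral>\<^sup>+ r. ennpowr (\<Phi> r) Q * ennreal (w r) * indicator {0<..<1} r \<partial>lborel) < top"
        using fin False by (simp add: mixed_norm_def ennpowr_less_top_iff \<Phi>_def Q_def w_def)
      then show ?thesis by (auto simp: ennreal_mult_less_top)
    qed
    finally have "(\<Sum>n. ennpowr (a n) Q) < \<infinity>" using c by (auto simp: ennreal_mult_less_top)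
    then show ?thesis using False by (simp add: ell_def Q_def)
  qed
  then show ?thesis by (simp add: a_def[abs_def] \<Phi>_def)
qed

text \<open>Conversely, a bound that is constant on each dyadic interval is integrated exactly.\<close>

lemma ell_imp_mixed_norm_finite:
  fixes g :: "complex ^ 'n \<Rightarrow> complex"
  assumes q: "1 \<le> q" and \<beta>: "0 < \<beta>"
    and mono: "\<And>r r'. 0 \<le> r \<Longrightarrow> r \<le> r' \<Longrightarrow> r' < 1 \<Longrightarrow> integral_mean p r g \<le> integral_mean p r' g"
    and bound: "\<And>n r. r \<in> dyadic_interval n \<Longrightarrow> integral_mean p r g \<le> B n"
    and ell: "(\<lambda>n. ennreal (2 powr (- \<beta> * real n)) * B n) \<in> ell q"
  shows "mixed_norm p q \<beta> g < \<infinity>"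
proof (cases "q = \<infinity>")
  case True
  define K where "K = (SUP n. ennreal (2 powr (- \<beta> * real n)) * B n)"
  have K: "K < top" using ell True by (simp add: ell_def K_def)
  have "esssup (restrict_space lborel {0..<1}) (\<lambda>r. ennreal ((1 - r\<^sup>2) powr \<beta>) * integral_mean p r g)
      \<le> ennreal (2 powr \<beta>) * K"
  proof (rule esssup_I)
    have "(\<lambda>r. ennreal ((1 - r\<^sup>2) powr \<beta>)) \<in> borel_measurable (restrict_space lborel {0..<1})"
      by (rule measurable_restrict_space1) measurable
    then show "(\<lambda>r. ennreal ((1 - r\<^sup>2) powr \<beta>) * integral_mean p r g) \<in> borel_measurable (restrict_space lborel {0..<1})"
      by (rule borel_measurable_times_ennreal[OF _ borel_measurable_mono_on_unit_interval[OF mono]])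
    show "AE r in restrict_space lborel {0..<1}. ennreal ((1 - r\<^sup>2) powr \<beta>) * integral_mean p r g \<le> ennreal (2 powr \<beta>) * K"
    proof (rule AE_I2)
      fix r assume "r \<in> space (restrict_space lborel {0..<1::real})"
      then have r: "0 \<le> r" "r < 1" by (auto simp: space_restrict_space)
      obtain n where n: "r \<in> dyadic_interval n" using dyadic_interval_cover[OF r] .
      have "0 \<le> 1 - r\<^sup>2" using dyadic_interval_bounds(5)[OF n] by (rule order_trans[rotated]) simp
      then have "(1 - r\<^sup>2) powr \<beta> \<le> (2 / 2 ^ n) powr \<beta>"
        using dyadic_interval_bounds(6)[OF n] \<beta> by (intro powr_mono2) auto
      also have "\<dots> = 2 powr \<beta> * 2 powr (- \<beta> * real n)"
        using powr_mult[of 2 "1 / 2 ^ n" \<beta>] by (simp add: inverse_power_2_powr del: power_Suc)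
      finally have "ennreal ((1 - r\<^sup>2) powr \<beta>) * integral_mean p r g
          \<le> ennreal (2 powr \<beta> * 2 powr (- \<beta> * real n)) * B n"
        by (intro mult_mono ennreal_leI bound n) auto
      also have "\<dots> = ennreal (2 powr \<beta>) * (ennreal (2 powr (- \<beta> * real n)) * B n)"
        by (simp add: ennreal_mult mult.assoc)
      also have "\<dots> \<le> ennreal (2 powr \<beta>) * K"
        unfolding K_def by (intro mult_left_mono SUP_upper) auto
      finally show "ennreal ((1 - r\<^sup>2) powr \<beta>) * integral_mean p r g \<le> ennreal (2 powr \<beta>) * K" .
    qed
  qed
  also have "\<dots> < top" using K by (simp add: ennreal_mult_less_top)
  finally show ?thesis using True by (simp add: mixed_norm_def)
next
  case False
  define Q where "Q = enn2real q"
  have Q: "1 \<le> Q" using enn2real_ge_1[OF q] False by (simp add: Q_def)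
  define a where "a n = ennreal (2 powr (- \<beta> * real n)) * B n" for n
  define w where "w r = (1 - r\<^sup>2) powr (Q * \<beta> - 1) * r ^ (2 * CARD('n) - 1)" for r :: real
  define h where "h n = ennreal (2 powr (Q * \<beta>) * 2 ^ Suc n) * ennpowr (a n) Q" for n
  have w: "w r \<le> 2 powr (Q * \<beta>) * 2 powr (- \<beta> * real n * Q) * 2 ^ Suc n" if r: "r \<in> dyadic_interval n" for n r
  proof -
    note b = dyadic_interval_bounds[OF r]
    have pos: "0 < 1 - r\<^sup>2" using b(5) by (rule less_le_trans[rotated]) simp
    have "(1 - r\<^sup>2) powr (Q * \<beta>) \<le> (2 / 2 ^ n) powr (Q * \<beta>)"
      using b(6) pos \<beta> Q by (intro powr_mono2) auto
    also have "\<dots> = 2 powr (Q * \<beta>) * 2 powr (- \<beta> * real n * Q)"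
      using powr_mult[of 2 "1 / 2 ^ n" "Q * \<beta>"] unfolding inverse_power_2_powr by (simp add: mult_ac)
    finally have 1: "(1 - r\<^sup>2) powr (Q * \<beta>) \<le> 2 powr (Q * \<beta>) * 2 powr (- \<beta> * real n * Q)" .
    have 2: "1 / (1 - r\<^sup>2) \<le> 2 ^ Suc n"
      using b(5) pos by (simp add: field_simps)
    have 3: "r ^ (2 * CARD('n) - 1) \<le> 1" using b(1,2) by (intro power_le_one) auto
    have "(1 - r\<^sup>2) powr (Q * \<beta>) * (1 / (1 - r\<^sup>2)) * r ^ (2 * CARD('n) - 1)
        \<le> 2 powr (Q * \<beta>) * 2 powr (- \<beta> * real n * Q) * 2 ^ Suc n * 1"
      using pos b(1) by (intro mult_mono 1 2 3) auto
    then show ?thesis using pos by (simp add: w_def powr_weight_split)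
  qed
  have step: "ennpowr (integral_mean p r g) Q * ennreal (w r) * indicator {0<..<1} r
      \<le> (\<Sum>n. h n * indicator (dyadic_interval (n + 0)) r)" for r
  proof (cases "0 < r \<and> r < 1")
    case True
    then obtain n where n: "r \<in> dyadic_interval n" using dyadic_interval_cover[of r] by auto
    have "ennpowr (integral_mean p r g) Q * ennreal (w r) * indicator {0<..<1} r
        = ennpowr (integral_mean p r g) Q * ennreal (w r)" using True by simp
    also have "\<dots> \<le> ennpowr (B n) Q * ennreal (2 powr (Q * \<beta>) * 2 powr (- \<beta> * real n * Q) * 2 ^ Suc n)"
      using Q by (intro mult_mono ennreal_leI w n ennpowr_mono bound) auto
    also have "\<dots> = h n"
      using Q by (simp add: h_def a_def ennpowr_mult ennpowr_ennreal powr_powr ennreal_mult mult_ac)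
    also have "\<dots> = (\<Sum>n. h n * indicator (dyadic_interval (n + 0)) r)"
      using suminf_cmult_indicator[OF disjoint_dyadic_intervals n, of h] by simp
    finally show ?thesis .
  qed auto
  have "(\<integral>\<^sup>+ r. ennpowr (integral_mean p r g) Q * ennreal (w r) * indicator {0<..<1} r \<partial>lborel)
      \<le> (\<integral>\<^sup>+ r. (\<Sum>n. h n * indicator (dyadic_interval (n + 0)) r) \<partial>lborel)"
    by (intro nn_integral_mono step)
  also have "\<dots> = (\<Sum>n. h n * ennreal (1 / 2 ^ Suc (n + 0)))"
    by (rule nn_integral_dyadic_steps)
  also have "\<dots> = (\<Sum>n. ennreal (2 powr (Q * \<beta>)) * ennpowr (a n) Q)"
  proof (rule suminf_cong)
    fix n
    have "ennreal (2 powr (Q * \<beta>) * 2 ^ Suc n) * ennreal (1 / 2 ^ Suc n) = ennreal (2 powr (Q * \<beta>))"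
      by (simp flip: ennreal_mult)
    then show "h n * ennreal (1 / 2 ^ Suc (n + 0)) = ennreal (2 powr (Q * \<beta>)) * ennpowr (a n) Q"
      unfolding h_def by (metis add_0_right mult.assoc mult.commute)
  qed
  also have "\<dots> = ennreal (2 powr (Q * \<beta>)) * (\<Sum>n. ennpowr (a n) Q)" by simp
  also have "\<dots> < top"
    using ell False by (simp add: ell_def a_def Q_def ennreal_mult_less_top)
  finally show ?thesis
    using False by (simp add: mixed_norm_def ennpowr_less_top_iff Q_def w_def ennreal_mult_less_top of_nat_less_top)
qed

section \<open>Smoothness and rate of approximation\<close>

lemma ell_Suc_iff: "x \<in> ell q \<longleftrightarrow> x 0 < \<infinity> \<and> (\<lambda>n. x (Suc n)) \<in> ell q"
proof (cases "q = \<infinity>")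
  case True
  have "(SUP n. x n) = sup (x 0) (SUP n. x (Suc n))"
  proof (rule antisym)
    show "(SUP n. x n) \<le> sup (x 0) (SUP n. x (Suc n))"
    proof (rule SUP_least)
      show "x n \<le> sup (x 0) (SUP n. x (Suc n))" for n
      proof (cases n)
        case (Suc m)
        then show ?thesis by (intro le_supI2 SUP_upper2[of m]) auto
      qed (simp add: le_supI1)
    qed
    show "sup (x 0) (SUP n. x (Suc n)) \<le> (SUP n. x n)"
      by (intro sup_least SUP_least SUP_upper) auto
  qed
  then show ?thesis using True by (auto simp: ell_def sup_max)
next
  case False
  have "(\<Sum>n. ennpowr (x n) (enn2real q)) = (\<Sum>n. ennpowr (x (Suc n)) (enn2real q)) + ennpowr (x 0) (enn2real q)"
    using suminf_offset[of "\<lambda>n. ennpowr (x n) (enn2real q)" 1] by (simp add: add.commute)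
  then show ?thesis using False by (auto simp: ell_def ennpowr_less_top_iff)
qed

theorem theorem3p1:
  fixes p q :: ennreal and \<alpha> :: real and f :: "complex ^ 'n \<Rightarrow> complex"
  assumes "1 \<le> p" and "1 \<le> q" and "\<alpha> > 0"
    and "f \<in> hardy_space p"
  shows "f \<in> Lambda_space p q \<alpha> \<longleftrightarrow>
         (\<lambda>\<nu>. ennreal (2 powr (real \<nu> * \<alpha>)) * best_approx (2 ^ \<nu>) p f) \<in> ell q"
proof -
  have hol: "holomorphic_cvec_on f unit_ball" and hardy: "hardy_norm p f < \<infinity>"
    using assms(4) by (auto simp: hardy_space_def)
  define F where "F = homogeneous_part f"
  have exp: "homogeneous_expansion f F"
    unfolding F_def by (rule homogeneous_expansion_homogeneous_part[OF hol])
  then have F: "homogeneous_series F" and f: "\<And>z. z \<in> unit_ball \<Longrightarrow> f z = (\<Sum>k. F k z)"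
    by (auto simp: homogeneous_series_def homogeneous_expansion_def sums_iff)
  define s where "s = nat (\<lfloor>\<alpha>\<rfloor> + 1)"
  have s: "1 \<le> s" "\<alpha> < real s" using assms(3) by (auto simp: s_def) linarith+
  have least: "real_of_int (LEAST k :: int. \<alpha> < real_of_int k) = real s"
  proof -
    have "(LEAST k :: int. \<alpha> < real_of_int k) = \<lfloor>\<alpha>\<rfloor> + 1"
      by (rule Least_equality) linarith+
    then show ?thesis using assms(3) by (simp add: s_def)
  qed
  define \<beta> where "\<beta> = real s - \<alpha>"
  have \<beta>: "0 < \<beta>" using s by (simp add: \<beta>_def)
  define R where "R = weighted (\<lambda>k. real k ^ s) F"
  have R: "homogeneous_series R"
    unfolding R_def by (rule homogeneous_series_weighted_power[OF F])
  define g where "g = radial_derivative (real s) f"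
  have g: "integral_mean p r g = series_mean p r R" if "0 \<le> r" "r < 1" for r
    unfolding series_mean_def
  proof (rule integral_mean_cong[OF that])
    fix z :: "complex ^ 'n" assume z: "z \<in> unit_ball"
    have "summable (\<lambda>k. R k z)" using R z by (auto simp: homogeneous_series_def)
    then have "(\<Sum>k. R k z) = (\<Sum>k. R (Suc k) z) + R 0 z"
      by (subst suminf_split_head) auto
    also have "R 0 z = 0" using s by (simp add: R_def weighted_def)
    finally show "g z = (\<Sum>k. R k z)"
      by (simp add: g_def radial_derivative_def R_def weighted_def F_def powr_realpow)
  qed
  have mono: "integral_mean p r g \<le> integral_mean p r' g" if "0 \<le> r" "r \<le> r'" "r' < 1" for r r'
    using that series_mean_mono[OF assms(1) R that] by (simp add: g)
  have Lambda: "f \<in> Lambda_space p q \<alpha> \<longleftrightarrow> mixed_norm p q \<beta> g < \<infinity>"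
    by (simp add: Lambda_space_def hol least Let_def \<beta>_def g_def)
  let ?X = "\<lambda>\<nu>. ennreal (2 powr (real \<nu> * \<alpha>)) * best_approx (2 ^ \<nu>) p f"
  have X0: "?X 0 < \<infinity>"
    using best_approx_le_hardy_norm[of 1 p f] hardy by simp
  have pow: "(2 powr (- x)) ^ d = 2 powr (- x * real d)" "2 ^ d = (2 :: real) powr real d" for x d
    by (simp_all add: powr_realpow powr_powr flip: powr_realpow[of "2 powr (- x)"])
  show ?thesis
  proof
    assume "f \<in> Lambda_space p q \<alpha>"
    define y where "y n = ennreal (2 powr (- \<beta> * real n)) * series_mean p (1 - 1 / 2 ^ (n + 2)) R" for n
    have y: "y \<in> ell q"
    proof -
      have "(\<lambda>n. ennreal (2 powr (- \<beta> * real n)) * integral_mean p (1 - 1 / 2 ^ (n + 2)) g) \<in> ell q"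
        using \<open>f \<in> Lambda_space p q \<alpha>\<close> Lambda by (intro mixed_norm_finite_imp_ell assms \<beta> mono) auto
      moreover have "integral_mean p (1 - 1 / 2 ^ (n + 2)) g = series_mean p (1 - 1 / 2 ^ (n + 2)) R" for n
        using inverse_power_2_le_1[of "n + 2"] by (intro g) auto
      ultimately show ?thesis by (simp only: y_def[abs_def])
    qed
    \<comment> \<open>\<open>2\<^sup>\<nu>\<^sup>\<alpha> 2\<^sup>-\<^sup>(\<^sup>\<nu>\<^sup>+\<^sup>d\<^sup>)\<^sup>s = 2\<^sup>-\<^sup>d\<^sup>\<alpha> 2\<^sup>-\<^sup>\<beta>\<^sup>(\<^sup>\<nu>\<^sup>+\<^sup>d\<^sup>)\<close>, so the weighted errors are bounded by a geometric tail of \<open>y\<close>\<close>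
    let ?T = "\<lambda>n. \<Sum>d. ennreal ((2 powr (- \<alpha>)) ^ d) * y (n + d)"
    have T: "?T \<in> ell q"
      using assms y by (intro ell_geometric_tail) (auto intro!: powr_less_one)
    have "?X (Suc \<nu>) \<le> ennreal (2 powr \<alpha> * (54 * 2 ^ s)) * ?T \<nu>" for \<nu>
    proof -
      have split: "2 powr (real (Suc \<nu>) * \<alpha>) = 2 powr \<alpha> * 2 powr (real \<nu> * \<alpha>)"
        by (simp add: algebra_simps powr_add)
      have "?X (Suc \<nu>) \<le> ennreal (2 powr \<alpha> * 2 powr (real \<nu> * \<alpha>)) * (ennreal (54 * 2 ^ s) *
          (\<Sum>d. ennreal (1 / 2 ^ ((\<nu> + d) * s)) * series_mean p (1 - 1 / 2 ^ (\<nu> + d + 2)) R))"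
        unfolding R_def split by (intro mult_left_mono best_approx_le_radial_derivative assms F f) auto
      also have "ennreal (2 powr \<alpha> * 2 powr (real \<nu> * \<alpha>)) * (ennreal (54 * 2 ^ s) *
          (\<Sum>d. ennreal (1 / 2 ^ ((\<nu> + d) * s)) * series_mean p (1 - 1 / 2 ^ (\<nu> + d + 2)) R))
          = ennreal (2 powr \<alpha> * (54 * 2 ^ s)) * (\<Sum>d. ennreal (2 powr (real \<nu> * \<alpha>)) *
          (ennreal (1 / 2 ^ ((\<nu> + d) * s)) * series_mean p (1 - 1 / 2 ^ (\<nu> + d + 2)) R))"
        by (simp add: ennreal_mult mult_ac)
      also have "(\<lambda>d. ennreal (2 powr (real \<nu> * \<alpha>)) *
          (ennreal (1 / 2 ^ ((\<nu> + d) * s)) * series_mean p (1 - 1 / 2 ^ (\<nu> + d + 2)) R))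
          = (\<lambda>d. ennreal ((2 powr (- \<alpha>)) ^ d) * y (\<nu> + d))"
      proof
        fix d
        have "2 powr (real \<nu> * \<alpha>) * (1 / 2 ^ ((\<nu> + d) * s)) = (2 powr (- \<alpha>)) ^ d * 2 powr (- \<beta> * real (\<nu> + d))"
          unfolding pow by (simp add: \<beta>_def algebra_simps flip: powr_add powr_minus_divide)
        then show "ennreal (2 powr (real \<nu> * \<alpha>)) *
          (ennreal (1 / 2 ^ ((\<nu> + d) * s)) * series_mean p (1 - 1 / 2 ^ (\<nu> + d + 2)) R)
          = ennreal ((2 powr (- \<alpha>)) ^ d) * y (\<nu> + d)"
          by (simp add: y_def mult.assoc[symmetric] flip: ennreal_mult)
      qed
      finally show ?thesis .
    qed
    moreover have "(\<lambda>\<nu>. ennreal (2 powr \<alpha> * (54 * 2 ^ s)) * ?T \<nu>) \<in> ell q"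
      by (rule ell_cmult[OF T assms(2)]) simp
    ultimately have "(\<lambda>\<nu>. ?X (Suc \<nu>)) \<in> ell q"
      by (rule ell_mono[OF _ assms(2), rotated])
    then show "?X \<in> ell q"
      using X0 by (subst ell_Suc_iff) auto
  next
    assume X: "?X \<in> ell q"
    define y where "y \<nu> = ennreal (2 powr (real \<nu> * \<alpha>)) * approx_level p f \<nu>" for \<nu>
    have "y (Suc \<nu>) = ennreal (2 powr \<alpha>) * ?X \<nu>" for \<nu>
      by (simp add: y_def approx_level_def algebra_simps powr_add ennreal_mult)
    moreover have "y 0 < \<infinity>" using hardy by (simp add: y_def approx_level_def)
    ultimately have y: "y \<in> ell q"
      using ell_cmult[OF X assms(2), of "ennreal (2 powr \<alpha>)"] by (subst ell_Suc_iff) auto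
    define C where "C = 8 * 4 ^ s + 4 * (16 * real s) ^ s"
    define B where "B n = ennreal C * (\<Sum>\<nu>\<le>n. ennreal (2 ^ (\<nu> * s)) * approx_level p f \<nu>)" for n
    have "integral_mean p r g \<le> B n" if r: "r \<in> dyadic_interval n" for n r
      using radial_derivative_le_best_approx[OF assms(1) F dyadic_interval_bounds(1,2)[OF r] s(1) f
          dyadic_interval_bounds(3)[OF r]]
      by (simp only: g[OF dyadic_interval_bounds(1,2)[OF r]] R_def B_def C_def)
    moreover have "(\<lambda>n. ennreal (2 powr (- \<beta> * real n)) * B n) \<in> ell q"
    proof -
      \<comment> \<open>\<open>2\<^sup>-\<^sup>\<beta>\<^sup>n 2\<^sup>\<nu>\<^sup>s = 2\<^sup>-\<^sup>\<beta>\<^sup>(\<^sup>n\<^sup>-\<^sup>\<nu>\<^sup>) 2\<^sup>\<nu>\<^sup>\<alpha>\<close>\<close>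
      have "ennreal (2 powr (- \<beta> * real n)) * B n
          = ennreal C * (\<Sum>\<nu>\<le>n. ennreal ((2 powr (- \<beta>)) ^ (n - \<nu>)) * y \<nu>)" for n
      proof -
        have "ennreal (2 powr (- \<beta> * real n)) * (ennreal (2 ^ (\<nu> * s)) * approx_level p f \<nu>)
            = ennreal ((2 powr (- \<beta>)) ^ (n - \<nu>)) * y \<nu>" if "\<nu> \<le> n" for \<nu>
        proof -
          have "2 powr (- \<beta> * real n) * 2 ^ (\<nu> * s) = (2 powr (- \<beta>)) ^ (n - \<nu>) * 2 powr (real \<nu> * \<alpha>)"
            unfolding pow using that by (simp add: \<beta>_def of_nat_diff algebra_simps flip: powr_add)
          then show ?thesis by (simp add: y_def mult.assoc[symmetric] flip: ennreal_mult)
        qed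
        then have "(\<Sum>\<nu>\<le>n. ennreal (2 powr (- \<beta> * real n)) * (ennreal (2 ^ (\<nu> * s)) * approx_level p f \<nu>))
            = (\<Sum>\<nu>\<le>n. ennreal ((2 powr (- \<beta>)) ^ (n - \<nu>)) * y \<nu>)"
          by (intro sum.cong) auto
        then have "ennreal (2 powr (- \<beta> * real n)) * (\<Sum>\<nu>\<le>n. ennreal (2 ^ (\<nu> * s)) * approx_level p f \<nu>)
            = (\<Sum>\<nu>\<le>n. ennreal ((2 powr (- \<beta>)) ^ (n - \<nu>)) * y \<nu>)"
          by (simp only: sum_distrib_left)
        then show ?thesis
          unfolding B_def mult.left_commute[of "ennreal (2 powr (- \<beta> * real n))"] by (simp only:)
      qed
      moreover have "(\<lambda>n. ennreal C * (\<Sum>\<nu>\<le>n. ennreal ((2 powr (- \<beta>)) ^ (n - \<nu>)) * y \<nu>)) \<in> ell q"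
        using y \<beta> assms by (intro ell_cmult ell_geometric_head) (auto intro!: powr_less_one)
      ultimately show ?thesis by simp
    qed
    ultimately show "f \<in> Lambda_space p q \<alpha>"
      unfolding Lambda by (intro ell_imp_mixed_norm_finite assms \<beta> mono)
  qed
qed

end
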